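(* Under the hypotheses (F1)–(F4), (G1)–(G2) of the context, for each $\ell>0$ the dynamical system $(\mathcal{H},S_\ell(t))$ generated by the Bresse system has a global attractor $\mathbf{A}_\ell$. In addition, $\mathbf{A}_\ell=\mathbb{M}_+(\mathcal{N}_\ell)$, the unstable manifold emanating from the set $\mathcal{N}_\ell$ of stationary points of $S_\ell(t)$.
   Context: Fix $L>0$, $\rho_1,\rho_2,b,k,k_0>0$, $\ell>0$; $\|\cdot\|$ is the $L^2(0,L)$ norm; $\mathcal{H}=H^1_0(0,L)^3\times L^2(0,L)^3$ with the standard product norm. The Bresse system is $\rho_1\varphi_{tt}-k(\varphi_x+\psi+\ell w)_x-k_0\ell(w_x-\ell\varphi)+g_1(\varphi_t)+f_1(\varphi,\psi,w)=0$, $\rho_2\psi_{tt}-b\psi_{xx}+k(\varphi_x+\psi+\ell w)+g_2(\psi_t)+f_2(\varphi,\psi,w)=0$, $\rho_1w_{tt}-k_0(w_x-\ell\varphi)_x+k\ell(\varphi_x+\psi+\ell w)+g_3(w_t)+f_3(\varphi,\psi,w)=0$ on $(0,L)\times\mathbb{R}^+$, with $\varphi=\psi=w=0$ at $x=0,L$ and initial data in $\mathcal{H}$; under the hypotheses below it is well posed in $\mathcal{H}$ (unique weak solution in $C([0,T];\mathcal{H})$ for each $T>0$, depending continuously on the data), and $S_\ell(t)y_0=(\varphi,\psi,w,\varphi_t,\psi_t,w_t)(t)$ defines a $C^0$ semigroup on $\mathcal{H}$. Let $\gamma_3>0$ satisfy $\|\varphi_x\|^2+\|\psi_x\|^2+\|w_x\|^2\le\gamma_3(b\|\psi_x\|^2+k\|\varphi_x+\psi+\ell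 w\|^2+k_0\|w_x-\ell\varphi\|^2)$ for all $\varphi,\psi,w\in H^1_0(0,L)$. Hypotheses: (F1) $F\in C^2(\mathbb{R}^3)$, $\nabla F=(f_1,f_2,f_3)$; (F2) there are $\beta,m_F\ge0$, $0\le\beta<\pi^2/(2\gamma_3L^2)$, with $F(u,v,w)\ge-\beta(u^2+v^2+w^2)-m_F$; (F3) there are $p\ge1$, $C_f>0$ with $|\nabla f_i(u,v,w)|\le C_f(1+|u|^{p-1}+|v|^{p-1}+|w|^{p-1})$, $i=1,2,3$; (F4) $\nabla F(u,v,w)\cdot(u,v,w)-F(u,v,w)\ge-\beta(u^2+v^2+w^2)-m_F$; (G1) $g_i\in C^1(\mathbb{R})$ increasing, $g_i(0)=0$; (G2) there are $m_i,M_i>0$ with $m_is^2\le g_i(s)s\le M_is^2$ for $|s|>1$. A global attractor is a compact set $\mathbf{A}\subset\mathcal{H}$ with $S_\ell(t)\mathbf{A}=\mathbf{A}$ for all $t\ge0$ and $\lim_{t\to\infty}\sup_{a\in S_\ell(t)B}\operatorname{dist}(a,\mathbf{A})=0$ for every bounded $B\subset\mathcal{H}$. The unstable manifold $\mathbb{M}_+(\mathcal{N}_\ell)$ is the set of $y\in\mathcal{H}$ for which there is a full trajectory $u:\mathbb{R}\to\mathcal{H}$ ($u(t+s)=S_\ell(t)u(s)$ for $t\ge0$) with $u(0)=y$ and $\operatorname{dist}(u(t),\mathcal{N}_\ell)\to0$ as $t\to-\infty$. *)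

theory Defs
  imports "HOL-Analysis.Analysis"
begin

quotient_type aefun = "real \<Rightarrow> real" / "\<lambda>f g. AE x in lebesgue. f x = g x"
  morphisms rep_ae abs_ae
proof (rule equivpI)
  show "reflp (\<lambda>f g. AE x in lebesgue. f x = g x)" by (rule reflpI) simp
  show "symp (\<lambda>f g. AE x in lebesgue. f x = g x)"
    by (rule sympI) (auto elim: AE_mp)
  show "transp (\<lambda>f g. AE x in lebesgue. f x = g x)"
    by (rule transpI) (auto elim!: AE_mp)
qed

definition L2fun :: "real \<Rightarrow> (real \<Rightarrow> real) \<Rightarrow> bool" where
  "L2fun L f \<longleftrightarrow> f \<in> borel_measurable lebesgue \<and>
     integrable lebesgue (\<lambda>x. indicator {0..L} x * (f x)\<^sup>2)"

definition ip :: "real \<Rightarrow> (real \<Rightarrow> real) \<Rightarrow> (real \<Rightarrow> real) \<Rightarrow> real" where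
  "ip L f g = (LINT x:{0..L}|lebesgue. f x * g x)"

definition nrm :: "real \<Rightarrow> (real \<Rightarrow> real) \<Rightarrow> real" where
  "nrm L f = sqrt (ip L f f)"

definition L2 :: "real \<Rightarrow> aefun \<Rightarrow> bool" where
  "L2 L u \<longleftrightarrow> L2fun L (rep_ae u) \<and> (AE x in lebesgue. x \<notin> {0..L} \<longrightarrow> rep_ae u x = 0)"

text \<open>g is an (L^2) weak derivative of u on (0,L) and u has zero boundary values:
  u(x) = integral of g over [0,x], and u(L) = 0.\<close>
definition H10_deriv :: "real \<Rightarrow> aefun \<Rightarrow> (real \<Rightarrow> real) \<Rightarrow> bool" where
  "H10_deriv L u g \<longleftrightarrow> L2fun L g \<and> (\<forall>x. x \<notin> {0..L} \<longrightarrow> g x = 0) \<and>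
     (LINT y:{0..L}|lebesgue. g y) = 0 \<and>
     (AE x in lebesgue. rep_ae u x = (if x \<in> {0..L} then (LINT y:{0..x}|lebesgue. g y) else 0))"

definition H10 :: "real \<Rightarrow> aefun \<Rightarrow> bool" where
  "H10 L u \<longleftrightarrow> L2 L u \<and> (\<exists>g. H10_deriv L u g)"

text \<open>The derivative u_x (determined up to a.e. equality, which is all that is used).\<close>
definition dx :: "real \<Rightarrow> aefun \<Rightarrow> real \<Rightarrow> real" where
  "dx L u = (SOME g. H10_deriv L u g)"

type_synonym state = "aefun \<times> aefun \<times> aefun \<times> aefun \<times> aefun \<times> aefun"

definition c1 :: "state \<Rightarrow> aefun" where "c1 y = fst y"
definition c2 :: "state \<Rightarrow> aefun" where "c2 y = fst (snd y)"
definition c3 :: "state \<Rightarrow> aefun" where "c3 y = fst (snd (snd y))"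
definition c4 :: "state \<Rightarrow> aefun" where "c4 y = fst (snd (snd (snd y)))"
definition c5 :: "state \<Rightarrow> aefun" where "c5 y = fst (snd (snd (snd (snd y))))"
definition c6 :: "state \<Rightarrow> aefun" where "c6 y = snd (snd (snd (snd (snd y))))"

definition phase :: "real \<Rightarrow> state set" where
  "phase L = {y. H10 L (c1 y) \<and> H10 L (c2 y) \<and> H10 L (c3 y) \<and>
                 L2 L (c4 y) \<and> L2 L (c5 y) \<and> L2 L (c6 y)}"

definition dH :: "real \<Rightarrow> state \<Rightarrow> state \<Rightarrow> real" where
  "dH L y z = sqrt (
      (nrm L (\<lambda>x. dx L (c1 y) x - dx L (c1 z) x))\<^sup>2
    + (nrm L (\<lambda>x. dx L (c2 y) x - dx L (c2 z) x))\<^sup>2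
    + (nrm L (\<lambda>x. dx L (c3 y) x - dx L (c3 z) x))\<^sup>2
    + (nrm L (\<lambda>x. rep_ae (c4 y) x - rep_ae (c4 z) x))\<^sup>2
    + (nrm L (\<lambda>x. rep_ae (c5 y) x - rep_ae (c5 z) x))\<^sup>2
    + (nrm L (\<lambda>x. rep_ae (c6 y) x - rep_ae (c6 z) x))\<^sup>2)"

text \<open>Spatial parts of the weak form, tested against q in H^1_0.\<close>
definition E1 where
  "E1 L k k0 l g1 f1 y q =
     k * ip L (\<lambda>x. dx L (c1 y) x + rep_ae (c2 y) x + l * rep_ae (c3 y) x) (dx L q)
   - k0 * l * ip L (\<lambda>x. dx L (c3 y) x - l * rep_ae (c1 y) x) (rep_ae q)
   + ip L (\<lambda>x. g1 (rep_ae (c4 y) x)) (rep_ae q)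
   + ip L (\<lambda>x. f1 (rep_ae (c1 y) x, rep_ae (c2 y) x, rep_ae (c3 y) x)) (rep_ae q)"

definition E2 where
  "E2 L b k l g2 f2 y q =
     b * ip L (dx L (c2 y)) (dx L q)
   + k * ip L (\<lambda>x. dx L (c1 y) x + rep_ae (c2 y) x + l * rep_ae (c3 y) x) (rep_ae q)
   + ip L (\<lambda>x. g2 (rep_ae (c5 y) x)) (rep_ae q)
   + ip L (\<lambda>x. f2 (rep_ae (c1 y) x, rep_ae (c2 y) x, rep_ae (c3 y) x)) (rep_ae q)"

definition E3 where
  "E3 L k k0 l g3 f3 y q =
     k0 * ip L (\<lambda>x. dx L (c3 y) x - l * rep_ae (c1 y) x) (dx L q)
   + k * l * ip L (\<lambda>x. dx L (c1 y) x + rep_ae (c2 y) x + l * rep_ae (c3 y) x) (rep_ae q)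
   + ip L (\<lambda>x. g3 (rep_ae (c6 y) x)) (rep_ae q)
   + ip L (\<lambda>x. f3 (rep_ae (c1 y) x, rep_ae (c2 y) x, rep_ae (c3 y) x)) (rep_ae q)"

definition vel_deriv :: "real \<Rightarrow> (real \<Rightarrow> aefun) \<Rightarrow> (real \<Rightarrow> aefun) \<Rightarrow> bool" where
  "vel_deriv L u v \<longleftrightarrow> (\<forall>t\<ge>0.
     ((\<lambda>s. nrm L (\<lambda>x. (rep_ae (u s) x - rep_ae (u t) x) / (s - t) - rep_ae (v t) x))
        \<longlongrightarrow> 0) (at t within {0..}))"

text \<open>Y is a weak solution on [0,\<infinity>) with initial datum y0: Y \<in> C([0,\<infinity>);H),
  (\<phi>_t,\<psi>_t,w_t) are the time derivatives of (\<phi>,\<psi>,w) in L^2, and the equations hold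
  in the weak (variational, time-integrated) sense for all test functions in H^1_0.\<close>
definition bresse_sol where
  "bresse_sol L \<rho>1 \<rho>2 b k k0 l g1 g2 g3 f1 f2 f3 y0 (Y :: real \<Rightarrow> state) \<longleftrightarrow>
     Y 0 = y0 \<and> (\<forall>t\<ge>0. Y t \<in> phase L) \<and>
     (\<forall>t\<ge>0. ((\<lambda>s. dH L (Y s) (Y t)) \<longlongrightarrow> 0) (at t within {0..})) \<and>
     vel_deriv L (\<lambda>s. c1 (Y s)) (\<lambda>s. c4 (Y s)) \<and>
     vel_deriv L (\<lambda>s. c2 (Y s)) (\<lambda>s. c5 (Y s)) \<and>
     vel_deriv L (\<lambda>s. c3 (Y s)) (\<lambda>s. c6 (Y s)) \<and>
     (\<forall>q. H10 L q \<longrightarrow> (\<forall>t\<ge>0.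
        ((\<lambda>s. E1 L k k0 l g1 f1 (Y s) q) has_integral
            (\<rho>1 * ip L (rep_ae (c4 (Y 0))) (rep_ae q) - \<rho>1 * ip L (rep_ae (c4 (Y t))) (rep_ae q))) {0..t} \<and>
        ((\<lambda>s. E2 L b k l g2 f2 (Y s) q) has_integral
            (\<rho>2 * ip L (rep_ae (c5 (Y 0))) (rep_ae q) - \<rho>2 * ip L (rep_ae (c5 (Y t))) (rep_ae q))) {0..t} \<and>
        ((\<lambda>s. E3 L k k0 l g3 f3 (Y s) q) has_integral
            (\<rho>1 * ip L (rep_ae (c6 (Y 0))) (rep_ae q) - \<rho>1 * ip L (rep_ae (c6 (Y t))) (rep_ae q))) {0..t}))"

definition bounded_H :: "real \<Rightarrow> state set \<Rightarrow> bool" where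
  "bounded_H L B \<longleftrightarrow> B \<subseteq> phase L \<and> (\<exists>y0\<in>phase L. \<exists>R. \<forall>y\<in>B. dH L y0 y \<le> R)"

definition compact_H :: "real \<Rightarrow> state set \<Rightarrow> bool" where
  "compact_H L A \<longleftrightarrow> A \<subseteq> phase L \<and>
     (\<forall>x :: nat \<Rightarrow> state. (\<forall>n. x n \<in> A) \<longrightarrow>
        (\<exists>a\<in>A. \<exists>r. strict_mono r \<and> ((\<lambda>n. dH L (x (r n)) a) \<longlonglongrightarrow> 0)))"

definition global_attractor :: "real \<Rightarrow> (real \<Rightarrow> state \<Rightarrow> state) \<Rightarrow> state set \<Rightarrow> bool" where
  "global_attractor L S A \<longleftrightarrow> compact_H L A \<and> (\<forall>t\<ge>0. S t ` A = A) \<and>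
     (\<forall>B. bounded_H L B \<longrightarrow>
        (\<forall>\<epsilon>>0. \<exists>T. \<forall>t\<ge>T. \<forall>a\<in>S t ` B. \<exists>z\<in>A. dH L a z < \<epsilon>))"

definition stationary :: "real \<Rightarrow> (real \<Rightarrow> state \<Rightarrow> state) \<Rightarrow> state set" where
  "stationary L S = {y \<in> phase L. \<forall>t\<ge>0. S t y = y}"

definition unstable_manifold :: "real \<Rightarrow> (real \<Rightarrow> state \<Rightarrow> state) \<Rightarrow> state set \<Rightarrow> state set" where
  "unstable_manifold L S N = {y. \<exists>u :: real \<Rightarrow> state. (\<forall>s. u s \<in> phase L) \<and>
      (\<forall>t\<ge>0. \<forall>s. u (t + s) = S t (u s)) \<and> u 0 = y \<and>
      (\<forall>\<epsilon>>0. \<exists>T. \<forall>t\<le>T. \<exists>z\<in>N. dH L (u t) z < \<epsilon>)}"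

end

theory Submission
  imports Defs
begin

text \<open>The energy is a strict Lyapunov function: the damping vanishes only at zero velocity, so a trajectory of
  constant energy is at rest. By (F2) and (F4) sublevel sets of the energy and the set of stationary points are
  bounded. Compactness comes from a stabilizability estimate for the difference of two trajectories, with
  remainder controlled by the L^2 distance of the displacements, in which H^1_0 is compact. Such a gradient
  system has a compact global attractor equal to the unstable manifold of its stationary points.
  A displacement u in H^1_0 is represented by its derivative u' in L^2, which has mean zero; the embedding of
  H^1_0 into L^2 becomes the integration operator, and the system becomes M u'' + A u + G u' + f u = 0 in the
  weak sense, for symmetric forms M and A.\<close>

section \<open>Gradient systems\<close>

text \<open>The damping may degenerate, since \<open>g'\<close> can vanish, so velocity differences
  have no rate of decay. What survives is a bound of the squared velocity difference by an
  arbitrarily small \<delta> plus a constant times dissipation, and the dissipation along a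
  trajectory is paid for by its energy drop. No absorbing ball comes out of this directly; bounded
  stationary states replace it, because on a limit set the energy never exceeds its value at some
  stationary point. The threshold for \<beta> has its origin in Wirtinger's inequality with the
  sharp constant L^2/pi^2: together with \<open>\<gamma>3\<close> it lets less than half of the
  elastic energy absorb the negative part of the potential. The solutions are only weak, with a
  velocity that is continuous in L^2 but has no time derivative there; hence the differentiability
  of the energy, uniqueness, the semigroup law and continuity in the data are all extracted from the
  weak equation.\<close>

locale gradient_system =
  fixes P :: "'x::complete_space set" and S :: "real \<Rightarrow> 'x \<Rightarrow> 'x" and E :: "'x \<Rightarrow> real"
  assumes closed_P: "closed P"
    and S_in: "t \<ge> 0 \<Longrightarrow> y \<in> P \<Longrightarrow> S t y \<in> P"
    and S_0: "y \<in> P \<Longrightarrow> S 0 y = y"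
    and S_add: "s \<ge> 0 \<Longrightarrow> t \<ge> 0 \<Longrightarrow> y \<in> P \<Longrightarrow> S (s + t) y = S s (S t y)"
    and S_cont: "t \<ge> 0 \<Longrightarrow> continuous_on P (S t)"
    and E_cont: "continuous_on P E"
    and E_decr: "t \<ge> 0 \<Longrightarrow> y \<in> P \<Longrightarrow> E (S t y) \<le> E y"
    and E_strict: "y \<in> P \<Longrightarrow> (\<And>t. t \<ge> 0 \<Longrightarrow> E (S t y) = E y) \<Longrightarrow> t \<ge> 0 \<Longrightarrow> S t y = y"
    and E_bdd: "B \<subseteq> P \<Longrightarrow> bounded B \<Longrightarrow> \<exists>R. \<forall>y\<in>B. E y \<le> R"
    and bounded_stat: "bounded {y\<in>P. \<forall>t\<ge>0. S t y = y}"
    and asymptotically_smooth: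
      "\<epsilon> > 0 \<Longrightarrow> \<exists>T\<ge>0. \<exists>X. finite X \<and> S T ` {y\<in>P. E y \<le> R} \<subseteq> (\<Union>x\<in>X. ball x \<epsilon>)"
begin

section \<open>Omega-limit sets of energy sublevels and the attractor\<close>

definition Stat :: "'x set" where "Stat = {y\<in>P. \<forall>t\<ge>0. S t y = y}"

definition Unst :: "'x set" where
  "Unst = {y. \<exists>u. (\<forall>s. u s \<in> P) \<and> (\<forall>t\<ge>0. \<forall>s. u (t + s) = S t (u s)) \<and> u 0 = y \<and>
      (\<forall>\<epsilon>>0. \<exists>T. \<forall>t\<le>T. \<exists>z\<in>Stat. dist (u t) z < \<epsilon>)}"

text \<open>The starting points \<open>y n\<close> vary with n, so this is the omega-limit set of
  the whole sublevel of \<open>E\<close> at height \<open>R\<close>, not of a single orbit.\<close>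

definition omega :: "real \<Rightarrow> 'x set" where
  "omega R = {x. \<exists>y t. (\<forall>n. y n \<in> P \<and> E (y n) \<le> R) \<and> filterlim t at_top sequentially \<and>
     (\<lambda>n::nat. S (t n) (y n)) \<longlonglongrightarrow> x}"

text \<open>Sublevels of \<open>E\<close> are positively invariant, so the covering available at the
  single time \<open>T\<close> serves every later time: \<open>S (t n)\<close> is \<open>S T\<close>
  after \<open>S (t n - T)\<close>. Hence all but finitely many points lie in finitely many small
  balls, and completeness yields a convergent subsequence.\<close>

lemma asymptotically_compact:
  assumes y: "\<And>n::nat. y n \<in> P" "\<And>n. E (y n) \<le> R" and t: "filterlim t at_top sequentially"
  obtains x r where "x \<in> P" "strict_mono r" "(\<lambda>n. S (t (r n)) (y (r n))) \<longlonglongrightarrow> x"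
proof -
  define z where "z n = S (t n) (y n)" for n
  have tb: "\<exists>k. finite k \<and> range z \<subseteq> (\<Union>x\<in>k. ball x \<epsilon>)" if eps: "\<epsilon> > 0" for \<epsilon>
  proof -
    obtain T X where T: "T \<ge> 0" "finite X" "S T ` {y\<in>P. E y \<le> R} \<subseteq> (\<Union>x\<in>X. ball x \<epsilon>)"
      using asymptotically_smooth[OF eps] by blast
    obtain N where N: "\<And>n. n \<ge> N \<Longrightarrow> t n \<ge> T"
      using t unfolding filterlim_at_top eventually_sequentially by blast
    \<comment> \<open>The terms before index \<open>N\<close>, whose times may lie below
      \<open>T\<close>, are covered by balls around themselves.\<close>
    have "z n \<in> (\<Union>x\<in>X \<union> z ` {..<N}. ball x \<epsilon>)" for n
    proof (cases "n \<ge> N")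
      case True
      have "z n = S T (S (t n - T) (y n))"
        unfolding z_def using S_add[of T "t n - T" "y n"] N[OF True] T(1) y by simp
      moreover have "S (t n - T) (y n) \<in> {y\<in>P. E y \<le> R}"
        using N[OF True] y S_in order_trans[OF E_decr[of "t n - T" "y n"] y(2)[of n]] by auto
      ultimately show ?thesis using T(3) by blast
    next
      case False
      then show ?thesis using eps by (auto intro!: bexI[of _ n])
    qed
    then show ?thesis using T(2) by (intro exI[of _ "X \<union> z ` {..<N}"] conjI image_subsetI) blast+
  qed
  have "compact (closure (range z))"
    unfolding compact_eq_totally_bounded
  proof safe
    show "complete (closure (range z))" by (simp add: complete_eq_closed)
    fix e :: real assume "e > 0"
    then obtain k where k: "finite k" "range z \<subseteq> (\<Union>x\<in>k. ball x (e/2))" using tb[of "e/2"] by auto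
    \<comment> \<open>A finite union of closed balls is closed and therefore also covers the
      closure; doubling the radius then returns to open balls.\<close>
    then have "range z \<subseteq> (\<Union>x\<in>k. cball x (e/2))" using ball_subset_cball by blast
    moreover have "closed (\<Union>x\<in>k. cball x (e/2))" using k(1) by blast
    ultimately have "closure (range z) \<subseteq> (\<Union>x\<in>k. cball x (e/2))" by (rule closure_minimal)
    also have "\<dots> \<subseteq> (\<Union>x\<in>k. ball x e)" using \<open>e > 0\<close> by (intro UN_mono) auto
    finally show "\<exists>k. finite k \<and> closure (range z) \<subseteq> (\<Union>x\<in>k. ball x e)" using k(1) by blast
  qed
  then obtain x r where x: "strict_mono (r::nat\<Rightarrow>nat)" "(z \<circ> r) \<longlonglongrightarrow> x"
    unfolding compact_def by (metis UNIV_I closure_subset image_subset_iff)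
  obtain N where N: "\<And>n. n \<ge> N \<Longrightarrow> t n \<ge> 0"
    using t unfolding filterlim_at_top eventually_sequentially by blast
  have "x \<in> P"
  proof (rule Lim_in_closed_set[OF closed_P _ _ x(2)])
    show "\<forall>\<^sub>F n in sequentially. (z \<circ> r) n \<in> P"
      unfolding eventually_sequentially z_def
      by (auto intro!: exI[of _ N] S_in y N intro: order_trans[OF _ seq_suble[OF x(1)]])
  qed simp
  with x show ?thesis by (intro that) (auto simp: z_def o_def)
qed

lemma omega_P: "omega R \<subseteq> P"
proof
  fix x assume "x \<in> omega R"
  then obtain y t where y: "\<And>n. y n \<in> P" and t: "filterlim t at_top sequentially"
    and l: "(\<lambda>n::nat. S (t n) (y n)) \<longlonglongrightarrow> x" unfolding omega_def by blast
  have "\<forall>\<^sub>F n in sequentially. S (t n) (y n) \<in> P"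
    using filterlim_at_top[THEN iffD1, OF t, rule_format, of 0]
    by eventually_elim (simp add: S_in y)
  then show "x \<in> P" by (rule Lim_in_closed_set[OF closed_P _ _ l]) simp
qed

lemma S_tendsto:
  assumes "t \<ge> 0" "x \<in> P" "(z \<longlongrightarrow> x) F" "\<forall>\<^sub>F n in F. z n \<in> P"
  shows "((\<lambda>n. S t (z n)) \<longlongrightarrow> S t x) F"
  by (rule continuous_on_tendsto_compose[OF S_cont[OF assms(1)] assms(3,2,4)])

text \<open>One inclusion is continuity of \<open>S s\<close>. For the other, a preimage is a
  subsequential limit of \<open>S (- s + t n) (y n)\<close>, which exists by asymptotic
  compactness.\<close>

lemma omega_invariant:
  assumes s: "s \<ge> 0" shows "S s ` omega R = omega R"
proof safe
  fix x assume x: "x \<in> omega R"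
  then obtain y t where y: "\<And>n. y n \<in> P" "\<And>n. E (y n) \<le> R" and t: "filterlim t at_top sequentially"
    and l: "(\<lambda>n::nat. S (t n) (y n)) \<longlonglongrightarrow> x" unfolding omega_def by blast
  have ev: "\<forall>\<^sub>F n in sequentially. t n \<ge> 0" using t unfolding filterlim_at_top by blast
  have "(\<lambda>n. S s (S (t n) (y n))) \<longlonglongrightarrow> S s x"
    using omega_P x by (intro S_tendsto s l eventually_mono[OF ev] S_in y) auto
  moreover have "\<forall>\<^sub>F n in sequentially. S s (S (t n) (y n)) = S (s + t n) (y n)"
    using ev by eventually_elim (simp add: S_add s y)
  ultimately have "(\<lambda>n. S (s + t n) (y n)) \<longlonglongrightarrow> S s x" by (rule Lim_transform_eventually)
  moreover have "filterlim (\<lambda>n. s + t n) at_top sequentially"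
    by (rule filterlim_tendsto_add_at_top[OF tendsto_const t])
  ultimately show "S s x \<in> omega R" unfolding omega_def using y by (intro CollectI exI[of _ y]) blast
next
  fix x assume x: "x \<in> omega R"
  then obtain y t where y: "\<And>n. y n \<in> P" "\<And>n. E (y n) \<le> R" and t: "filterlim t at_top sequentially"
    and l: "(\<lambda>n::nat. S (t n) (y n)) \<longlonglongrightarrow> x" unfolding omega_def by blast
  have t': "filterlim (\<lambda>n. - s + t n) at_top sequentially"
    by (rule filterlim_tendsto_add_at_top[OF tendsto_const t])
  obtain x' r where r: "x' \<in> P" "strict_mono r" "(\<lambda>n. S (- s + t (r n)) (y (r n))) \<longlonglongrightarrow> x'"
    using asymptotically_compact[where y = y and R = R, OF y t'] by blast
  have tr: "filterlim (\<lambda>n. - s + t (r n)) at_top sequentially"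
    using filterlim_compose[OF t' filterlim_subseq[OF r(2)]] .
  have ev: "\<forall>\<^sub>F n in sequentially. - s + t (r n) \<ge> 0" using tr unfolding filterlim_at_top by blast
  have x': "x' \<in> omega R" unfolding omega_def using y r tr
    by (intro CollectI exI[of _ "\<lambda>n. y (r n)"] exI[of _ "\<lambda>n. - s + t (r n)"]) auto
  have "(\<lambda>n. S s (S (- s + t (r n)) (y (r n)))) \<longlonglongrightarrow> S s x'"
    by (intro S_tendsto s r eventually_mono[OF ev] S_in y) auto
  moreover have "\<forall>\<^sub>F n in sequentially. S s (S (- s + t (r n)) (y (r n))) = S (t (r n)) (y (r n))"
    using ev by eventually_elim (use S_add[OF s, symmetric] y in simp)
  ultimately have "(\<lambda>n. S (t (r n)) (y (r n))) \<longlonglongrightarrow> S s x'" by (rule Lim_transform_eventually)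
  moreover have "(\<lambda>n. S (t (r n)) (y (r n))) \<longlonglongrightarrow> x"
    using LIMSEQ_subseq_LIMSEQ[OF l r(2)] by (simp add: o_def)
  ultimately have "x = S s x'" by (rule LIMSEQ_unique[symmetric])
  with x' show "x \<in> S s ` omega R" by blast
qed

text \<open>Each \<open>x n\<close> is replaced by an orbit point \<open>S (t n) (y n)\<close> at
  distance below 1/(n+1) with \<open>t n\<close> at least n. Asymptotic compactness applies to these
  points, and the limit of the subsequence lies in \<open>omega R\<close> by construction.\<close>

lemma omega_compact: "compact (omega R)"
  unfolding compact_def
proof (intro allI impI)
  fix x :: "nat \<Rightarrow> 'x" assume x: "\<forall>n. x n \<in> omega R"
  have "\<exists>y t. y \<in> P \<and> E y \<le> R \<and> t \<ge> real n \<and> dist (S t y) (x n) < 1 / Suc n" for n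
  proof -
    obtain y t where y: "\<And>n. y n \<in> P" "\<And>n. E (y n) \<le> R" and t: "filterlim t at_top sequentially"
      and l: "(\<lambda>i::nat. S (t i) (y i)) \<longlonglongrightarrow> x n" using x unfolding omega_def by blast
    have "\<forall>\<^sub>F i in sequentially. t i \<ge> real n" using t unfolding filterlim_at_top by blast
    moreover have "\<forall>\<^sub>F i in sequentially. dist (S (t i) (y i)) (x n) < 1 / Suc n"
      using l by (rule tendstoD) simp
    ultimately have "\<forall>\<^sub>F i in sequentially. t i \<ge> real n \<and> dist (S (t i) (y i)) (x n) < 1 / Suc n"
      by eventually_elim simp
    then obtain i where "t i \<ge> real n \<and> dist (S (t i) (y i)) (x n) < 1 / Suc n"
      by (blast dest: eventually_happens'[OF sequentially_bot])
    with y show ?thesis by blast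
  qed
  then obtain y t where y: "\<And>n. y n \<in> P" "\<And>n. E (y n) \<le> R" and t: "\<And>n. t n \<ge> real n"
    and d: "\<And>n. dist (S (t n) (y n)) (x n) < 1 / Suc n" by metis
  have tt: "filterlim t at_top sequentially"
    by (rule filterlim_at_top_mono[OF filterlim_real_sequentially]) (simp add: t)
  obtain a r where r: "a \<in> P" "strict_mono r" "(\<lambda>n. S (t (r n)) (y (r n))) \<longlonglongrightarrow> a"
    using asymptotically_compact[where y = y and R = R, OF y tt] by blast
  have "a \<in> omega R" unfolding omega_def using y r filterlim_compose[OF tt filterlim_subseq[OF r(2)]]
    by (intro CollectI exI[of _ "\<lambda>n. y (r n)"] exI[of _ "\<lambda>n. t (r n)"]) auto
  moreover have "(x \<circ> r) \<longlonglongrightarrow> a"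
  proof -
    have "(\<lambda>n. dist (S (t n) (y n)) (x n)) \<longlonglongrightarrow> 0"
      by (rule tendsto_sandwich[OF _ _ tendsto_const LIMSEQ_inverse_real_of_nat])
         (use d in \<open>auto intro!: always_eventually less_imp_le simp: inverse_eq_divide\<close>)
    from LIMSEQ_subseq_LIMSEQ[OF this r(2)]
    have 1: "(\<lambda>n. dist (S (t (r n)) (y (r n))) (x (r n))) \<longlonglongrightarrow> 0" by (simp add: o_def)
    have 2: "(\<lambda>n. dist (S (t (r n)) (y (r n))) (x (r n)) + dist (S (t (r n)) (y (r n))) a) \<longlonglongrightarrow> 0 + 0"
      using r(3) by (intro tendsto_add 1) (simp add: tendsto_dist_iff[symmetric])
    have "(\<lambda>n. dist (x (r n)) a) \<longlonglongrightarrow> 0"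
      by (rule tendsto_sandwich[OF _ _ tendsto_const 2[unfolded add_0]])
         (auto intro!: always_eventually dist_triangle3)
    then show ?thesis unfolding o_def by (simp add: tendsto_dist_iff[symmetric])
  qed
  ultimately show "\<exists>l\<in>omega R. \<exists>r. strict_mono r \<and> (x \<circ> r) \<longlonglongrightarrow> l" using r(2) by blast
qed

lemma omega_attracts:
  assumes "\<epsilon> > 0"
  shows "\<exists>T\<ge>0. \<forall>t\<ge>T. \<forall>y\<in>P. E y \<le> R \<longrightarrow> (\<exists>z\<in>omega R. dist (S t y) z < \<epsilon>)"
proof (rule ccontr)
  assume "\<not> ?thesis"
  then have "\<exists>t y. t \<ge> real n \<and> y \<in> P \<and> E y \<le> R \<and> (\<forall>z\<in>omega R. \<epsilon> \<le> dist (S t y) z)" for n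
    by (meson not_less of_nat_0_le_iff)
  then obtain t y where y: "\<And>n. y n \<in> P" "\<And>n. E (y n) \<le> R" and t: "\<And>n. t n \<ge> real n"
    and d: "\<And>n z. z \<in> omega R \<Longrightarrow> \<epsilon> \<le> dist (S (t n) (y n)) z" by metis
  have tt: "filterlim t at_top sequentially"
    by (rule filterlim_at_top_mono[OF filterlim_real_sequentially]) (simp add: t)
  obtain a r where r: "a \<in> P" "strict_mono r" "(\<lambda>n. S (t (r n)) (y (r n))) \<longlonglongrightarrow> a"
    using asymptotically_compact[where y = y and R = R, OF y tt] by blast
  have a: "a \<in> omega R" unfolding omega_def using y r filterlim_compose[OF tt filterlim_subseq[OF r(2)]]
    by (intro CollectI exI[of _ "\<lambda>n. y (r n)"] exI[of _ "\<lambda>n. t (r n)"]) auto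
  have "\<forall>\<^sub>F n in sequentially. dist (S (t (r n)) (y (r n))) a < \<epsilon>" using r(3) assms by (rule tendstoD)
  then obtain n where "dist (S (t (r n)) (y (r n))) a < \<epsilon>"
    by (blast dest: eventually_happens'[OF sequentially_bot])
  with d[OF a, of "r n"] show False by simp
qed

text \<open>Invariance at time 1 makes \<open>S 1\<close> surjective on the limit set. Iterating a
  chosen preimage fixes the states \<open>Y n\<close> at the times -n, and \<open>S\<close> fills in
  the times between.\<close>

lemma full_trajectory:
  assumes y: "y \<in> omega R"
  obtains u where "\<And>s. u s \<in> omega R" "\<And>t s. t \<ge> 0 \<Longrightarrow> u (t + s) = S t (u s)" "u 0 = y"
proof -
  define p where "p x = (SOME x'. x' \<in> omega R \<and> S 1 x' = x)" for x
  have p: "p x \<in> omega R \<and> S 1 (p x) = x" if "x \<in> omega R" for x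
    unfolding p_def by (rule someI_ex) (use that omega_invariant[of 1 R] in force)
  define Y where "Y n = (p ^^ n) y" for n
  have Y: "Y n \<in> omega R" for n by (induction n) (auto simp: Y_def y p)
  have YS: "S 1 (Y (Suc n)) = Y n" for n using p[OF Y[of n]] by (simp add: Y_def)
  have oP: "x \<in> P" if "x \<in> omega R" for x using omega_P that by blast
  \<comment> \<open>Starting k units further in the past and running k units longer changes nothing,
    so \<open>u\<close> does not depend on the integer past time it is started from.\<close>
  have shift: "S (t + real k) (Y (n + k)) = S t (Y n)" if "t \<ge> 0" for t k n
  proof (induction k arbitrary: n)
    case (Suc k)
    have "S (t + real (Suc k)) (Y (n + Suc k)) = S (t + real k) (S 1 (Y (Suc (n + k))))"
      using S_add[of "t + real k" 1 "Y (Suc (n+k))"] that oP Y by (simp add: add.commute add.left_commute)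
    then show ?case using YS Suc by simp
  qed simp
  \<comment> \<open>The ceiling of |t| is an integer n with t + n \<ge> 0, so \<open>S\<close> is
    evaluated at nonnegative times only.\<close>
  define u where "u t = S (t + real (nat \<lceil>\<bar>t\<bar>\<rceil>)) (Y (nat \<lceil>\<bar>t\<bar>\<rceil>))" for t
  have u: "u t = S (t + real n) (Y n)" if "t + real n \<ge> 0" for t n
  proof -
    let ?m = "nat \<lceil>\<bar>t\<bar>\<rceil>"
    have m: "t + real ?m \<ge> 0" by (smt (verit) real_nat_ceiling_ge)
    show ?thesis
    proof (cases "n \<ge> ?m")
      case True
      then show ?thesis using shift[OF m, of "n - ?m" ?m] by (simp add: u_def)
    next
      case False
      then have "n + (?m - n) = ?m" "real n + real (?m - n) = real ?m" by linarith+
      then show ?thesis using shift[OF that, of "?m - n" n] unfolding u_def by (metis add.assoc)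
    qed
  qed
  have n: "\<exists>n. s + real n \<ge> 0" for s :: real
  proof -
    obtain n where "- s \<le> real n" using real_arch_simple by blast
    then show ?thesis by (intro exI[of _ n]) simp
  qed
  show ?thesis
  proof (rule that)
    show "u s \<in> omega R" for s
    proof -
      obtain k where "s + real k \<ge> 0" using n by blast
      then show ?thesis using u[of s k] Y[of k] omega_invariant[of "s + real k" R] by (metis imageI)
    qed
    show "u (t + s) = S t (u s)" if "t \<ge> 0" for t s
    proof -
      obtain n where "s + real n \<ge> 0" using n by blast
      then show ?thesis using u[of s n] u[of "t + s" n] S_add[of t "s + real n" "Y n"] that oP Y
        by (simp add: add.assoc)
    qed
    show "u 0 = y" using u[of 0 0] S_0[OF oP[OF y]] by (simp add: Y_def)
  qed
qed

text \<open>Backwards in time the Lyapunov function converges along a precompact full trajectory, hence it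
  is constant on trajectories through backward limit points, which are therefore stationary.\<close>
lemma omega_backward:
  assumes u: "\<And>s. u s \<in> omega R" "\<And>t s. t \<ge> 0 \<Longrightarrow> u (t + s) = S t (u s)"
  shows "\<And>\<epsilon>. \<epsilon> > 0 \<Longrightarrow> \<exists>T. \<forall>t\<le>T. \<exists>z\<in>Stat. dist (u t) z < \<epsilon>"
    and "\<exists>z\<in>Stat. E (u 0) \<le> E z"
proof -
  have uP: "u s \<in> P" for s using u(1) omega_P by blast
  define e where "e s = E (u s)" for s
  have e_mono: "e t \<le> e s" if "s \<le> t" for s t
    using u(2)[of "t - s" s] that E_decr[of "t - s" "u s"] uP by (simp add: e_def)
  have "compact (E ` omega R)"
    using compact_continuous_image[OF continuous_on_subset[OF E_cont omega_P] omega_compact] .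
  then have "bdd_above (E ` omega R)" by (simp add: bounded_imp_bdd_above compact_imp_bounded)
  then have bdd: "bdd_above (range e)" by (rule bdd_above_mono) (auto simp: e_def u(1))
  define c where "c = (SUP s. e s)"
  have ec: "e s \<le> c" for s unfolding c_def by (rule cSUP_upper[OF _ bdd]) simp
  have elim: "(\<lambda>n. e (t n)) \<longlonglongrightarrow> c" if t: "filterlim t at_bot sequentially" for t :: "nat \<Rightarrow> real"
  proof (rule order_tendstoI)
    fix a assume "a < c"
    then obtain s where s: "a < e s" unfolding c_def using less_cSUP_iff[OF _ bdd] by auto
    have "\<forall>\<^sub>F n in sequentially. t n \<le> s" using t unfolding filterlim_at_bot by blast
    then show "\<forall>\<^sub>F n in sequentially. a < e (t n)"
      by eventually_elim (use e_mono s in \<open>blast intro: less_le_trans\<close>)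
  qed (use ec in \<open>auto intro!: always_eventually le_less_trans[OF ec]\<close>)
  have key: "\<exists>z\<in>Stat. \<exists>r. strict_mono r \<and> (\<lambda>n. u (t (r n))) \<longlonglongrightarrow> z \<and> E z = c"
    if t: "filterlim t at_bot sequentially" for t :: "nat \<Rightarrow> real"
  proof -
    obtain z r where z: "z \<in> omega R" "strict_mono (r::nat\<Rightarrow>nat)" "(\<lambda>n. u (t (r n))) \<longlonglongrightarrow> z"
      using omega_compact[of R] u(1) unfolding compact_def o_def by meson
    have zP: "z \<in> P" using z(1) omega_P by blast
    have tr: "filterlim (\<lambda>n. t (r n)) at_bot sequentially"
      using filterlim_compose[OF t filterlim_subseq[OF z(2)]] .
    \<comment> \<open>Delaying all times by s leaves the limit c of the energies unchanged, so the
      energy is constant on the forward orbit of z and strictness makes z stationary.\<close>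
    have Es: "E (S s z) = c" if s: "s \<ge> 0" for s
    proof -
      have "(\<lambda>n. S s (u (t (r n)))) \<longlonglongrightarrow> S s z" by (intro S_tendsto s zP z) (simp add: uP)
      then have "(\<lambda>n. u (s + t (r n))) \<longlonglongrightarrow> S s z" using u(2)[OF s] by simp
      then have "(\<lambda>n. E (u (s + t (r n)))) \<longlonglongrightarrow> E (S s z)"
        by (rule continuous_on_tendsto_compose[OF E_cont]) (use S_in s zP uP in auto)
      moreover have "(\<lambda>n. E (u (s + t (r n)))) \<longlonglongrightarrow> c"
      proof -
        have "filterlim (\<lambda>n. s + t (r n)) at_bot sequentially"
          unfolding filterlim_at_bot
        proof
          fix Z
          have "\<forall>\<^sub>F n in sequentially. t (r n) \<le> Z - s" using tr unfolding filterlim_at_bot by blast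
          then show "\<forall>\<^sub>F n in sequentially. s + t (r n) \<le> Z" by eventually_elim simp
        qed
        from elim[OF this] show ?thesis by (simp add: e_def)
      qed
      ultimately show ?thesis by (rule LIMSEQ_unique)
    qed
    have "E z = c" using Es[of 0] S_0[OF zP] by simp
    moreover have "z \<in> Stat" unfolding Stat_def using E_strict[OF zP] Es \<open>E z = c\<close> zP by auto
    ultimately show ?thesis using z by blast
  qed
  have bot: "filterlim (\<lambda>n. - real n) at_bot sequentially"
    using filterlim_real_sequentially filterlim_uminus_at_bot[of "\<lambda>n. - real n"] by simp
  show "\<exists>z\<in>Stat. E (u 0) \<le> E z" using key[OF bot] ec[of 0] by (auto simp: e_def)
  show "\<exists>T. \<forall>t\<le>T. \<exists>z\<in>Stat. dist (u t) z < \<epsilon>" if "\<epsilon> > 0" for \<epsilon>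
  proof (rule ccontr)
    assume "\<not> ?thesis"
    then have "\<exists>t. t \<le> - real n \<and> (\<forall>z\<in>Stat. \<epsilon> \<le> dist (u t) z)" for n
      by (meson not_less)
    then obtain t where t: "\<And>n. t n \<le> - real n" "\<And>n z. z \<in> Stat \<Longrightarrow> \<epsilon> \<le> dist (u (t n)) z" by metis
    have "filterlim t at_bot sequentially"
      by (rule filterlim_at_bot_mono[OF bot]) (simp add: t)
    from key[OF this] obtain z r where z: "z \<in> Stat" "(\<lambda>n. u (t (r n))) \<longlonglongrightarrow> z" by blast
    have "\<forall>\<^sub>F n in sequentially. dist (u (t (r n))) z < \<epsilon>" using z(2) that by (rule tendstoD)
    then obtain n where "dist (u (t (r n))) z < \<epsilon>"
      by (blast dest: eventually_happens'[OF sequentially_bot])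
    with t(2)[OF z(1), of "r n"] show False by simp
  qed
qed

lemma omega_Unst: "omega R \<subseteq> Unst"
proof
  fix y assume "y \<in> omega R"
  then obtain u where u: "\<And>s. u s \<in> omega R" "\<And>t s. t \<ge> 0 \<Longrightarrow> u (t + s) = S t (u s)" "u 0 = y"
    using full_trajectory[of y R] by blast
  then show "y \<in> Unst" unfolding Unst_def
    using omega_backward(1)[of u R, OF u(1,2)] omega_P by blast
qed

theorem attractor_exists:
  "\<exists>A. A \<subseteq> P \<and> compact A \<and> (\<forall>t\<ge>0. S t ` A = A) \<and>
     (\<forall>B. B \<subseteq> P \<and> bounded B \<longrightarrow> (\<forall>\<epsilon>>0. \<exists>T. \<forall>t\<ge>T. \<forall>a\<in>S t ` B. \<exists>z\<in>A. dist a z < \<epsilon>)) \<and>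
     A = Unst"
proof -
  have sb: "bounded Stat" "Stat \<subseteq> P" using bounded_stat by (auto simp: Stat_def)
  obtain R0 where R0: "\<And>z. z \<in> Stat \<Longrightarrow> E z \<le> R0" using E_bdd[OF sb(2,1)] by blast
  define A where "A = omega R0"
  \<comment> \<open>Energies on any \<open>omega R\<close> are bounded by the bound
    \<open>R0\<close> for stationary states, because each full trajectory there has less energy than
    some backward limit point. This is why one limit set serves all bounded sets.\<close>
  have sub: "omega R \<subseteq> A" for R
  proof
    fix x assume x: "x \<in> omega R"
    have le: "E y \<le> R0" if yR: "y \<in> omega R" for y
    proof -
      obtain u where u: "\<And>s. u s \<in> omega R" "\<And>t s. t \<ge> 0 \<Longrightarrow> u (t + s) = S t (u s)" "u 0 = y"
        using full_trajectory[OF yR] by blast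
      obtain z where "z \<in> Stat" "E (u 0) \<le> E z"
        using omega_backward(2)[of u R, OF u(1,2)] by blast
      then show ?thesis using R0[of z] u(3) by simp
    qed
    \<comment> \<open>Every point of \<open>omega R\<close> has preimages in \<open>omega R\<close>
      under \<open>S\<close> at all integer times; having energy at most \<open>R0\<close>, they
      exhibit x as a point of \<open>omega R0\<close>.\<close>
    have "\<exists>y\<in>omega R. S (real n) y = x" for n using omega_invariant[of "real n" R] x by force
    then obtain y where y: "\<And>n. y n \<in> omega R" "\<And>n. S (real n) (y n) = x" by metis
    show "x \<in> A" unfolding A_def omega_def
      by (intro CollectI exI[of _ y] exI[of _ real])
         (use y le subsetD[OF omega_P y(1)] filterlim_real_sequentially in auto)
  qed
  have attr: "\<exists>T\<ge>0. \<forall>t\<ge>T. \<forall>a\<in>S t ` B. \<exists>z\<in>A. dist a z < \<epsilon>" if "B \<subseteq> P" "bounded B" "\<epsilon> > 0" for B \<epsilon>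
  proof -
    obtain R where R: "\<forall>y\<in>B. E y \<le> R" using E_bdd[OF \<open>B \<subseteq> P\<close> \<open>bounded B\<close>] by blast
    obtain T where T: "T \<ge> 0" "\<And>t y. t \<ge> T \<Longrightarrow> y \<in> P \<Longrightarrow> E y \<le> R \<Longrightarrow> \<exists>z\<in>omega R. dist (S t y) z < \<epsilon>"
      using omega_attracts[OF \<open>\<epsilon> > 0\<close>, of R] by blast
    show ?thesis
    proof (intro exI[of _ T] conjI allI impI ballI T(1))
      fix t a assume "t \<ge> T" "a \<in> S t ` B"
      then show "\<exists>z\<in>A. dist a z < \<epsilon>" using T(2)[of t] R sub[of R] \<open>B \<subseteq> P\<close> by blast
    qed
  qed
  have "Unst \<subseteq> A"
  proof
    fix y assume "y \<in> Unst"
    then obtain u where u: "\<And>s. u s \<in> P" "\<And>t s. t \<ge> 0 \<Longrightarrow> u (t + s) = S t (u s)" "u 0 = y"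
      and ub: "\<And>\<epsilon>. \<epsilon> > 0 \<Longrightarrow> \<exists>T. \<forall>t\<le>T. \<exists>z\<in>Stat. dist (u t) z < \<epsilon>"
      unfolding Unst_def by blast
    obtain T where T: "\<And>t. t \<le> T \<Longrightarrow> \<exists>z\<in>Stat. dist (u t) z < 1" using ub[of 1] by auto
    \<comment> \<open>Up to time \<open>T\<close> the trajectory stays within distance 1 of the
      bounded stationary set, so its past is a bounded set. Since y is reached from this past after
      arbitrarily long times, the attraction of \<open>B\<close> places y in the closure of
      \<open>A\<close>.\<close>
    define B where "B = u ` {..T}"
    obtain x0 e0 where "\<And>z. z \<in> Stat \<Longrightarrow> dist x0 z \<le> e0" using sb(1) unfolding bounded_def by blast
    moreover obtain z where "\<And>t. t \<le> T \<Longrightarrow> z t \<in> Stat \<and> dist (u t) (z t) < 1" using T by metis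
    ultimately have "dist x0 (u t) \<le> e0 + 1" if "t \<le> T" for t
      using dist_triangle2[of x0 "u t" "z t"] that by (meson add_mono less_imp_le order_trans)
    then have "\<forall>b\<in>B. dist x0 b \<le> e0 + 1" unfolding B_def by simp
    then have B: "bounded B" "B \<subseteq> P" unfolding bounded_def by (blast, simp add: B_def image_subset_iff u(1))
    have "\<exists>z\<in>A. dist y z < \<epsilon>" if eps: "\<epsilon> > 0" for \<epsilon>
    proof -
      obtain T1 where T1: "T1 \<ge> 0" "\<And>t a. t \<ge> T1 \<Longrightarrow> a \<in> S t ` B \<Longrightarrow> \<exists>z\<in>A. dist a z < \<epsilon>"
        using attr[OF B(2,1) eps] by blast
      define t where "t = max T1 (- T)"
      have "y = S t (u (- t))" using u(2)[of t "- t"] u(3) T1(1) by (simp add: t_def)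
      moreover have "u (- t) \<in> B" unfolding B_def t_def by auto
      ultimately show ?thesis using T1(2)[of t y] by (auto simp: t_def)
    qed
    then have "y \<in> closure A" by (metis closure_approachable dist_commute)
    then show "y \<in> A" unfolding A_def using omega_compact by (simp add: compact_imp_closed)
  qed
  moreover have "A \<subseteq> Unst" using omega_Unst by (simp add: A_def)
  ultimately have "A = Unst" by blast
  moreover have "\<exists>T. \<forall>t\<ge>T. \<forall>a\<in>S t ` B. \<exists>z\<in>A. dist a z < \<epsilon>" if "B \<subseteq> P" "bounded B" "\<epsilon> > 0" for B \<epsilon>
    using attr[OF that] by blast
  moreover have "A \<subseteq> P" "compact A" "\<forall>t\<ge>0. S t ` A = A"
    unfolding A_def using omega_P omega_compact omega_invariant by auto
  ultimately show ?thesis by (intro exI[of _ A] conjI allI impI) simp_all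
qed

end

section \<open>Linear wave equations with a continuous forcing term\<close>

text \<open>Velocities are given as limits of difference quotients, and the product rule below
  multiplies such quotients; this translates to and from the library notion.\<close>

lemma has_vector_derivative_iff_quotient:
  "(f has_vector_derivative D) (at x within S) \<longleftrightarrow>
     ((\<lambda>y. (f y - f x) /\<^sub>R (y - x)) \<longlongrightarrow> D) (at x within S)"
proof -
  have "(f has_vector_derivative D) (at x within S) \<longleftrightarrow>
      ((\<lambda>y. norm (f y - f x - (y - x) *\<^sub>R D) / norm (y - x)) \<longlongrightarrow> 0) (at x within S)"
    unfolding has_vector_derivative_def has_derivative_iff_norm
    by (simp add: bounded_linear_scaleR_left)
  also have "\<dots> \<longleftrightarrow> ((\<lambda>y. norm ((f y - f x) /\<^sub>R (y - x) - D)) \<longlongrightarrow> 0) (at x within S)"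
  proof (rule filterlim_cong)
    show "\<forall>\<^sub>F y in at x within S. norm (f y - f x - (y - x) *\<^sub>R D) / norm (y - x) =
        norm ((f y - f x) /\<^sub>R (y - x) - D)"
      unfolding eventually_at_filter
    proof (intro always_eventually allI impI)
      fix y assume "y \<noteq> x"
      then have "f y - f x - (y - x) *\<^sub>R D = (y - x) *\<^sub>R ((f y - f x) /\<^sub>R (y - x) - D)"
        by (simp add: scaleR_diff_right)
      then have "norm (f y - f x - (y - x) *\<^sub>R D) = \<bar>y - x\<bar> * norm ((f y - f x) /\<^sub>R (y - x) - D)"
        by (metis norm_scaleR)
      then show "norm (f y - f x - (y - x) *\<^sub>R D) / norm (y - x) = norm ((f y - f x) /\<^sub>R (y - x) - D)"
        using \<open>y \<noteq> x\<close> by simp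
    qed
  qed auto
  also have "\<dots> \<longleftrightarrow> ((\<lambda>y. (f y - f x) /\<^sub>R (y - x)) \<longlongrightarrow> D) (at x within S)"
    by (simp add: tendsto_norm_zero_iff LIM_zero_iff)
  finally show ?thesis .
qed

text \<open>Since \<open>g t = 0\<close>, the quotient of the product is \<open>B (f s)\<close>
  applied to the quotient of \<open>g\<close>, so continuity of \<open>f\<close> is enough. This
  matters when \<open>f\<close> is the velocity, which has no time derivative in the velocity
  space.\<close>

lemma has_vector_derivative_bilinear_vanishing:
  assumes "bounded_bilinear B" and "(f \<longlongrightarrow> f t) (at t)" and "(g has_vector_derivative g') (at t)" and "g t = 0"
  shows "((\<lambda>s. B (f s) (g s)) has_vector_derivative B (f t) g') (at t)"
  using bounded_bilinear.tendsto[OF assms(1,2) assms(3)[unfolded has_vector_derivative_iff_quotient]] assms(4)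
  unfolding has_vector_derivative_iff_quotient
  by (simp add: bounded_bilinear.scaleR_right[OF assms(1)] bounded_bilinear.zero_right[OF assms(1)])

text \<open>The integrand depends on the window width d as well; uniform continuity on a compact
  rectangle lets both effects vanish together.\<close>

lemma shifted_quotient_integral:
  fixes k :: "real \<Rightarrow> real \<Rightarrow> real"
  assumes cont: "continuous_on ({a..b} \<times> {0..c}) (\<lambda>(s, d). k s d)" and ab: "a < b" and c: "c > 0"
  shows "((\<lambda>d. integral {b - d..b} (\<lambda>s. k s d) / d) \<longlongrightarrow> k b 0) (at_right 0)"
proof (rule tendstoI)
  fix e :: real assume e: "e > 0"
  have "uniformly_continuous_on ({a..b} \<times> {0..c}) (\<lambda>(s, d). k s d)"
    by (intro compact_uniformly_continuous cont compact_Times compact_Icc)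
  then obtain \<delta> where \<delta>: "\<delta> > 0" "\<And>s d s' d'. (s, d) \<in> {a..b} \<times> {0..c} \<Longrightarrow> (s', d') \<in> {a..b} \<times> {0..c} \<Longrightarrow>
      dist (s', d') (s, d) < \<delta> \<Longrightarrow> dist (k s' d') (k s d) < e / 2"
    unfolding uniformly_continuous_on_def using half_gt_zero[OF e] by (metis (no_types, lifting) case_prod_conv)
  have "\<forall>\<^sub>F d in at_right 0. d < min (\<delta> / 2) (min c (b - a))"
    by (rule eventually_at_rightI[of 0 "min (\<delta> / 2) (min c (b - a))"]) (use \<delta>(1) c ab in auto)
  moreover have "\<forall>\<^sub>F d in at_right (0::real). d > 0" by (simp add: eventually_at_right_less)
  ultimately show "\<forall>\<^sub>F d in at_right 0. dist (integral {b - d..b} (\<lambda>s. k s d) / d) (k b 0) < e"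
  proof eventually_elim
    case (elim d)
    then have d: "0 < d" "d < \<delta> / 2" "d < c" "d < b - a" by auto
    have cd: "continuous_on {b - d..b} (\<lambda>s. k s d)"
    proof -
      have "continuous_on {b - d..b} ((\<lambda>(s, d). k s d) \<circ> (\<lambda>s. (s, d)))"
        by (intro continuous_on_compose continuous_intros continuous_on_subset[OF cont]) (use d in auto)
      then show ?thesis by (simp add: o_def)
    qed
    have "norm (integral {b - d..b} (\<lambda>s. k s d - k b 0)) \<le> e / 2 * (b - (b - d))"
    proof (rule integral_bound)
      fix s assume s: "s \<in> {b - d..b}"
      have "dist (s, d) (b, 0) \<le> dist s b + dist d 0"
        unfolding dist_Pair_Pair by (rule sqrt_sum_squares_le_sum) auto
      then have "dist (s, d) (b, 0) < \<delta>" using s d by (auto simp: dist_real_def)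
      then show "norm (k s d - k b 0) \<le> e / 2"
        using \<delta>(2)[of b 0 s d] s d ab by (auto simp: dist_norm)
    qed (use d in \<open>auto intro!: continuous_intros cd\<close>)
    moreover have "integral {b - d..b} (\<lambda>s. k s d - k b 0) = integral {b - d..b} (\<lambda>s. k s d) - d * k b 0"
      using d by (subst integral_diff) (auto intro!: integrable_continuous_real cd)
    ultimately have "\<bar>integral {b - d..b} (\<lambda>s. k s d) - d * k b 0\<bar> \<le> e / 2 * d" by simp
    then have "\<bar>integral {b - d..b} (\<lambda>s. k s d) / d - k b 0\<bar> \<le> e / 2"
      using d by (simp add: field_simps abs_le_iff)
    then show ?case using e by (simp add: dist_real_def)
  qed
qed

lemma continuous_on_shift_pair:
  fixes z :: "real \<Rightarrow> 'a::real_normed_vector"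
  assumes "continuous_on {0..} z" "a \<ge> 0" "bounded_bilinear B"
  shows "continuous_on ({a..b} \<times> {0..c}) (\<lambda>(s, d). B (z s) (z (s + d)))"
proof -
  have "continuous_on ({a..b} \<times> {0..c}) (\<lambda>p. B (z (fst p)) (z (fst p + snd p)))"
    by (intro bounded_bilinear.continuous_on[OF assms(3)] continuous_on_compose2[OF assms(1)] continuous_intros)
       (use assms(2) in auto)
  then show ?thesis by (simp add: case_prod_unfold)
qed

text \<open>With \<open>k s = B (z s) (z (s + d))\<close>, symmetry gives
  \<open>B (z s) (z (s - d)) = k (s - d)\<close>. The two integrals are translates of each other and
  cancel except near the end points.\<close>

lemma symmetric_shift_telescope:
  fixes B :: "'a::real_normed_vector \<Rightarrow> 'a \<Rightarrow> real" and z :: "real \<Rightarrow> 'a"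
  assumes B: "bounded_bilinear B" "\<And>x y. B x y = B y x" and z: "continuous_on {0..} z"
    and d: "0 < d" "d < a" "a \<le> b"
  shows "integral {a..b} (\<lambda>s. B (z s) (z (s + d)) - B (z s) (z (s - d))) =
    integral {b - d..b} (\<lambda>s. B (z s) (z (s + d))) - integral {a - d..a} (\<lambda>s. B (z s) (z (s + d)))"
proof -
  define k where "k s = B (z s) (z (s + d))" for s
  have ck: "continuous_on {0..} k" unfolding k_def
    by (intro bounded_bilinear.continuous_on[OF B(1)] continuous_on_compose2[OF z] continuous_intros)
       (use d in auto)
  have ik: "k integrable_on {x..y}" if "x \<ge> 0" for x y
    by (intro integrable_continuous_real continuous_on_subset[OF ck]) (use that in auto)
  have "(\<lambda>s. k (s + (- d))) = (\<lambda>s. B (z s) (z (s - d)))" by (auto simp: k_def B(2))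
  then have 2: "integral {a..b} (\<lambda>s. B (z s) (z (s - d))) = integral {a - d..b - d} k"
    using integral_shift_real_ivl[of "a - d" "- d" "b - d" k] by simp
  have "integral {a..b} (\<lambda>s. B (z s) (z (s + d)) - B (z s) (z (s - d))) =
      integral {a..b} k - integral {a - d..b - d} k"
    unfolding 2[symmetric] k_def[symmetric]
    using d by (intro integral_diff ik integrable_continuous_real
        bounded_bilinear.continuous_on[OF B(1)] continuous_on_compose2[OF z] continuous_intros) auto
  also have "integral {a - d..b - d} k + integral {b - d..b} k = integral {a - d..a} k + integral {a..b} k"
    using d Henstock_Kurzweil_Integration.integral_combine[where a = "a - d" and b = b and c = "b - d" and f = k]
      Henstock_Kurzweil_Integration.integral_combine[where a = "a - d" and b = b and c = a and f = k] ik[of "a - d" b] by simp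
  then have "integral {a..b} k - integral {a - d..b - d} k = integral {b - d..b} k - integral {a - d..a} k"
    by simp
  finally show ?thesis by (simp add: k_def[abs_def])
qed

text \<open>\<open>V\<close> and \<open>H\<close> are closed subspaces instead of types because in
  the application they depend on the interval length. \<open>J\<close> embeds displacements into the
  velocity space, \<open>M\<close> is the inertia form, and \<open>A\<close> is the elastic form,
  whose coercivity is asked for on \<open>V\<close>.\<close>

locale wave_forms =
  fixes V :: "'v::{real_inner,complete_space} set" and H :: "'h::{real_inner,complete_space} set"
    and J :: "'v \<Rightarrow> 'h" and M :: "'h \<Rightarrow> 'h \<Rightarrow> real" and A :: "'v \<Rightarrow> 'v \<Rightarrow> real" and \<mu> \<alpha> :: real
  assumes V: "subspace V" "closed V" and H: "subspace H" "closed H"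
    and J: "bounded_linear J" and J_V: "\<And>u. u \<in> V \<Longrightarrow> J u \<in> H"
    and J_inj: "\<And>u. u \<in> V \<Longrightarrow> J u = 0 \<Longrightarrow> u = 0"
    and M: "bounded_bilinear M" "\<And>x y. M x y = M y x" "\<mu> > 0" "\<And>x. \<mu> * (norm x)\<^sup>2 \<le> M x x"
    and A: "bounded_bilinear A" "\<And>x y. A x y = A y x" "\<alpha> > 0" "\<And>u. u \<in> V \<Longrightarrow> \<alpha> * (norm u)\<^sup>2 \<le> A u u"
begin

lemmas J_diff = linear_diff[OF bounded_linear.linear[OF J]]

text \<open>Damping and restoring forces enter only through the continuous term \<open>h\<close>.
  The equation is then linear in (z, w, h), so the difference of two solutions of the nonlinear
  problem is again of this kind.\<close>

definition lin_sol :: "(real \<Rightarrow> 'v) \<Rightarrow> (real \<Rightarrow> 'h) \<Rightarrow> (real \<Rightarrow> 'h) \<Rightarrow> bool" where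
  "lin_sol z w h \<longleftrightarrow> continuous_on {0..} z \<and> continuous_on {0..} w \<and> continuous_on {0..} h \<and>
     (\<forall>t\<ge>0. z t \<in> V \<and> w t \<in> H) \<and>
     (\<forall>t\<ge>0. ((\<lambda>s. J (z s)) has_vector_derivative w t) (at t within {0..})) \<and>
     (\<forall>q\<in>V. \<forall>t\<ge>0. ((\<lambda>s. A (z s) q + inner (h s) (J q)) has_integral (M (w 0) (J q) - M (w t) (J q))) {0..t})"

context
  fixes z w h assumes sol: "lin_sol z w h"
begin

lemma sol_cont: "continuous_on {0..} z" "continuous_on {0..} w" "continuous_on {0..} h"
  and sol_V: "t \<ge> 0 \<Longrightarrow> z t \<in> V" "t \<ge> 0 \<Longrightarrow> w t \<in> H"
  and sol_vel: "t \<ge> 0 \<Longrightarrow> ((\<lambda>s. J (z s)) has_vector_derivative w t) (at t within {0..})"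
  and sol_weak: "q \<in> V \<Longrightarrow> t \<ge> 0 \<Longrightarrow>
      ((\<lambda>s. A (z s) q + inner (h s) (J q)) has_integral (M (w 0) (J q) - M (w t) (J q))) {0..t}"
  using sol unfolding lin_sol_def by auto

lemma sol_cont_subset:
  assumes "T \<subseteq> {0..}"
  shows "continuous_on T z" "continuous_on T w" "continuous_on T h"
  using sol_cont assms by (auto intro: continuous_on_subset)

lemma sol_isCont:
  assumes "t > 0"
  shows "isCont z t" "isCont w t" "isCont h t"
  using sol_cont assms
  by (auto intro!: continuous_on_interior[of "{0..}"] simp: interior_real_atLeast)

lemma sol_vel_at: "t > 0 \<Longrightarrow> ((\<lambda>s. J (z s)) has_vector_derivative w t) (at t)"
  using sol_vel[of t] at_within_interior[of t "{0..}"] by (simp add: interior_real_atLeast)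

lemma sol_weak_deriv:
  assumes q: "q \<in> V" and t: "t > 0"
  shows "((\<lambda>s. M (w s) (J q)) has_real_derivative - (A (z t) q + inner (h t) (J q))) (at t)"
proof -
  define k where "k s = A (z s) q + inner (h s) (J q)" for s
  have ck: "continuous_on {0..t + 1} k" unfolding k_def
    by (intro continuous_intros bounded_bilinear.continuous_on[OF A(1)] sol_cont_subset) auto
  have "((\<lambda>s. integral {0..s} k) has_real_derivative k t) (at t within {0..t + 1})"
    using t by (intro integral_has_real_derivative ck) auto
  then have "((\<lambda>s. integral {0..s} k) has_real_derivative k t) (at t)"
    using t by (simp add: at_within_Icc_at)
  then have "((\<lambda>s. M (w 0) (J q) - integral {0..s} k) has_real_derivative 0 - k t) (at t)"
    by (intro derivative_intros)
  then have "((\<lambda>s. M (w s) (J q)) has_real_derivative 0 - k t) (at t)"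
  proof (rule has_field_derivative_transform_within_open[where S = "{0<..}"])
    fix s :: real assume "s \<in> {0<..}"
    then show "M (w 0) (J q) - integral {0..s} k = M (w s) (J q)"
      using sol_weak[OF q, of s] unfolding k_def[symmetric] by (simp add: integral_unique)
  qed (use t in auto)
  then show ?thesis by (simp add: k_def)
qed

text \<open>The moving test function is split into its value at t and the increment since t. The
  first part is covered by the weak equation; in the second the factor
  \<open>J (q s) - J (q t)\<close> vanishes at t, so continuity of \<open>w\<close>
  suffices.\<close>

lemma sol_pairing_deriv:
  assumes t: "t > 0" and q: "q t \<in> V" and dq: "((\<lambda>s. J (q s)) has_vector_derivative q') (at t)"
  shows "((\<lambda>s. M (w s) (J (q s))) has_real_derivative
     (M (w t) q' - A (z t) (q t) - inner (h t) (J (q t)))) (at t)"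
proof -
  have "((\<lambda>s. M (w s) (J (q s) - J (q t))) has_vector_derivative M (w t) q') (at t)"
  proof (rule has_vector_derivative_bilinear_vanishing[OF M(1)])
    show "((\<lambda>s. J (q s) - J (q t)) has_vector_derivative q') (at t)"
      using has_vector_derivative_diff[OF dq has_vector_derivative_const[of "J (q t)"]] by simp
  qed (use sol_isCont(2)[OF t] in \<open>auto simp: isCont_def\<close>)
  then have "((\<lambda>s. M (w s) (J (q t)) + M (w s) (J (q s) - J (q t))) has_real_derivative
      - (A (z t) (q t) + inner (h t) (J (q t))) + M (w t) q') (at t)"
    by (intro DERIV_add sol_weak_deriv q t) (simp add: has_real_derivative_iff_has_vector_derivative)
  then show ?thesis
    by (simp add: bounded_bilinear.diff_right[OF M(1)] algebra_simps)
qed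

text \<open>Mean value inequality for \<open>J (z r) - r *\<^sub>R w s\<close> as a function of r:
  its derivative \<open>w r - w s\<close> is small near s, uniformly on the interval because
  \<open>w\<close> is uniformly continuous.\<close>

lemma sol_velocity_quotient:
  assumes a: "0 < a" and e: "e > 0"
  obtains \<delta> where "\<delta> > 0" "\<And>d s. 0 < d \<Longrightarrow> d < \<delta> \<Longrightarrow> s \<in> {a..b} \<Longrightarrow>
    norm (J (z (s + d)) - J (z (s - d)) - (2 * d) *\<^sub>R w s) \<le> 2 * d * e"
proof -
  have "uniformly_continuous_on {0..b + 1} w"
    by (intro compact_uniformly_continuous sol_cont_subset compact_Icc) auto
  then obtain \<delta> where \<delta>: "\<delta> > 0" "\<And>s s'. s \<in> {0..b + 1} \<Longrightarrow> s' \<in> {0..b + 1} \<Longrightarrow> dist s' s < \<delta> \<Longrightarrow> dist (w s') (w s) < e"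
    unfolding uniformly_continuous_on_def using e by metis
  show ?thesis
  proof (rule that[of "min \<delta> (min a 1)"])
    fix d s assume d: "0 < d" "d < min \<delta> (min a 1)" and s: "s \<in> {a..b}"
    have "norm ((J (z (s + d)) - (s + d) *\<^sub>R w s) - (J (z (s - d)) - (s - d) *\<^sub>R w s)) \<le> e * norm ((s + d) - (s - d))"
    proof (rule differentiable_bound[where S = "{s - d..s + d}" and f' = "\<lambda>x y. y *\<^sub>R (w x - w s)"])
      fix x assume x: "x \<in> {s - d..s + d}"
      then have x0: "x > 0" using d s by auto
      have "((\<lambda>r. J (z r) - r *\<^sub>R w s) has_vector_derivative w x - 1 *\<^sub>R w s) (at x)"
        by (intro has_vector_derivative_diff sol_vel_at x0) (auto intro!: derivative_eq_intros)
      then show "((\<lambda>r. J (z r) - r *\<^sub>R w s) has_derivative (\<lambda>y. y *\<^sub>R (w x - w s))) (at x within {s - d..s + d})"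
        by (simp add: has_vector_derivative_def has_derivative_at_withinI)
      have "dist (w x) (w s) < e" using x d s by (intro \<delta>(2)) (auto simp: dist_real_def)
      then show "onorm (\<lambda>y. y *\<^sub>R (w x - w s)) \<le> e"
        by (intro onorm_le) (simp add: dist_norm mult.commute[of e] mult_left_mono)
    qed (use d in auto)
    moreover have "(J (z (s + d)) - (s + d) *\<^sub>R w s) - (J (z (s - d)) - (s - d) *\<^sub>R w s) =
        J (z (s + d)) - J (z (s - d)) - (2 * d) *\<^sub>R w s"
      by (simp add: algebra_simps flip: scaleR_add_left)
    ultimately show "norm (J (z (s + d)) - J (z (s - d)) - (2 * d) *\<^sub>R w s) \<le> 2 * d * e"
      using d by (simp add: mult_ac)
  qed (use \<delta>(1) a in auto)
qed

text \<open>A weak solution need not have enough regularity to be tested with its own velocity. Testing with the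
  symmetric difference z(s + d) - z(s - d) is admissible, and by symmetry of the two forms the resulting
  integrals telescope; the identity follows on dividing by d and letting d tend to 0.\<close>
lemma energy_identity:
  assumes ab: "0 < a" "a \<le> b"
  shows "M (w b) (w b) + A (z b) (z b) - (M (w a) (w a) + A (z a) (z a)) =
    - 2 * integral {a..b} (\<lambda>s. inner (h s) (w s))"
proof -
  define D where "D d s = J (z (s + d)) - J (z (s - d))" for d s
  define IM where "IM d x = integral {x - d..x} (\<lambda>s. M (w s) (w (s + d)))" for d x
  define IA where "IA d x = integral {x - d..x} (\<lambda>s. A (z s) (z (s + d)))" for d x
  have sd: "((\<lambda>r. r + c) has_vector_derivative 1) (at x within T)" for c x :: real and T
    by (simp add: has_vector_derivative_add_const has_vector_derivative_diff_const)
  have Dcont: "continuous_on {a..b} (D d)" if "0 < d" "d < a" for d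
    unfolding D_def using that ab
    by (intro continuous_intros continuous_on_compose2[OF sol_cont(1)] bounded_linear.continuous_on[OF J]) auto
  \<comment> \<open>The restriction d < a keeps s - d positive, where \<open>J z\<close> has the
    two-sided derivative \<open>w\<close>.\<close>
  have id: "M (w b) (D d b) - M (w a) (D d a) =
      (IM d b - IM d a) - (IA d b - IA d a) - integral {a..b} (\<lambda>s. inner (h s) (D d s))"
    if d: "0 < d" "d < a" for d
  proof -
    define k where "k s = M (w s) (w (s + d)) - M (w s) (w (s - d)) -
        (A (z s) (z (s + d)) - A (z s) (z (s - d))) - inner (h s) (D d s)" for s
    have der: "((\<lambda>s. M (w s) (D d s)) has_real_derivative k s) (at s)" if s: "s \<ge> a" for s
    proof -
      have "((\<lambda>r. M (w r) (J (z (r + d) - z (r - d)))) has_real_derivative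
         M (w s) (w (s + d) - w (s - d)) - A (z s) (z (s + d) - z (s - d)) -
         inner (h s) (J (z (s + d) - z (s - d)))) (at s)"
      proof (rule sol_pairing_deriv)
        show "0 < s" using s ab by simp
        show "z (s + d) - z (s - d) \<in> V" using s d by (intro subspace_diff V sol_V) auto
        have 1: "((\<lambda>r. J (z (r + d))) has_vector_derivative 1 *\<^sub>R w (s + d)) (at s)"
          using vector_diff_chain_at[OF sd, of "\<lambda>r. J (z r)" "w (s + d)" s d] sol_vel_at[of "s + d"] s d
          by (auto simp: o_def)
        have 2: "((\<lambda>r. J (z (r - d))) has_vector_derivative 1 *\<^sub>R w (s - d)) (at s)"
          using vector_diff_chain_at[OF sd, of "\<lambda>r. J (z r)" "w (s - d)" s "- d"] sol_vel_at[of "s - d"] s d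
          by (auto simp: o_def)
        show "((\<lambda>r. J (z (r + d) - z (r - d))) has_vector_derivative w (s + d) - w (s - d)) (at s)"
          using has_vector_derivative_diff[OF 1 2] by (simp add: J_diff)
      qed
      then show ?thesis
        by (simp add: k_def D_def J_diff bounded_bilinear.diff_right[OF M(1)] bounded_bilinear.diff_right[OF A(1)])
    qed
    have "(k has_integral (M (w b) (D d b) - M (w a) (D d a))) {a..b}"
      using der ab by (intro fundamental_theorem_of_calculus)
        (auto simp: has_real_derivative_iff_has_vector_derivative[symmetric] has_field_derivative_at_within)
    moreover have "integral {a..b} k = integral {a..b} (\<lambda>s. M (w s) (w (s + d)) - M (w s) (w (s - d))) -
        integral {a..b} (\<lambda>s. A (z s) (z (s + d)) - A (z s) (z (s - d))) - integral {a..b} (\<lambda>s. inner (h s) (D d s))"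
    proof -
      have 1: "(\<lambda>s. M (w s) (w (s + d)) - M (w s) (w (s - d))) integrable_on {a..b}"
        using d ab by (intro integrable_continuous_real continuous_intros bounded_bilinear.continuous_on[OF M(1)]
            continuous_on_compose2[OF sol_cont(2)]) auto
      have 2: "(\<lambda>s. A (z s) (z (s + d)) - A (z s) (z (s - d))) integrable_on {a..b}"
        using d ab by (intro integrable_continuous_real continuous_intros bounded_bilinear.continuous_on[OF A(1)]
            continuous_on_compose2[OF sol_cont(1)]) auto
      have 3: "(\<lambda>s. inner (h s) (D d s)) integrable_on {a..b}"
        using d ab by (intro integrable_continuous_real continuous_intros Dcont sol_cont_subset) auto
      show ?thesis unfolding k_def
        by (simp only: integral_diff integrable_diff 1 2 3)
    qed
    ultimately show ?thesis
      using symmetric_shift_telescope[OF M(1,2) sol_cont(2) d ab(2)]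
        symmetric_shift_telescope[OF A(1,2) sol_cont(1) d ab(2)]
      by (simp add: integral_unique IM_def IA_def)
  qed
  have ev: "\<forall>\<^sub>F d in at_right 0. 0 < d \<and> d < a"
    by (rule eventually_at_rightI[of 0 a]) (use ab in auto)
  have lM: "((\<lambda>d. IM d x / d) \<longlongrightarrow> M (w x) (w x)) (at_right 0)" if "x > 0" for x
    unfolding IM_def
    using shifted_quotient_integral[of 0 x 1 "\<lambda>s d. M (w s) (w (s + d))",
        OF continuous_on_shift_pair[OF sol_cont(2) _ M(1)]] that by simp
  have lA: "((\<lambda>d. IA d x / d) \<longlongrightarrow> A (z x) (z x)) (at_right 0)" if "x > 0" for x
    unfolding IA_def
    using shifted_quotient_integral[of 0 x 1 "\<lambda>s d. A (z s) (z (s + d))",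
        OF continuous_on_shift_pair[OF sol_cont(1) _ A(1)]] that by simp
  have lD: "((\<lambda>d. D d x /\<^sub>R d) \<longlongrightarrow> 2 *\<^sub>R w x) (at_right 0)" if x: "x > 0" for x
  proof (rule tendstoI)
    fix e :: real assume "e > 0"
    then obtain \<delta> where \<delta>: "\<delta> > 0" "\<And>d s. 0 < d \<Longrightarrow> d < \<delta> \<Longrightarrow> s \<in> {x..x} \<Longrightarrow>
        norm (J (z (s + d)) - J (z (s - d)) - (2 * d) *\<^sub>R w s) \<le> 2 * d * (e / 4)"
      using sol_velocity_quotient[OF x, of "e / 4" x] by auto
    have "\<forall>\<^sub>F d in at_right 0. 0 < d \<and> d < \<delta>" by (rule eventually_at_rightI[of 0 \<delta>]) (use \<delta> in auto)
    then show "\<forall>\<^sub>F d in at_right 0. dist (D d x /\<^sub>R d) (2 *\<^sub>R w x) < e"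
    proof eventually_elim
      case (elim d)
      have "D d x /\<^sub>R d - 2 *\<^sub>R w x = (1 / d) *\<^sub>R (D d x - (2 * d) *\<^sub>R w x)"
        using elim by (simp add: scaleR_diff_right inverse_eq_divide)
      then have "norm (D d x /\<^sub>R d - 2 *\<^sub>R w x) = norm (D d x - (2 * d) *\<^sub>R w x) / d" using elim by simp
      also have "\<dots> \<le> e / 2" using \<delta>(2)[of d x] elim unfolding D_def by (simp add: field_simps)
      finally show ?case using \<open>e > 0\<close> by (simp add: dist_norm)
    qed
  qed
  have lMD: "((\<lambda>d. M (w x) (D d x) / d) \<longlongrightarrow> 2 * M (w x) (w x)) (at_right 0)" if x: "x > 0" for x
    using bounded_linear.tendsto[OF bounded_bilinear.bounded_linear_right[OF M(1)] lD[OF x], of "w x"]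
    by (simp add: bounded_bilinear.scaleR_right[OF M(1)] divide_inverse mult.commute)
  have lI: "((\<lambda>d. integral {a..b} (\<lambda>s. inner (h s) (D d s)) / d) \<longlongrightarrow>
      2 * integral {a..b} (\<lambda>s. inner (h s) (w s))) (at_right 0)"
  proof (rule tendstoI)
    fix e :: real assume e: "e > 0"
    have "bounded (h ` {a..b})"
      using ab by (intro compact_imp_bounded compact_continuous_image sol_cont_subset) auto
    then obtain C where C: "C > 0" "\<And>s. s \<in> {a..b} \<Longrightarrow> norm (h s) \<le> C" unfolding bounded_pos by auto
    \<comment> \<open>The integrated error is at most \<open>C * (2 * d * e') * (b - a)\<close>, and
      this choice keeps it below d e / 2. The summand 1 keeps the denominator positive when a =
      b.\<close>
    define e' where "e' = e / (4 * C * (b - a + 1))"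
    have e': "e' > 0" using e C(1) ab by (simp add: e'_def)
    have e'_eq: "C * (b - a + 1) * e' = e / 4" using C(1) ab
      by (simp add: e'_def) (simp add: add_pos_nonneg divide_eq_eq algebra_simps)
    obtain \<delta> where \<delta>: "\<delta> > 0" "\<And>d s. 0 < d \<Longrightarrow> d < \<delta> \<Longrightarrow> s \<in> {a..b} \<Longrightarrow>
        norm (J (z (s + d)) - J (z (s - d)) - (2 * d) *\<^sub>R w s) \<le> 2 * d * e'"
      using sol_velocity_quotient[OF ab(1) e'] by metis
    have "\<forall>\<^sub>F d in at_right 0. 0 < d \<and> d < \<delta>" by (rule eventually_at_rightI[of 0 \<delta>]) (use \<delta> in auto)
    with ev show "\<forall>\<^sub>F d in at_right 0. dist (integral {a..b} (\<lambda>s. inner (h s) (D d s)) / d)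
        (2 * integral {a..b} (\<lambda>s. inner (h s) (w s))) < e"
    proof eventually_elim
      case (elim d)
      have c1: "continuous_on {a..b} (\<lambda>s. inner (h s) (D d s))" "continuous_on {a..b} (\<lambda>s. inner (h s) (w s))"
        using elim ab by (auto intro!: continuous_intros Dcont sol_cont_subset)
      have "norm (integral {a..b} (\<lambda>s. inner (h s) (D d s) - 2 * d * inner (h s) (w s))) \<le> C * (2 * d * e') * (b - a)"
      proof (rule integral_bound)
        fix s assume s: "s \<in> {a..b}"
        have "\<bar>inner (h s) (D d s - (2 * d) *\<^sub>R w s)\<bar> \<le> norm (h s) * norm (D d s - (2 * d) *\<^sub>R w s)"
          by (rule Cauchy_Schwarz_ineq2)
        also have "\<dots> \<le> C * (2 * d * e')"
          using C s \<delta>(2)[of d s] elim unfolding D_def by (intro mult_mono) auto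
        finally show "norm (inner (h s) (D d s) - 2 * d * inner (h s) (w s)) \<le> C * (2 * d * e')"
          by (simp add: inner_diff_right)
      qed (use ab in \<open>auto intro!: continuous_intros c1\<close>)
      also have "integral {a..b} (\<lambda>s. inner (h s) (D d s) - 2 * d * inner (h s) (w s)) =
          integral {a..b} (\<lambda>s. inner (h s) (D d s)) - 2 * d * integral {a..b} (\<lambda>s. inner (h s) (w s))"
        by (subst integral_diff) (auto intro!: integrable_continuous_real continuous_intros c1)
      also have "C * (2 * d * e') * (b - a) \<le> C * (2 * d * e') * (b - a + 1)"
        using C(1) e' elim by (intro mult_left_mono) auto
      also have "\<dots> = 2 * d * (C * (b - a + 1) * e')" by (simp add: mult_ac)
      also have "\<dots> = d * e / 2" unfolding e'_eq by simp
      finally have "\<bar>integral {a..b} (\<lambda>s. inner (h s) (D d s)) / d - 2 * integral {a..b} (\<lambda>s. inner (h s) (w s))\<bar> \<le> e / 2"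
        using elim by (simp add: field_simps abs_le_iff)
      then show ?case using e by (simp add: dist_real_def)
    qed
  qed
  have "((\<lambda>d. M (w b) (D d b) / d - M (w a) (D d a) / d) \<longlongrightarrow> 2 * M (w b) (w b) - 2 * M (w a) (w a)) (at_right 0)"
    using ab by (intro tendsto_diff lMD) auto
  moreover have "((\<lambda>d. M (w b) (D d b) / d - M (w a) (D d a) / d) \<longlongrightarrow>
     (M (w b) (w b) - M (w a) (w a)) - (A (z b) (z b) - A (z a) (z a)) - 2 * integral {a..b} (\<lambda>s. inner (h s) (w s))) (at_right 0)"
  proof (rule Lim_transform_eventually)
    show "((\<lambda>d. (IM d b / d - IM d a / d) - (IA d b / d - IA d a / d) - integral {a..b} (\<lambda>s. inner (h s) (D d s)) / d) \<longlongrightarrow>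
     (M (w b) (w b) - M (w a) (w a)) - (A (z b) (z b) - A (z a) (z a)) - 2 * integral {a..b} (\<lambda>s. inner (h s) (w s))) (at_right 0)"
      using ab by (intro tendsto_diff lM lA lI) auto
    show "\<forall>\<^sub>F d in at_right 0. (IM d b / d - IM d a / d) - (IA d b / d - IA d a / d) -
        integral {a..b} (\<lambda>s. inner (h s) (D d s)) / d = M (w b) (D d b) / d - M (w a) (D d a) / d"
      using ev by eventually_elim (use id in \<open>auto simp flip: diff_divide_distrib\<close>)
  qed
  \<comment> \<open>One limit contains the kinetic increment twice, the other once together with
    minus the elastic increment; the difference is the increment of the full energy.\<close>
  ultimately have "2 * M (w b) (w b) - 2 * M (w a) (w a) =
     (M (w b) (w b) - M (w a) (w a)) - (A (z b) (z b) - A (z a) (z a)) - 2 * integral {a..b} (\<lambda>s. inner (h s) (w s))"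
    by (intro tendsto_unique[OF trivial_limit_at_right_real])
  then show ?thesis by simp
qed

lemma energy_deriv:
  assumes t: "t > 0"
  shows "((\<lambda>s. (M (w s) (w s) + A (z s) (z s)) / 2) has_real_derivative - inner (h t) (w t)) (at t)"
proof -
  \<comment> \<open>The energy identity holds between positive times, so the primitive starts at
    t/2.\<close>
  have "((\<lambda>s. integral {t/2..s} (\<lambda>s. inner (h s) (w s))) has_real_derivative inner (h t) (w t)) (at t within {t/2..t + 1})"
    using t by (intro integral_has_real_derivative continuous_intros sol_cont_subset) auto
  then have "((\<lambda>s. integral {t/2..s} (\<lambda>s. inner (h s) (w s))) has_real_derivative inner (h t) (w t)) (at t)"
    using t by (simp add: at_within_Icc_at)
  then have "((\<lambda>s. (M (w (t/2)) (w (t/2)) + A (z (t/2)) (z (t/2))) / 2 - integral {t/2..s} (\<lambda>s. inner (h s) (w s)))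
      has_real_derivative 0 - inner (h t) (w t)) (at t)"
    by (intro derivative_intros)
  then have "((\<lambda>s. (M (w s) (w s) + A (z s) (z s)) / 2) has_real_derivative 0 - inner (h t) (w t)) (at t)"
  proof (rule has_field_derivative_transform_within_open[where S = "{t/2<..}"])
    fix s assume "s \<in> {t/2<..}"
    then show "(M (w (t/2)) (w (t/2)) + A (z (t/2)) (z (t/2))) / 2 - integral {t/2..s} (\<lambda>s. inner (h s) (w s)) =
        (M (w s) (w s) + A (z s) (z s)) / 2"
      using energy_identity[of "t/2" s] t by (simp add: field_simps)
  qed (use t in auto)
  then show ?thesis by simp
qed

text \<open>Testing with the displacement itself is admissible. Its value is that it exchanges
  elastic for kinetic energy when added to an energy balance.\<close>

lemma equipartition_deriv:
  assumes t: "t > 0"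
  shows "((\<lambda>s. M (w s) (J (z s))) has_real_derivative
     (M (w t) (w t) - A (z t) (z t) - inner (h t) (J (z t)))) (at t)"
  using t by (intro sol_pairing_deriv sol_V sol_vel_at) auto

lemma energy_cont: "continuous_on {0..} (\<lambda>s. (M (w s) (w s) + A (z s) (z s)) / 2)"
  by (intro continuous_intros bounded_bilinear.continuous_on[OF M(1)] bounded_bilinear.continuous_on[OF A(1)] sol_cont) auto

text \<open>Translated solutions, combined with uniqueness, give the semigroup law.\<close>

lemma lin_sol_shift:
  assumes r: "r \<ge> 0"
  shows "lin_sol (\<lambda>t. z (t + r)) (\<lambda>t. w (t + r)) (\<lambda>t. h (t + r))"
  unfolding lin_sol_def
proof (intro conjI allI impI ballI)
  have sd: "((\<lambda>r. r + c) has_vector_derivative 1) (at x within T)" for c x :: real and T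
    by (simp add: has_vector_derivative_add_const has_vector_derivative_diff_const)
  show "continuous_on {0..} (\<lambda>t. z (t + r))" "continuous_on {0..} (\<lambda>t. w (t + r))" "continuous_on {0..} (\<lambda>t. h (t + r))"
    using r by (auto intro!: continuous_on_compose2[OF sol_cont(1)] continuous_on_compose2[OF sol_cont(2)]
        continuous_on_compose2[OF sol_cont(3)] continuous_intros)
  fix t :: real assume t: "t \<ge> 0"
  show "z (t + r) \<in> V" "w (t + r) \<in> H" using sol_V t r by auto
  have "((\<lambda>s. J (z s)) has_vector_derivative w (t + r)) (at (t + r) within (\<lambda>s. s + r) ` {0..})"
    using sol_vel[of "t + r"] t r by (auto intro: has_vector_derivative_within_subset)
  then show "((\<lambda>s. J (z (s + r))) has_vector_derivative w (t + r)) (at t within {0..})"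
    using vector_diff_chain_within[OF sd, of "\<lambda>s. J (z s)" "w (t + r)" t r "{0..}"]
    by (auto simp: o_def)
  fix q assume q: "q \<in> V"
  have "((\<lambda>s. A (z (s + r)) q + inner (h (s + r)) (J q)) has_integral
      (- M (w (t + r)) (J q)) - (- M (w (0 + r)) (J q))) {0..t}"
  \<comment> \<open>For r = 0 the pairing is known to be differentiable only at s > 0, hence the
    version that asks for derivatives in the open interval and continuity on the closed one.\<close>
  proof (rule fundamental_theorem_of_calculus_interior[OF t])
    have "continuous_on {0..t} (\<lambda>s. w (s + r))"
      by (intro continuous_on_compose2[OF sol_cont(2)] continuous_intros) (use r in auto)
    then show "continuous_on {0..t} (\<lambda>s. - M (w (s + r)) (J q))"
      by (intro continuous_intros bounded_bilinear.continuous_on[OF M(1)])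
    fix s assume "s \<in> {0<..<t}"
    then have "s + r > 0" using r by auto
    have "((\<lambda>s. - M (w s) (J q)) has_real_derivative (A (z (s + r)) q + inner (h (s + r)) (J q))) (at (s + r))"
      using DERIV_minus[OF sol_weak_deriv[OF q \<open>s + r > 0\<close>]] by (simp only: minus_minus)
    then show "((\<lambda>s. - M (w (s + r)) (J q)) has_vector_derivative (A (z (s + r)) q + inner (h (s + r)) (J q))) (at s)"
      unfolding has_real_derivative_iff_has_vector_derivative[symmetric] by (simp add: DERIV_shift)
  qed
  then show "((\<lambda>s. A (z (s + r)) q + inner (h (s + r)) (J q)) has_integral
      (M (w (0 + r)) (J q) - M (w (t + r)) (J q))) {0..t}" by simp
qed

end

lemma lin_sol_diff:
  assumes "lin_sol z1 w1 h1" "lin_sol z2 w2 h2"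
  shows "lin_sol (\<lambda>t. z1 t - z2 t) (\<lambda>t. w1 t - w2 t) (\<lambda>t. h1 t - h2 t)"
  unfolding lin_sol_def
proof (intro conjI allI impI ballI continuous_on_diff sol_cont[OF assms(1)] sol_cont[OF assms(2)])
  fix t :: real assume t: "t \<ge> 0"
  show "z1 t - z2 t \<in> V" "w1 t - w2 t \<in> H"
    using t sol_V[OF assms(1)] sol_V[OF assms(2)] by (auto intro!: subspace_diff V H)
  show "((\<lambda>s. J (z1 s - z2 s)) has_vector_derivative w1 t - w2 t) (at t within {0..})"
    using has_vector_derivative_diff[OF sol_vel[OF assms(1) t] sol_vel[OF assms(2) t]] by (simp add: J_diff)
  fix q assume q: "q \<in> V"
  show "((\<lambda>s. A (z1 s - z2 s) q + inner (h1 s - h2 s) (J q)) has_integral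
     (M (w1 0 - w2 0) (J q) - M (w1 t - w2 t) (J q))) {0..t}"
    using has_integral_diff[OF sol_weak[OF assms(1) q t] sol_weak[OF assms(2) q t]]
    by (simp add: bounded_bilinear.diff_left[OF A(1)] bounded_bilinear.diff_left[OF M(1)] inner_diff_left algebra_simps)
qed

end

section \<open>Nonlinearly damped waves\<close>

lemma gronwall_deriv:
  fixes g g' :: "real \<Rightarrow> real"
  assumes "continuous_on {0..} g" "\<And>t. t > 0 \<Longrightarrow> (g has_real_derivative g' t) (at t)"
    "\<And>t. t > 0 \<Longrightarrow> g' t \<le> K * g t" "t \<ge> 0"
  shows "g t \<le> g 0 * exp (K * t)"
proof -
  have "g t * exp (- K * t) \<le> g 0 * exp (- K * 0)"
  proof (rule DERIV_nonpos_imp_decreasing_open[OF \<open>t \<ge> 0\<close>])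
    fix x assume x: "0 < x" "x < t"
    have "((\<lambda>t. g t * exp (- K * t)) has_real_derivative (g' x * exp (- K * x) + (exp (- K * x) * (- K)) * g x)) (at x)"
      by (auto intro!: derivative_eq_intros assms(2) x)
    moreover have "g' x * exp (- K * x) + (exp (- K * x) * (- K)) * g x = exp (- K * x) * (g' x - K * g x)"
      by (simp add: algebra_simps)
    moreover have "exp (- K * x) * (g' x - K * g x) \<le> 0"
      using assms(3)[OF x(1)] by (intro mult_nonneg_nonpos) auto
    ultimately show "\<exists>y. DERIV (\<lambda>t. g t * exp (- K * t)) x :> y \<and> y \<le> 0" by metis
  next
    show "continuous_on {0..t} (\<lambda>t. g t * exp (- K * t))"
      by (intro continuous_intros continuous_on_subset[OF assms(1)]) auto
  qed
  then have "g t * exp (- K * t) * exp (K * t) \<le> g 0 * exp (K * t)" by (intro mult_right_mono) auto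
  then show ?thesis by (simp add: mult.assoc flip: exp_add)
qed

lemma le_of_square_le:
  fixes x k c :: real
  assumes "k > 0" "k * x\<^sup>2 \<le> c"
  shows "x \<le> 1 + \<bar>c / k\<bar>"
proof (cases "x \<le> 1")
  case False
  then have "x \<le> x\<^sup>2" by (simp add: self_le_power)
  also have "x\<^sup>2 \<le> c / k" using assms by (simp add: field_simps)
  finally show ?thesis by linarith
qed linarith

text \<open>\<open>f_lip\<close> and \<open>Phi_taylor\<close> measure differences of displacements
  after \<open>J\<close>, in the norm in which bounded sets are precompact; this makes the restoring
  force a compact perturbation. \<open>G_damp\<close> stands in for a uniform lower bound on the
  damping. \<open>S\<close> is described by its weak equation and continuity in time; its semigroup
  law and continuity in the data are consequences.\<close>

locale damped_wave = wave_forms V H J M A \<mu> \<alpha>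
  for V :: "'v::{real_inner,complete_space} set" and H :: "'h::{real_inner,complete_space} set"
    and J M A \<mu> \<alpha> +
  fixes G :: "'h \<Rightarrow> 'h" and f :: "'v \<Rightarrow> 'h" and Phi :: "'v \<Rightarrow> real"
    and S :: "real \<Rightarrow> 'v \<times> 'h \<Rightarrow> 'v \<times> 'h" and \<kappa> C0 :: real
  assumes G_cont: "continuous_on H G" and G_0: "G 0 = 0"
    and G_mono: "\<And>v w. v \<in> H \<Longrightarrow> w \<in> H \<Longrightarrow> 0 \<le> inner (G v - G w) (v - w)"
    and G_pos: "\<And>v. v \<in> H \<Longrightarrow> inner (G v) v = 0 \<Longrightarrow> v = 0"
    and G_bdd: "\<And>R. \<exists>C. \<forall>v\<in>H. norm v \<le> R \<longrightarrow> norm (G v) \<le> C"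
    and G_damp: "\<And>\<delta>. \<delta> > 0 \<Longrightarrow> \<exists>C\<ge>0. \<forall>v\<in>H. \<forall>w\<in>H. (norm (v - w))\<^sup>2 \<le>
        \<delta> + C * (inner (G v - G w) (v - w) + inner (G v) v + inner (G w) w)"
    and f_lip: "\<And>R. \<exists>C. \<forall>u\<in>V. \<forall>w\<in>V. norm u \<le> R \<longrightarrow> norm w \<le> R \<longrightarrow>
        norm (f u - f w) \<le> C * norm (J u - J w)"
    and Phi_taylor: "\<And>R. \<exists>C. \<forall>u\<in>V. \<forall>w\<in>V. norm u \<le> R \<longrightarrow> norm w \<le> R \<longrightarrow>
        \<bar>Phi u - Phi w - inner (f w) (J u - J w)\<bar> \<le> C * (norm (J u - J w))\<^sup>2"
    and \<kappa>: "\<kappa> > 0"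
    and Phi_lower: "\<And>u. u \<in> V \<Longrightarrow> \<kappa> * (norm u)\<^sup>2 - C0 \<le> A u u / 2 + Phi u"
    and f_lower: "\<And>u. u \<in> V \<Longrightarrow> \<kappa> * (norm u)\<^sup>2 - C0 \<le> A u u + inner (f u) (J u)"
    and J_compact: "\<And>R \<eta>. \<eta> > 0 \<Longrightarrow> \<exists>X. finite X \<and> (\<forall>u\<in>V. norm u \<le> R \<longrightarrow> (\<exists>x\<in>X. dist (J u) x < \<eta>))"
    and S_0: "\<And>y. y \<in> V \<times> H \<Longrightarrow> S 0 y = y"
    and S_in: "\<And>y t. y \<in> V \<times> H \<Longrightarrow> t \<ge> 0 \<Longrightarrow> S t y \<in> V \<times> H"
    and S_time_cont: "\<And>y. y \<in> V \<times> H \<Longrightarrow> continuous_on {0..} (\<lambda>t. S t y)"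
    and S_vel: "\<And>y t. y \<in> V \<times> H \<Longrightarrow> t \<ge> 0 \<Longrightarrow>
        ((\<lambda>s. J (fst (S s y))) has_vector_derivative snd (S t y)) (at t within {0..})"
    and S_weak: "\<And>y q t. y \<in> V \<times> H \<Longrightarrow> q \<in> V \<Longrightarrow> t \<ge> 0 \<Longrightarrow>
        ((\<lambda>s. A (fst (S s y)) q + inner (G (snd (S s y)) + f (fst (S s y))) (J q)) has_integral
          (M (snd (S 0 y)) (J q) - M (snd (S t y)) (J q))) {0..t}"
begin

section \<open>Energy, uniqueness and continuous dependence\<close>

definition P :: "('v \<times> 'h) set" where "P = V \<times> H"

definition sol :: "(real \<Rightarrow> 'v \<times> 'h) \<Rightarrow> bool" where
  "sol U \<longleftrightarrow> lin_sol (\<lambda>t. fst (U t)) (\<lambda>t. snd (U t)) (\<lambda>t. G (snd (U t)) + f (fst (U t)))"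

definition E :: "'v \<times> 'h \<Rightarrow> real" where
  "E y = (M (snd y) (snd y) + A (fst y) (fst y)) / 2 + Phi (fst y)"

text \<open>The quadratic part of the energy, evaluated on a difference; on \<open>P\<close> it is
  equivalent to the squared distance and, unlike that distance, has a computable time
  derivative.\<close>

definition D :: "'v \<times> 'h \<Rightarrow> 'v \<times> 'h \<Rightarrow> real" where
  "D y y' = (M (snd y - snd y') (snd y - snd y') + A (fst y - fst y') (fst y - fst y')) / 2"

lemma J_cont: "continuous_on T J"
  by (rule linear_continuous_on[OF J])

lemma J_lin: "J (u - w) = J u - J w"
  by (rule J_diff)

lemma G_nonneg: "v \<in> H \<Longrightarrow> 0 \<le> inner (G v) v"
  using G_mono[of v 0] subspace_0[OF H(1)] by (simp add: G_0)

lemma f_cont: "continuous_on V f"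
  unfolding continuous_on_iff
proof (intro ballI allI impI)
  fix u e assume u: "u \<in> V" and e: "(e::real) > 0"
  obtain C where C: "\<And>u' w. u' \<in> V \<Longrightarrow> w \<in> V \<Longrightarrow> norm u' \<le> norm u + 1 \<Longrightarrow> norm w \<le> norm u + 1 \<Longrightarrow>
      norm (f u' - f w) \<le> C * norm (J u' - J w)" using f_lip[of "norm u + 1"] by blast
  have "isCont J u" using J_cont[of UNIV] by (simp add: continuous_on_eq_continuous_at)
  then obtain d where d: "d > 0" "\<And>w. dist w u < d \<Longrightarrow> dist (J w) (J u) < e / (\<bar>C\<bar> + 1)"
    unfolding continuous_at_eps_delta using e by (metis abs_ge_zero add_nonneg_pos divide_pos_pos zero_less_one)
  show "\<exists>d>0. \<forall>w\<in>V. dist w u < d \<longrightarrow> dist (f w) (f u) < e"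
  proof (intro exI[of _ "min d 1"] conjI ballI impI)
    fix w assume w: "w \<in> V" "dist w u < min d 1"
    have "norm w \<le> norm u + 1" using w(2) norm_triangle_ineq2[of w u] by (simp add: dist_norm)
    then have "norm (f w - f u) \<le> C * norm (J w - J u)" using C[OF w(1) u] by simp
    also have "\<dots> \<le> (\<bar>C\<bar> + 1) * norm (J w - J u)" by (intro mult_right_mono) auto
    also have "\<dots> < e" using d(2)[of w] w(2) by (simp add: dist_norm pos_less_divide_eq add_nonneg_pos mult.commute)
    finally show "dist (f w) (f u) < e" by (simp add: dist_norm)
  qed (use d in auto)
qed

lemma Phi_cont: "continuous_on V Phi"
  unfolding continuous_on_def
proof
  fix u assume u: "u \<in> V"
  obtain C where C: "\<And>u' w. u' \<in> V \<Longrightarrow> w \<in> V \<Longrightarrow> norm u' \<le> norm u + 1 \<Longrightarrow> norm w \<le> norm u + 1 \<Longrightarrow>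
      \<bar>Phi u' - Phi w - inner (f w) (J u' - J w)\<bar> \<le> C * (norm (J u' - J w))\<^sup>2" using Phi_taylor[of "norm u + 1"] by blast
  have JJ: "(J \<longlongrightarrow> J u) (at u within V)" using J_cont[of V] u by (simp add: continuous_on_def)
  have "((\<lambda>w. Phi w - Phi u - inner (f u) (J w - J u)) \<longlongrightarrow> 0) (at u within V)"
  proof (rule Lim_null_comparison)
    show "\<forall>\<^sub>F w in at u within V. norm (Phi w - Phi u - inner (f u) (J w - J u)) \<le> C * (norm (J w - J u))\<^sup>2"
      unfolding eventually_at
    proof (intro exI[of _ 1] conjI ballI impI)
      fix w assume w: "w \<in> V" "w \<noteq> u \<and> dist w u < 1"
      have "norm w \<le> norm u + 1" using w(2) norm_triangle_ineq2[of w u] by (simp add: dist_norm)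
      then show "norm (Phi w - Phi u - inner (f u) (J w - J u)) \<le> C * (norm (J w - J u))\<^sup>2" using C[OF w(1) u] by simp
    qed simp
    have "((\<lambda>w. C * (norm (J w - J u))\<^sup>2) \<longlongrightarrow> C * (norm (J u - J u))\<^sup>2) (at u within V)"
      by (intro tendsto_intros JJ)
    then show "((\<lambda>w. C * (norm (J w - J u))\<^sup>2) \<longlongrightarrow> 0) (at u within V)" by simp
  qed
  moreover have "((\<lambda>w. inner (f u) (J w - J u)) \<longlongrightarrow> inner (f u) (J u - J u)) (at u within V)"
    by (intro tendsto_intros JJ)
  ultimately have "((\<lambda>w. (Phi w - Phi u - inner (f u) (J w - J u)) + inner (f u) (J w - J u) + Phi u) \<longlongrightarrow> 0 + inner (f u) (J u - J u) + Phi u) (at u within V)"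
    by (intro tendsto_add tendsto_const)
  then show "(Phi \<longlongrightarrow> Phi u) (at u within V)" by simp
qed

lemma E_cont: "continuous_on P E"
  unfolding E_def[abs_def] P_def
  by (intro continuous_intros bounded_bilinear.continuous_on[OF M(1)] bounded_bilinear.continuous_on[OF A(1)]
      continuous_on_compose2[OF Phi_cont]) auto

lemma S_sol:
  assumes y: "y \<in> P" shows "sol (\<lambda>t. S t y)"
proof -
  have y': "y \<in> V \<times> H" using y by (simp add: P_def)
  have c: "continuous_on {0..} (\<lambda>t. fst (S t y))" "continuous_on {0..} (\<lambda>t. snd (S t y))"
    by (intro continuous_intros S_time_cont y')+
  have i: "fst (S t y) \<in> V \<and> snd (S t y) \<in> H" if "t \<ge> 0" for t
    using S_in[OF y' that] by (auto simp: mem_Times_iff)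
  show ?thesis unfolding sol_def lin_sol_def
  proof (intro conjI allI impI ballI)
    show "continuous_on {0..} (\<lambda>t. G (snd (S t y)) + f (fst (S t y)))"
      by (intro continuous_on_add continuous_on_compose2[OF G_cont c(2)] continuous_on_compose2[OF f_cont c(1)])
         (use i in auto)
  qed (use c i S_vel[OF y'] S_weak[OF y'] in auto)
qed

lemma sol_in: "sol U \<Longrightarrow> t \<ge> 0 \<Longrightarrow> U t \<in> P"
  unfolding sol_def P_def mem_Times_iff using sol_V[where z = "\<lambda>t. fst (U t)" and w = "\<lambda>t. snd (U t)"] by blast

lemma sol_time_cont:
  assumes "sol U" shows "continuous_on {0..} U"
  using continuous_on_Pair[OF sol_cont(1)[OF assms[unfolded sol_def]] sol_cont(2)[OF assms[unfolded sol_def]]] by simp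

text \<open>Displacements are differentiable in time only after \<open>J\<close>, so the chain rule
  for \<open>Phi\<close> is read off the Taylor bound: the remainder is of order |J u(s) - J
  u(t)|^2, which is o(|s - t|).\<close>

lemma E_deriv:
  assumes U: "sol U" and t: "t > 0"
  shows "((\<lambda>s. E (U s)) has_real_derivative - inner (G (snd (U t))) (snd (U t))) (at t)"
proof -
  note U' = U[unfolded sol_def]
  define u where "u s = fst (U s)" for s
  define v where "v s = snd (U s)" for s
  note U'' = U'[folded u_def v_def]
  have u: "u s \<in> V" if "s \<ge> 0" for s using sol_V[OF U'' that] by simp
  have du: "((\<lambda>s. J (u s)) has_vector_derivative v t) (at t)" using sol_vel_at[OF U'' t] .
  obtain C where C: "\<And>u' w. u' \<in> V \<Longrightarrow> w \<in> V \<Longrightarrow> norm u' \<le> norm (u t) + 1 \<Longrightarrow> norm w \<le> norm (u t) + 1 \<Longrightarrow>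
      \<bar>Phi u' - Phi w - inner (f w) (J u' - J w)\<bar> \<le> C * (norm (J u' - J w))\<^sup>2"
    using Phi_taylor[of "norm (u t) + 1"] by blast
  have "((\<lambda>s. J (u s)) \<longlongrightarrow> J (u t)) (at t)"
    using has_vector_derivative_continuous[OF du] by (simp add: continuous_within)
  from tendsto_diff[OF this tendsto_const[of "J (u t)"]]
  have tJ: "((\<lambda>s. J (u s) - J (u t)) \<longlongrightarrow> J (u t) - J (u t)) (at t)" .
  have "((\<lambda>s. J (u s) - J (u t)) has_vector_derivative v t) (at t)"
    using has_vector_derivative_diff[OF du has_vector_derivative_const[of "J (u t)"]] by simp
  from has_vector_derivative_bilinear_vanishing[OF bounded_bilinear_inner tJ this]
  have "((\<lambda>s. inner (J (u s) - J (u t)) (J (u s) - J (u t))) has_vector_derivative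
      inner (J (u t) - J (u t)) (v t)) (at t)" by simp
  then have "((\<lambda>s. inner (J (u s) - J (u t)) (J (u s) - J (u t)) /\<^sub>R (s - t)) \<longlongrightarrow> 0) (at t)"
    unfolding has_vector_derivative_iff_quotient by simp
  from tendsto_mult_right_zero[OF tendsto_rabs_zero[OF this], of C]
  have lim: "((\<lambda>s. C * ((norm (J (u s) - J (u t)))\<^sup>2 / \<bar>s - t\<bar>)) \<longlongrightarrow> 0) (at t)"
    by (simp add: power2_norm_eq_inner abs_mult divide_inverse mult.commute)
  have "isCont u t" using sol_isCont(1)[OF U'' t] .
  then have "\<forall>\<^sub>F s in at t. dist (u s) (u t) < 1" unfolding isCont_def by (rule tendstoD) simp
  moreover have "\<forall>\<^sub>F s in at t. s > 0" using order_tendstoD(1)[OF tendsto_ident_at t] .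
  ultimately have "\<forall>\<^sub>F s in at t. norm ((Phi (u s) - Phi (u t) - inner (f (u t)) (J (u s) - J (u t))) / (s - t)) \<le>
      C * ((norm (J (u s) - J (u t)))\<^sup>2 / \<bar>s - t\<bar>)"
  proof eventually_elim
    case (elim s)
    have "norm (u s) \<le> norm (u t) + 1" using elim(1) norm_triangle_ineq2[of "u s" "u t"] by (simp add: dist_norm)
    then have "\<bar>Phi (u s) - Phi (u t) - inner (f (u t)) (J (u s) - J (u t))\<bar> \<le> C * (norm (J (u s) - J (u t)))\<^sup>2"
      using C[of "u s" "u t"] u elim t by simp
    then show ?case by (simp add: divide_right_mono)
  qed
  from Lim_null_comparison[OF this lim]
  have "((\<lambda>s. Phi (u s) - inner (f (u t)) (J (u s))) has_real_derivative 0) (at t)"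
    unfolding has_field_derivative_iff by (simp add: inner_diff_right algebra_simps)
  moreover have "((\<lambda>s. inner (f (u t)) (J (u s))) has_real_derivative inner (f (u t)) (v t)) (at t)"
    unfolding has_real_derivative_iff_has_vector_derivative
    by (intro bounded_linear.has_vector_derivative[OF bounded_linear_inner_right] du)
  ultimately have "((\<lambda>s. (Phi (u s) - inner (f (u t)) (J (u s))) + inner (f (u t)) (J (u s))) has_real_derivative 0 + inner (f (u t)) (v t)) (at t)"
    by (rule DERIV_add)
  then have "((\<lambda>s. Phi (u s)) has_real_derivative inner (f (u t)) (v t)) (at t)" by simp
  from DERIV_add[OF energy_deriv[OF U'' t] this] show ?thesis
    by (simp add: E_def u_def v_def inner_add_left)
qed

lemma E_sol_cont: "sol U \<Longrightarrow> continuous_on {0..} (\<lambda>s. E (U s))"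
  by (rule continuous_on_compose2[OF E_cont sol_time_cont]) (auto intro: sol_in)

lemma E_decreasing:
  assumes U: "sol U" and t: "t \<ge> 0"
  shows "E (U t) \<le> E (U 0)"
proof (rule DERIV_nonpos_imp_decreasing_open[OF t])
  fix x assume "0 < x" "x < t"
  then show "\<exists>y. ((\<lambda>s. E (U s)) has_real_derivative y) (at x) \<and> y \<le> 0"
    using E_deriv[OF U] sol_in[OF U, of x] by (intro exI conjI) (auto simp: P_def mem_Times_iff intro!: G_nonneg)
qed (intro continuous_on_subset[OF E_sol_cont[OF U]], auto)

text \<open>As the energy decreases, all trajectories from a sublevel stay in one ball, on which the
  local constants of \<open>f\<close>, \<open>G\<close> and \<open>Phi\<close> can be fixed
  once.\<close>

lemma E_sublevel_bounded:
  "\<exists>\<rho>>0. \<forall>y\<in>P. E y \<le> R \<longrightarrow> norm (fst y) \<le> \<rho> \<and> norm (snd y) \<le> \<rho>"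
proof (intro exI conjI ballI impI)
  show "0 < 1 + \<bar>(R + C0) / \<kappa>\<bar> + \<bar>(R + C0) / (\<mu> / 2)\<bar>" by (simp add: add_pos_nonneg)
  fix y assume y: "y \<in> P" "E y \<le> R"
  have "\<kappa> * (norm (fst y))\<^sup>2 + \<mu> / 2 * (norm (snd y))\<^sup>2 \<le> R + C0"
    using Phi_lower[of "fst y"] M(4)[of "snd y"] y unfolding E_def P_def by (auto simp: mem_Times_iff field_simps)
  moreover have "0 \<le> \<kappa> * (norm (fst y))\<^sup>2" "0 \<le> \<mu> / 2 * (norm (snd y))\<^sup>2" using \<kappa> M(3) by auto
  ultimately have "\<kappa> * (norm (fst y))\<^sup>2 \<le> R + C0" "\<mu> / 2 * (norm (snd y))\<^sup>2 \<le> R + C0" by linarith+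
  then have "norm (fst y) \<le> 1 + \<bar>(R + C0) / \<kappa>\<bar>" "norm (snd y) \<le> 1 + \<bar>(R + C0) / (\<mu> / 2)\<bar>"
    using le_of_square_le \<kappa> M(3) by (auto simp del: abs_divide)
  then show "norm (fst y) \<le> 1 + \<bar>(R + C0) / \<kappa>\<bar> + \<bar>(R + C0) / (\<mu> / 2)\<bar>"
    "norm (snd y) \<le> 1 + \<bar>(R + C0) / \<kappa>\<bar> + \<bar>(R + C0) / (\<mu> / 2)\<bar>" by linarith+
qed

lemma E_lower:
  assumes "y \<in> P" shows "- C0 \<le> E y"
proof -
  have "0 \<le> \<mu> * (norm (snd y))\<^sup>2" "0 \<le> \<kappa> * (norm (fst y))\<^sup>2" using M(3) \<kappa> by auto
  moreover have "fst y \<in> V" using assms by (auto simp: P_def)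
  ultimately show ?thesis using Phi_lower[of "fst y"] M(4)[of "snd y"] unfolding E_def by (simp add: field_simps)
qed

lemma E_bounded:
  assumes B: "B \<subseteq> P" "bounded B" shows "\<exists>R. \<forall>y\<in>B. E y \<le> R"
proof -
  obtain r where r: "\<And>y. y \<in> B \<Longrightarrow> norm y \<le> r" using B(2) unfolding bounded_iff by blast
  obtain KM where KM: "KM \<ge> 0" "\<And>x y. norm (M x y) \<le> norm x * norm y * KM"
    using bounded_bilinear.nonneg_bounded[OF M(1)] by blast
  obtain KA where KA: "KA \<ge> 0" "\<And>x y. norm (A x y) \<le> norm x * norm y * KA"
    using bounded_bilinear.nonneg_bounded[OF A(1)] by blast
  obtain KJ where KJ: "KJ \<ge> 0" "\<And>x. norm (J x) \<le> norm x * KJ"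
    using bounded_linear.nonneg_bounded[OF J] by blast
  obtain C where C: "\<And>u' w. u' \<in> V \<Longrightarrow> w \<in> V \<Longrightarrow> norm u' \<le> \<bar>r\<bar> \<Longrightarrow> norm w \<le> \<bar>r\<bar> \<Longrightarrow>
      \<bar>Phi u' - Phi w - inner (f w) (J u' - J w)\<bar> \<le> C * (norm (J u' - J w))\<^sup>2" using Phi_taylor[of "\<bar>r\<bar>"] by blast
  show ?thesis
  proof (intro exI ballI)
    fix y assume y: "y \<in> B"
    have r0: "r \<ge> 0" using r[OF y] norm_ge_zero[of y] by linarith
    have n: "norm (fst y) \<le> r" "norm (snd y) \<le> r"
      using r[OF y] norm_fst_le[of "fst y" "snd y"] norm_snd_le[of "snd y" "fst y"] by auto
    have V': "fst y \<in> V" "0 \<in> V" using y B(1) subspace_0[OF V(1)] by (auto simp: P_def)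
    have nJ: "norm (J (fst y)) \<le> r * KJ" using KJ(2)[of "fst y"] n(1) KJ(1) by (meson mult_right_mono order_trans)
    have "M (snd y) (snd y) \<le> r * r * KM"
      using KM(2)[of "snd y" "snd y"] mult_right_mono[OF mult_mono[OF n(2) n(2) r0] KM(1)] by auto
    moreover have "A (fst y) (fst y) \<le> r * r * KA"
      using KA(2)[of "fst y" "fst y"] mult_right_mono[OF mult_mono[OF n(1) n(1) r0] KA(1)] by auto
    moreover have "Phi (fst y) \<le> Phi 0 + norm (f 0) * (r * KJ) + \<bar>C\<bar> * (r * KJ)\<^sup>2"
    proof -
      have "J 0 = 0" using linear_0[OF bounded_linear.linear[OF J]] .
      then have "\<bar>Phi (fst y) - Phi 0 - inner (f 0) (J (fst y))\<bar> \<le> C * (norm (J (fst y)))\<^sup>2"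
        using C[OF V'] n(1) r0 by simp
      moreover have "C * (norm (J (fst y)))\<^sup>2 \<le> \<bar>C\<bar> * (r * KJ)\<^sup>2" using nJ by (intro mult_mono power_mono) auto
      moreover have "inner (f 0) (J (fst y)) \<le> norm (f 0) * (r * KJ)"
        using norm_cauchy_schwarz[of "f 0" "J (fst y)"] nJ by (meson mult_left_mono norm_ge_zero order_trans)
      ultimately show ?thesis by linarith
    qed
    ultimately show "E y \<le> (r * r * KM + r * r * KA) / 2 + (Phi 0 + norm (f 0) * (r * KJ) + \<bar>C\<bar> * (r * KJ)\<^sup>2)"
      unfolding E_def by (intro add_mono divide_right_mono) auto
  qed
qed

lemma dist_sq:
  fixes y y' :: "'v \<times> 'h"
  shows "(dist y y')\<^sup>2 = (norm (fst y - fst y'))\<^sup>2 + (norm (snd y - snd y'))\<^sup>2"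
  by (simp add: dist_prod_def dist_norm)

lemma D_lower:
  assumes "y \<in> P" "y' \<in> P"
  shows "min \<mu> \<alpha> / 2 * (dist y y')\<^sup>2 \<le> D y y'"
proof -
  have "fst y - fst y' \<in> V" using assms by (auto simp: P_def intro!: subspace_diff V)
  then have "\<alpha> * (norm (fst y - fst y'))\<^sup>2 \<le> A (fst y - fst y') (fst y - fst y')" by (rule A(4))
  moreover have "min \<mu> \<alpha> * (norm (fst y - fst y'))\<^sup>2 \<le> \<alpha> * (norm (fst y - fst y'))\<^sup>2"
    "min \<mu> \<alpha> * (norm (snd y - snd y'))\<^sup>2 \<le> \<mu> * (norm (snd y - snd y'))\<^sup>2" by (intro mult_right_mono; simp)+
  ultimately have "min \<mu> \<alpha> * (dist y y')\<^sup>2 \<le> M (snd y - snd y') (snd y - snd y') + A (fst y - fst y') (fst y - fst y')"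
    using M(4)[of "snd y - snd y'"] unfolding dist_sq distrib_left by linarith
  then show ?thesis unfolding D_def by simp
qed

lemma D_upper: "\<exists>K>0. \<forall>y y'. D y y' \<le> K * (dist y y')\<^sup>2"
proof -
  obtain KM where KM: "KM > 0" "\<And>x y. norm (M x y) \<le> norm x * norm y * KM"
    using bounded_bilinear.pos_bounded[OF M(1)] by blast
  obtain KA where KA: "KA > 0" "\<And>x y. norm (A x y) \<le> norm x * norm y * KA"
    using bounded_bilinear.pos_bounded[OF A(1)] by blast
  show ?thesis
  proof (intro exI[of _ "KM + KA"] conjI allI)
    fix y y' :: "'v \<times> 'h"
    have "M (snd y - snd y') (snd y - snd y') \<le> KM * (norm (snd y - snd y'))\<^sup>2"
      using KM(2)[of "snd y - snd y'" "snd y - snd y'"] by (simp add: power2_eq_square mult_ac)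
    moreover have "A (fst y - fst y') (fst y - fst y') \<le> KA * (norm (fst y - fst y'))\<^sup>2"
      using KA(2)[of "fst y - fst y'" "fst y - fst y'"] by (simp add: power2_eq_square mult_ac)
    moreover have "0 \<le> KM * (norm (fst y - fst y'))\<^sup>2" "0 \<le> KA * (norm (snd y - snd y'))\<^sup>2" using KM KA by auto
    moreover have "0 \<le> KM * (norm (snd y - snd y'))\<^sup>2" "0 \<le> KA * (norm (fst y - fst y'))\<^sup>2" using KM KA by auto
    ultimately show "D y y' \<le> (KM + KA) * (dist y y')\<^sup>2"
      unfolding D_def dist_sq by (simp add: algebra_simps)
  qed (use KM KA in simp)
qed

lemma D_zero:
  assumes "y \<in> P" "y' \<in> P" "D y y' \<le> 0" shows "y = y'"
proof -
  have "min \<mu> \<alpha> / 2 * (dist y y')\<^sup>2 \<le> 0" using D_lower[OF assms(1,2)] assms(3) by linarith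
  moreover have "min \<mu> \<alpha> / 2 > 0" using M(3) A(3) by simp
  ultimately have "(dist y y')\<^sup>2 \<le> 0" by (metis mult_pos_pos not_le)
  then show ?thesis by simp
qed

lemma sol_diff:
  assumes "sol U1" "sol U2"
  shows "lin_sol (\<lambda>t. fst (U1 t) - fst (U2 t)) (\<lambda>t. snd (U1 t) - snd (U2 t))
    (\<lambda>t. (G (snd (U1 t)) + f (fst (U1 t))) - (G (snd (U2 t)) + f (fst (U2 t))))"
  using lin_sol_diff assms unfolding sol_def by blast

lemma D_deriv:
  assumes "sol U1" "sol U2" "t > 0"
  shows "((\<lambda>s. D (U1 s) (U2 s)) has_real_derivative
    - inner (G (snd (U1 t)) - G (snd (U2 t))) (snd (U1 t) - snd (U2 t))
    - inner (f (fst (U1 t)) - f (fst (U2 t))) (snd (U1 t) - snd (U2 t))) (at t)"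
proof -
  have "- inner (G (snd (U1 t)) + f (fst (U1 t)) - (G (snd (U2 t)) + f (fst (U2 t)))) (snd (U1 t) - snd (U2 t)) =
      - inner (G (snd (U1 t)) - G (snd (U2 t))) (snd (U1 t) - snd (U2 t))
    - inner (f (fst (U1 t)) - f (fst (U2 t))) (snd (U1 t) - snd (U2 t))"
    by (simp add: inner_diff_left inner_add_left)
  then show ?thesis using energy_deriv[OF sol_diff[OF assms(1,2)] assms(3)] by (simp add: D_def)
qed

lemma D_cont:
  assumes "sol U1" "sol U2"
  shows "continuous_on {0..} (\<lambda>s. D (U1 s) (U2 s))"
  using energy_cont[OF sol_diff[OF assms]] by (simp add: D_def)

text \<open>Gronwall for \<open>D\<close>: the monotone damping contributes with the favourable
  sign, and on the ball containing both trajectories the force term is at most a multiple of the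
  squared distance, hence of \<open>D\<close>.\<close>

lemma continuous_dependence:
  "\<exists>K. \<forall>U1 U2 t. sol U1 \<longrightarrow> sol U2 \<longrightarrow> E (U1 0) \<le> R \<longrightarrow> E (U2 0) \<le> R \<longrightarrow> t \<ge> 0 \<longrightarrow>
     D (U1 t) (U2 t) \<le> D (U1 0) (U2 0) * exp (K * t)"
proof -
  obtain \<rho> where \<rho>: "\<rho> > 0" "\<And>y. y \<in> P \<Longrightarrow> E y \<le> R \<Longrightarrow> norm (fst y) \<le> \<rho> \<and> norm (snd y) \<le> \<rho>"
    using E_sublevel_bounded[of R] by blast
  obtain C where C: "\<And>u w. u \<in> V \<Longrightarrow> w \<in> V \<Longrightarrow> norm u \<le> \<rho> \<Longrightarrow> norm w \<le> \<rho> \<Longrightarrow>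
      norm (f u - f w) \<le> C * norm (J u - J w)" using f_lip[of \<rho>] by blast
  obtain KJ where KJ: "KJ > 0" "\<And>x. norm (J x) \<le> norm x * KJ"
    using bounded_linear.pos_bounded[OF J] by blast
  define m where "m = min \<mu> \<alpha> / 2"
  have m: "m > 0" using M(3) A(3) by (simp add: m_def)
  define K where "K = \<bar>C\<bar> * KJ / m"
  show ?thesis
  proof (intro exI[of _ K] allI impI)
    fix U1 U2 t assume U: "sol U1" "sol U2" "E (U1 0) \<le> R" "E (U2 0) \<le> R" and t: "(t::real) \<ge> 0"
    show "D (U1 t) (U2 t) \<le> D (U1 0) (U2 0) * exp (K * t)"
    proof (rule gronwall_deriv[OF D_cont[OF U(1,2)] D_deriv[OF U(1,2)] _ t])
      fix s :: real assume s: "s > 0"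
      have P: "U1 s \<in> P" "U2 s \<in> P" using sol_in U s by auto
      then have V': "fst (U1 s) \<in> V" "fst (U2 s) \<in> V" "snd (U1 s) \<in> H" "snd (U2 s) \<in> H" by (auto simp: P_def)
      have b: "norm (fst (U1 s)) \<le> \<rho>" "norm (fst (U2 s)) \<le> \<rho>"
        using \<rho>(2)[OF P(1)] \<rho>(2)[OF P(2)] E_decreasing[OF U(1), of s] E_decreasing[OF U(2), of s] U s by auto
      let ?z = "fst (U1 s) - fst (U2 s)" and ?w = "snd (U1 s) - snd (U2 s)"
      have "norm (f (fst (U1 s)) - f (fst (U2 s))) \<le> \<bar>C\<bar> * norm (J ?z)"
        unfolding J_lin by (rule order_trans[OF C[OF V'(1,2) b]]) (intro mult_right_mono; simp)
      also have "\<dots> \<le> \<bar>C\<bar> * (norm ?z * KJ)" by (intro mult_left_mono KJ) auto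
      finally have fz: "norm (f (fst (U1 s)) - f (fst (U2 s))) \<le> \<bar>C\<bar> * KJ * norm ?z" by (simp add: mult_ac)
      have "- inner (f (fst (U1 s)) - f (fst (U2 s))) ?w \<le> norm (f (fst (U1 s)) - f (fst (U2 s))) * norm ?w"
        using Cauchy_Schwarz_ineq2[of "f (fst (U1 s)) - f (fst (U2 s))" ?w] by linarith
      also have "\<dots> \<le> \<bar>C\<bar> * KJ * norm ?z * norm ?w" by (intro mult_right_mono fz) auto
      also have "\<dots> = \<bar>C\<bar> * KJ * (norm ?z * norm ?w)" by simp
      also have "\<dots> \<le> \<bar>C\<bar> * KJ * (dist (U1 s) (U2 s))\<^sup>2"
      proof (intro mult_left_mono)
        have "2 * (norm ?z * norm ?w) \<le> (norm ?z)\<^sup>2 + (norm ?w)\<^sup>2"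
          using sum_squares_bound[of "norm ?z" "norm ?w"] by simp
        moreover have "0 \<le> norm ?z * norm ?w" by simp
        ultimately show "norm ?z * norm ?w \<le> (dist (U1 s) (U2 s))\<^sup>2" unfolding dist_sq by linarith
      qed (use KJ in auto)
      also have "\<dots> \<le> \<bar>C\<bar> * KJ * (D (U1 s) (U2 s) / m)"
      proof (intro mult_left_mono)
        show "(dist (U1 s) (U2 s))\<^sup>2 \<le> D (U1 s) (U2 s) / m"
          using D_lower[OF P] m unfolding m_def[symmetric] by (simp add: pos_le_divide_eq mult.commute)
      qed (use KJ in auto)
      finally show "- inner (G (snd (U1 s)) - G (snd (U2 s))) ?w - inner (f (fst (U1 s)) - f (fst (U2 s))) ?w \<le> K * D (U1 s) (U2 s)"
        using G_mono[OF V'(3,4)] by (simp add: K_def)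
    qed
  qed
qed

lemma sol_unique:
  assumes "sol U1" "sol U2" "U1 0 = U2 0" "t \<ge> 0" shows "U1 t = U2 t"
proof -
  obtain K where K: "\<And>V1 V2 t. sol V1 \<Longrightarrow> sol V2 \<Longrightarrow> E (V1 0) \<le> E (U1 0) \<Longrightarrow> E (V2 0) \<le> E (U1 0) \<Longrightarrow> t \<ge> 0 \<Longrightarrow>
     D (V1 t) (V2 t) \<le> D (V1 0) (V2 0) * exp (K * t)" using continuous_dependence by blast
  have "D (U1 t) (U2 t) \<le> D (U1 0) (U2 0) * exp (K * t)" by (rule K) (use assms in auto)
  moreover have "D (U1 0) (U2 0) = 0"
    using assms(3) by (simp add: D_def bounded_bilinear.zero_left[OF M(1)] bounded_bilinear.zero_left[OF A(1)])
  ultimately show ?thesis using D_zero sol_in assms by simp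
qed

text \<open>The shifted orbit and the orbit issued from \<open>S t y\<close> are solutions with the
  same initial state.\<close>

lemma S_add:
  assumes "s \<ge> 0" "t \<ge> 0" "y \<in> P" shows "S (s + t) y = S s (S t y)"
proof -
  have "sol (\<lambda>r. S (r + t) y)" using lin_sol_shift[of _ _ _ t] S_sol[OF assms(3)] assms(2) unfolding sol_def by blast
  moreover have St: "S t y \<in> P" using S_in assms by (simp add: P_def)
  moreover have "S (0 + t) y = S 0 (S t y)" using S_0[of "S t y"] St by (simp add: P_def)
  ultimately show ?thesis using sol_unique[of "\<lambda>r. S (r + t) y" "\<lambda>r. S r (S t y)" s] S_sol assms(1) by simp
qed

lemma S_cont:
  assumes t: "t \<ge> 0" shows "continuous_on P (S t)"
  unfolding continuous_on_def
proof
  fix y assume y: "y \<in> P"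
  \<comment> \<open>The constant of the stability estimate depends on the energy level; the unit
    ball around y lies below a single level, which makes it uniform for nearby states.\<close>
  obtain R where R: "\<And>x. x \<in> cball y 1 \<inter> P \<Longrightarrow> E x \<le> R" using E_bounded[of "cball y 1 \<inter> P"] bounded_subset[OF bounded_cball[of y 1]] by blast
  obtain K where K: "\<And>U1 U2 t. sol U1 \<Longrightarrow> sol U2 \<Longrightarrow> E (U1 0) \<le> R \<Longrightarrow> E (U2 0) \<le> R \<Longrightarrow> t \<ge> 0 \<Longrightarrow>
     D (U1 t) (U2 t) \<le> D (U1 0) (U2 0) * exp (K * t)" using continuous_dependence by blast
  obtain KD where KD: "KD > 0" "\<And>y y'. D y y' \<le> KD * (dist y y')\<^sup>2" using D_upper by blast
  define m where "m = min \<mu> \<alpha> / 2"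
  have m: "m > 0" using M(3) A(3) by (simp add: m_def)
  have "((\<lambda>x. (dist (S t x) (S t y))\<^sup>2) \<longlongrightarrow> 0) (at y within P)"
  proof (rule Lim_null_comparison)
    show "\<forall>\<^sub>F x in at y within P. norm ((dist (S t x) (S t y))\<^sup>2) \<le> KD * (dist x y)\<^sup>2 * exp (K * t) / m"
      unfolding eventually_at
    proof (intro exI[of _ 1] conjI ballI impI)
      fix x assume x: "x \<in> P" "x \<noteq> y \<and> dist x y < 1"
      have xy: "S 0 x = x" "S 0 y = y" using S_0 x y by (auto simp: P_def)
      have "D (S t x) (S t y) \<le> D x y * exp (K * t)"
        using K[OF S_sol[OF x(1)] S_sol[OF y], of t] R[of x] R[of y] x y t xy by (auto simp: dist_commute)
      also have "\<dots> \<le> KD * (dist x y)\<^sup>2 * exp (K * t)" by (intro mult_right_mono KD) auto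
      finally have "m * (dist (S t x) (S t y))\<^sup>2 \<le> KD * (dist x y)\<^sup>2 * exp (K * t)"
        using D_lower[of "S t x" "S t y"] S_in[of x t] S_in[of y t] x y t by (simp add: P_def m_def)
      then show "norm ((dist (S t x) (S t y))\<^sup>2) \<le> KD * (dist x y)\<^sup>2 * exp (K * t) / m"
        using m by (simp add: field_simps)
    qed simp
    have "((\<lambda>x. KD * (dist x y)\<^sup>2 * exp (K * t) / m) \<longlongrightarrow> KD * (dist y y)\<^sup>2 * exp (K * t) / m) (at y within P)"
      using m by (intro tendsto_intros) auto
    then show "((\<lambda>x. KD * (dist x y)\<^sup>2 * exp (K * t) / m) \<longlongrightarrow> 0) (at y within P)" by simp
  qed
  from tendsto_real_sqrt[OF this] show "(S t \<longlongrightarrow> S t y) (at y within P)"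
    by (simp add: tendsto_dist_iff[symmetric])
qed

text \<open>Constant energy annihilates the dissipation, hence the velocity, at positive times, and
  by continuity at time 0. Then \<open>J\<close> of the displacement is constant, and injectivity of
  \<open>J\<close> on \<open>V\<close> fixes the displacement itself.\<close>

lemma E_strict:
  assumes y: "y \<in> P" and e: "\<And>t. t \<ge> 0 \<Longrightarrow> E (S t y) = E y" and t: "t \<ge> 0"
  shows "S t y = y"
proof -
  note s = S_sol[OF y]
  have v0: "snd (S t y) = 0" if "t > 0" for t
  proof -
    have "((\<lambda>s. E (S s y)) has_real_derivative - inner (G (snd (S t y))) (snd (S t y))) (at t)"
      using E_deriv[OF s that] .
    moreover have "((\<lambda>s. E (S s y)) has_real_derivative 0) (at t)"
      by (rule has_field_derivative_transform_within_open[OF DERIV_const[of "E y"], where S = "{0<..}"]) (use that e in auto)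
    ultimately have "inner (G (snd (S t y))) (snd (S t y)) = 0" using DERIV_unique by force
    then show ?thesis using G_pos[of "snd (S t y)"] sol_in[OF s, of t] that by (auto simp: P_def mem_Times_iff)
  qed
  have "continuous_on (closure {0<..}) (\<lambda>t. snd (S t y))"
    using S_time_cont[of y] y by (auto simp: P_def intro!: continuous_intros)
  then have v: "snd (S t y) = 0" if "t \<ge> 0" for t
    using continuous_constant_on_closure[of "{0<..}" "\<lambda>t. snd (S t y)" 0 t] v0 that by simp
  have dv: "((\<lambda>s. J (fst (S s y))) has_vector_derivative 0) (at r within {0..})" if "r \<in> {0..}" for r
    using S_vel[of y r] v[of r] y that by (simp add: P_def)
  obtain c where "\<And>r. r \<in> {0..} \<Longrightarrow> J (fst (S r y)) = c"
    using has_vector_derivative_zero_constant[OF convex_real_interval(1) dv] by blast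
  then have "J (fst (S t y)) = J (fst (S 0 y))" using t by auto
  moreover have S0: "S 0 y = y" using S_0 y by (simp add: P_def)
  ultimately have "J (fst (S t y) - fst y) = 0" by (simp add: J_lin)
  moreover have "fst (S t y) - fst y \<in> V" using sol_in[OF s t] y by (auto simp: P_def mem_Times_iff intro!: subspace_diff V)
  ultimately have "fst (S t y) = fst y" using J_inj by fastforce
  moreover have "snd (S t y) = snd y" using v[OF t] v[of 0] S0 by simp
  ultimately show ?thesis by (simp add: prod_eq_iff)
qed

text \<open>A stationary state has zero velocity, so the weak equation tested with its own
  displacement u leaves \<open>A u u + inner (f u) (J u) = 0\<close>, and \<open>f_lower\<close>
  bounds u.\<close>

lemma stationary_bounded: "bounded {y\<in>P. \<forall>t\<ge>0. S t y = y}"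
  unfolding bounded_iff
proof (intro exI ballI)
  fix y assume "y \<in> {y\<in>P. \<forall>t\<ge>0. S t y = y}"
  then have y: "y \<in> P" and st: "\<And>t. t \<ge> 0 \<Longrightarrow> S t y = y" by auto
  have yV: "y \<in> V \<times> H" "fst y \<in> V" using y by (auto simp: P_def)
  have "((\<lambda>s. J (fst (S s y))) has_vector_derivative snd y) (at 1)"
    using sol_vel_at[OF S_sol[OF y, unfolded sol_def], of 1] st by simp
  moreover have "((\<lambda>s. J (fst (S s y))) has_vector_derivative 0) (at 1)"
    by (rule has_vector_derivative_transform_within_open[OF has_vector_derivative_const[of "J (fst y)"], where S = "{0<..}"]) (use st in auto)
  ultimately have v: "snd y = 0" using vector_derivative_unique_at by blast
  have "((\<lambda>s. A (fst y) (fst y) + inner (f (fst y)) (J (fst y))) has_integral 0) {0..1::real}"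
  proof (rule has_integral_eq)
    show "((\<lambda>s. A (fst (S s y)) (fst y) + inner (G (snd (S s y)) + f (fst (S s y))) (J (fst y))) has_integral 0) {0..1}"
      using S_weak[OF yV, of 1] st by simp
  qed (use st v in \<open>auto simp: G_0\<close>)
  then have "A (fst y) (fst y) + inner (f (fst y)) (J (fst y)) = 0"
    using has_integral_const_real[of "A (fst y) (fst y) + inner (f (fst y)) (J (fst y))" 0 1]
    by (simp add: has_integral_unique)
  then have "\<kappa> * (norm (fst y))\<^sup>2 \<le> C0" using f_lower[OF yV(2)] by simp
  from le_of_square_le[OF \<kappa> this] show "norm y \<le> 1 + \<bar>C0 / \<kappa>\<bar>"
    using v by (simp add: norm_prod_def)
qed

end

section \<open>Stabilizability estimate and asymptotic smoothness\<close>

context damped_wave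
begin

text \<open>For z = u1 - u2 the function t D + M(z', Jz)/2 + c D + c (E1 + E2), with a large constant c, is almost
  nonincreasing: the damping controls the kinetic part of D up to a small error, the time derivative of the
  middle term converts kinetic into potential energy, and the remaining terms are of lower order. Since all
  summands but the first are bounded uniformly in time, D(T) is small for large T.\<close>
lemma quasi_stability:
  assumes \<epsilon>: "\<epsilon> > 0"
  shows "\<exists>T>0. \<exists>\<eta>>0. \<forall>U1 U2. sol U1 \<longrightarrow> sol U2 \<longrightarrow> E (U1 0) \<le> R \<longrightarrow> E (U2 0) \<le> R \<longrightarrow>
    (\<forall>t\<in>{0..T}. norm (J (fst (U1 t)) - J (fst (U2 t))) \<le> \<eta>) \<longrightarrow> D (U1 T) (U2 T) \<le> \<epsilon>"
proof -
  obtain \<rho> where \<rho>: "\<rho> > 0" "\<And>y. y \<in> P \<Longrightarrow> E y \<le> R \<Longrightarrow> norm (fst y) \<le> \<rho> \<and> norm (snd y) \<le> \<rho>"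
    using E_sublevel_bounded[of R] by blast
  obtain C' where C': "\<And>u w. u \<in> V \<Longrightarrow> w \<in> V \<Longrightarrow> norm u \<le> \<rho> \<Longrightarrow> norm w \<le> \<rho> \<Longrightarrow>
      norm (f u - f w) \<le> C' * norm (J u - J w)" using f_lip[of \<rho>] by blast
  define C where "C = \<bar>C'\<bar>"
  have C0: "C \<ge> 0" by (simp add: C_def)
  have C: "norm (f u - f w) \<le> C * norm (J u - J w)" if "u \<in> V" "w \<in> V" "norm u \<le> \<rho>" "norm w \<le> \<rho>" for u w
    by (rule order_trans[OF C'[OF that]]) (auto intro!: mult_right_mono simp: C_def)
  obtain Cg' where Cg': "\<And>v. v \<in> H \<Longrightarrow> norm v \<le> \<rho> \<Longrightarrow> norm (G v) \<le> Cg'" using G_bdd[of \<rho>] by blast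
  define Cg where "Cg = \<bar>Cg'\<bar>"
  have Cg0: "Cg \<ge> 0" by (simp add: Cg_def)
  have Cg: "norm (G v) \<le> Cg" if "v \<in> H" "norm v \<le> \<rho>" for v
    using Cg'[OF that] by (simp add: Cg_def)
  obtain KJ where KJ: "KJ > 0" "\<And>x. norm (J x) \<le> norm x * KJ"
    using bounded_linear.pos_bounded[OF J] by blast
  obtain KM where KM: "KM > 0" "\<And>x y. norm (M x y) \<le> norm x * norm y * KM"
    using bounded_bilinear.pos_bounded[OF M(1)] by blast
  obtain KD where KD: "KD > 0" "\<And>y y'. D y y' \<le> KD * (dist y y')\<^sup>2" using D_upper by blast
  \<comment> \<open>The budget consists of three parts \<epsilon>/3: the \<delta> of the damping
    estimate, entering as KM \<delta>; the terms small with the displacement difference, entering as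
    L \<eta>; and the bounded terms, entering as B/T.\<close>
  define \<delta> where "\<delta> = \<epsilon> / (3 * KM)"
  have \<delta>: "\<delta> > 0" using \<epsilon> KM by (simp add: \<delta>_def)
  obtain c0 where c0: "c0 \<ge> 0" "\<And>v w. v \<in> H \<Longrightarrow> w \<in> H \<Longrightarrow> (norm (v - w))\<^sup>2 \<le>
      \<delta> + c0 * (inner (G v - G w) (v - w) + inner (G v) v + inner (G w) w)" using G_damp[OF \<delta>] by blast
  \<comment> \<open>With this c the damping estimate bounds \<open>M (w t) (w t)\<close> by c times
    dissipation up to \<epsilon>/3, and this is exactly what the summands c D and c (E1 + E2)
    dissipate.\<close>
  define c where "c = KM * c0"
  have c: "c \<ge> 0" using KM c0 by (simp add: c_def)
  define m where "m = KM * (2 * \<rho>) * (2 * \<rho> * KJ)"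
  \<comment> \<open>B exceeds the sum of the upper bound for Q(0) and the amount by which Q(T) can
    fall short of T D(T).\<close>
  define B where "B = m + c * (KD * (8 * \<rho>\<^sup>2)) + 2 * c * (R + C0) + 1"
  define T where "T = max 1 (3 * B / \<epsilon>)"
  have T: "T > 0" "B \<le> T * (\<epsilon> / 3)" using \<epsilon> by (auto simp: T_def max_def field_simps)
  define Ch where "Ch = 2 * Cg + C * (2 * \<rho> * KJ)"
  have Ch: "Ch \<ge> 0" using Cg0 C0 \<rho>(1) KJ(1) by (simp add: Ch_def)
  define L where "L = Ch / 2 + (T + c) * C * (2 * \<rho>) + 1"
  have L: "L > 0" using Ch T c C0 \<rho>(1) by (simp add: L_def add_nonneg_pos)
  define \<eta> where "\<eta> = \<epsilon> / (3 * L)"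
  have \<eta>: "\<eta> > 0" "L * \<eta> = \<epsilon> / 3" using \<epsilon> L by (auto simp: \<eta>_def)
  show ?thesis
  proof (rule exI[of _ T], rule conjI[OF T(1)], rule exI[of _ \<eta>], rule conjI[OF \<eta>(1)], intro allI impI)
    fix U1 U2 assume U: "sol U1" "sol U2" "E (U1 0) \<le> R" "E (U2 0) \<le> R"
      and small: "\<forall>t\<in>{0..T}. norm (J (fst (U1 t)) - J (fst (U2 t))) \<le> \<eta>"
    define z where "z t = fst (U1 t) - fst (U2 t)" for t
    define w where "w t = snd (U1 t) - snd (U2 t)" for t
    define h where "h t = (G (snd (U1 t)) + f (fst (U1 t))) - (G (snd (U2 t)) + f (fst (U2 t)))" for t
    have zwh: "lin_sol z w h" using sol_diff[OF U(1,2)] by (simp add: z_def[abs_def] w_def[abs_def] h_def[abs_def])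
    have UP: "U1 t \<in> P" "U2 t \<in> P" if "t \<ge> 0" for t using sol_in U that by auto
    have VH: "fst (U1 t) \<in> V" "fst (U2 t) \<in> V" "snd (U1 t) \<in> H" "snd (U2 t) \<in> H" if "t \<ge> 0" for t
      using UP[OF that] by (auto simp: P_def)
    have ER: "E (U1 t) \<le> R" "E (U2 t) \<le> R" if "t \<ge> 0" for t
      using E_decreasing[OF U(1) that] E_decreasing[OF U(2) that] U by auto
    have b: "norm (fst (U1 t)) \<le> \<rho>" "norm (fst (U2 t)) \<le> \<rho>" "norm (snd (U1 t)) \<le> \<rho>" "norm (snd (U2 t)) \<le> \<rho>"
      if "t \<ge> 0" for t using \<rho>(2) UP[OF that] ER[OF that] by auto
    have bz: "norm (z t) \<le> 2 * \<rho>" and bw: "norm (w t) \<le> 2 * \<rho>" if "t \<ge> 0" for t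
      using norm_triangle_ineq4[of "fst (U1 t)" "fst (U2 t)"] norm_triangle_ineq4[of "snd (U1 t)" "snd (U2 t)"] b[OF that]
      by (auto simp: z_def w_def)
    have bJ: "norm (J (z t)) \<le> 2 * \<rho> * KJ" if "t \<ge> 0" for t
      by (rule order_trans[OF KJ(2)]) (use bz[OF that] KJ(1) in \<open>auto intro!: mult_right_mono\<close>)
    have sJ: "norm (J (z t)) \<le> \<eta>" if "t \<in> {0..T}" for t using small that by (simp add: z_def J_lin)
    have bf: "norm (f (fst (U1 t)) - f (fst (U2 t))) \<le> C * norm (J (z t))" if "t \<ge> 0" for t
      unfolding z_def J_lin by (rule C) (use VH[OF that] b[OF that] in auto)
    have bm: "\<bar>M (w t) (J (z t))\<bar> \<le> m" if "t \<ge> 0" for t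
    proof -
      have "\<bar>M (w t) (J (z t))\<bar> \<le> norm (w t) * norm (J (z t)) * KM" using KM(2)[of "w t" "J (z t)"] by simp
      also have "\<dots> \<le> (2 * \<rho>) * (2 * \<rho> * KJ) * KM"
        using bw[OF that] bJ[OF that] KM(1) \<rho>(1) by (intro mult_right_mono mult_mono) auto
      finally show ?thesis by (simp add: m_def mult_ac)
    qed
    define Q where "Q t = (t + c) * D (U1 t) (U2 t) + M (w t) (J (z t)) / 2 + c * (E (U1 t) + E (U2 t))" for t
    define g where "g t = inner (G (snd (U1 t)) - G (snd (U2 t))) (w t)" for t
    define k where "k t = inner (f (fst (U1 t)) - f (fst (U2 t))) (w t)" for t
    define d where "d t = inner (G (snd (U1 t))) (snd (U1 t)) + inner (G (snd (U2 t))) (snd (U2 t))" for t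
    define Q' where "Q' t = D (U1 t) (U2 t) + (t + c) * (- g t - k t) +
       (M (w t) (w t) - A (z t) (z t) - inner (h t) (J (z t))) / 2 - c * d t" for t
    have dQ: "(Q has_real_derivative Q' t) (at t)" if t: "t > 0" for t
      unfolding Q_def Q'_def d_def g_def k_def w_def
      by (auto intro!: derivative_eq_intros D_deriv[OF U(1,2) t] E_deriv[OF U(1) t] E_deriv[OF U(2) t]
          equipartition_deriv[OF zwh t, unfolded w_def] simp: field_simps)
    have Q'_le: "Q' t \<le> 2 * \<epsilon> / 3" if t: "t > 0" "t < T" for t
    proof -
      have t0: "t \<ge> 0" using t by simp
      have g0: "g t \<ge> 0" unfolding g_def w_def by (rule G_mono) (use VH[OF t0] in auto)
      have "M (w t) (w t) \<le> KM * (norm (w t))\<^sup>2" using KM(2)[of "w t" "w t"] by (simp add: power2_eq_square mult_ac)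
      also have "\<dots> \<le> KM * (\<delta> + c0 * (g t + d t))"
        using c0(2)[OF VH(3,4)[OF t0]] KM(1) by (intro mult_left_mono) (auto simp: g_def d_def w_def add.assoc)
      also have "\<dots> = \<epsilon> / 3 + c * (g t + d t)" using KM(1) by (simp add: \<delta>_def c_def distrib_left)
      finally have 1: "M (w t) (w t) \<le> \<epsilon> / 3 + c * (g t + d t)" .
      have "norm (h t) \<le> (norm (G (snd (U1 t))) + norm (G (snd (U2 t)))) + norm (f (fst (U1 t)) - f (fst (U2 t)))"
      proof -
        have "h t = (G (snd (U1 t)) - G (snd (U2 t))) + (f (fst (U1 t)) - f (fst (U2 t)))" by (simp add: h_def)
        then show ?thesis
            using norm_triangle_ineq[of "G (snd (U1 t)) - G (snd (U2 t))" "f (fst (U1 t)) - f (fst (U2 t))"]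
              norm_triangle_ineq4[of "G (snd (U1 t))" "G (snd (U2 t))"] by simp
      qed
      also have "\<dots> \<le> (Cg + Cg) + C * (2 * \<rho> * KJ)"
        using Cg VH[OF t0] b[OF t0] order_trans[OF bf[OF t0] mult_left_mono[OF bJ[OF t0] C0]] by (intro add_mono) auto
      finally have nh: "norm (h t) \<le> Ch" by (simp add: Ch_def)
      have "- inner (h t) (J (z t)) \<le> norm (h t) * norm (J (z t))"
        using Cauchy_Schwarz_ineq2[of "h t" "J (z t)"] by linarith
      also have "\<dots> \<le> Ch * \<eta>" using nh sJ[of t] t Ch by (intro mult_mono) auto
      finally have 2: "- inner (h t) (J (z t)) \<le> Ch * \<eta>" .
      have "- k t \<le> norm (f (fst (U1 t)) - f (fst (U2 t))) * norm (w t)"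
        using Cauchy_Schwarz_ineq2[of "f (fst (U1 t)) - f (fst (U2 t))" "w t"] by (simp add: k_def)
      also have "\<dots> \<le> (C * \<eta>) * (2 * \<rho>)"
        using order_trans[OF bf[OF t0] mult_left_mono[OF sJ C0]] t bw[OF t0] C0 \<eta>(1) by (intro mult_mono) auto
      finally have k1: "- k t \<le> C * \<eta> * (2 * \<rho>)" .
      have "(t + c) * (- k t) \<le> (t + c) * (C * \<eta> * (2 * \<rho>))" using k1 t0 c by (intro mult_left_mono) auto
      also have "\<dots> \<le> (T + c) * (C * \<eta> * (2 * \<rho>))" using t c C0 \<eta>(1) \<rho>(1) by (intro mult_right_mono) auto
      finally have 3: "(t + c) * (- k t) \<le> (T + c) * C * (2 * \<rho>) * \<eta>" by (simp add: mult_ac)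
      have 4: "c * g t \<le> (t + c) * g t" using g0 t0 by (intro mult_right_mono) auto
      have 5: "D (U1 t) (U2 t) = (M (w t) (w t) + A (z t) (z t)) / 2" by (simp add: D_def w_def z_def)
      \<comment> \<open>D plus half of the difference of the kinetic and elastic forms is the
        kinetic form alone: the elastic part, which the damping does not control, has
        cancelled.\<close>
      have "Q' t = M (w t) (w t) - (t + c) * g t + (t + c) * (- k t) - inner (h t) (J (z t)) / 2 - c * d t"
        unfolding Q'_def 5 by (simp add: field_simps)
      also have "\<dots> \<le> \<epsilon> / 3 + (T + c) * C * (2 * \<rho>) * \<eta> + Ch * \<eta> / 2"
        using 1 2 3 4 unfolding distrib_left[of c] by linarith
      also have "\<dots> \<le> \<epsilon> / 3 + L * \<eta>" using \<eta>(1) by (simp add: L_def distrib_right)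
      also have "\<dots> = 2 * \<epsilon> / 3" using \<eta> by simp
      finally show ?thesis .
    qed
    have "Q T - 2 * \<epsilon> / 3 * T \<le> Q 0 - 2 * \<epsilon> / 3 * 0"
    proof (rule DERIV_nonpos_imp_decreasing_open[of 0 T "\<lambda>t. Q t - 2 * \<epsilon> / 3 * t"])
      fix x assume x: "0 < x" "x < T"
      have "((\<lambda>t. Q t - 2 * \<epsilon> / 3 * t) has_real_derivative Q' x - 2 * \<epsilon> / 3) (at x)"
        by (auto intro!: derivative_eq_intros dQ x)
      then show "\<exists>y. ((\<lambda>t. Q t - 2 * \<epsilon> / 3 * t) has_real_derivative y) (at x) \<and> y \<le> 0"
        using Q'_le[OF x] by (intro exI[of _ "Q' x - 2 * \<epsilon> / 3"]) simp
    next
      show "continuous_on {0..T} (\<lambda>t. Q t - 2 * \<epsilon> / 3 * t)"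
        unfolding Q_def
        by (intro continuous_intros continuous_on_subset[OF D_cont[OF U(1,2)]] continuous_on_subset[OF E_sol_cont[OF U(1)]]
            continuous_on_subset[OF E_sol_cont[OF U(2)]] bounded_bilinear.continuous_on[OF M(1)]
            sol_cont_subset[OF zwh] bounded_linear.continuous_on[OF J]) auto
    qed (use T in \<open>auto simp: Q_def\<close>)
    then have "Q T \<le> Q 0 + 2 * \<epsilon> / 3 * T" by simp
    moreover have "T * D (U1 T) (U2 T) - m / 2 - 2 * c * C0 \<le> Q T"
    proof -
      have "0 \<le> c * D (U1 T) (U2 T)"
      proof -
        have "0 \<le> min \<mu> \<alpha> / 2 * (dist (U1 T) (U2 T))\<^sup>2" using M(3) A(3) by auto
        then have "0 \<le> D (U1 T) (U2 T)" using D_lower[OF UP[OF less_imp_le[OF T(1)]]] by linarith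
        then show ?thesis using c by simp
      qed
      moreover have "c * (- C0 + - C0) \<le> c * (E (U1 T) + E (U2 T))"
        using E_lower UP T c by (intro mult_left_mono add_mono) auto
      ultimately show ?thesis using bm[of T] T by (simp add: Q_def distrib_right abs_le_iff)
    qed
    moreover have "Q 0 \<le> c * (KD * (8 * \<rho>\<^sup>2)) + m / 2 + 2 * c * R"
    proof -
      have "D (U1 0) (U2 0) \<le> KD * (dist (U1 0) (U2 0))\<^sup>2" by (rule KD(2))
      also have "(dist (U1 0) (U2 0))\<^sup>2 \<le> (2 * \<rho>)\<^sup>2 + (2 * \<rho>)\<^sup>2"
        unfolding dist_sq using bz[of 0] bw[of 0] by (intro add_mono power_mono) (auto simp: z_def w_def)
      finally have "D (U1 0) (U2 0) \<le> KD * (8 * \<rho>\<^sup>2)" using KD(1) by (simp add: power_mult_distrib)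
      then have "c * D (U1 0) (U2 0) \<le> c * (KD * (8 * \<rho>\<^sup>2))" using c by (intro mult_left_mono) auto
      moreover have "c * (E (U1 0) + E (U2 0)) \<le> c * (R + R)" using U c by (intro mult_left_mono add_mono) auto
      ultimately show ?thesis using bm[of 0] by (simp add: Q_def abs_le_iff distrib_left)
    qed
    ultimately have "T * D (U1 T) (U2 T) \<le> B + T * (2 * \<epsilon> / 3)"
      by (simp add: B_def algebra_simps)
    also have "\<dots> \<le> T * (\<epsilon> / 3) + T * (2 * \<epsilon> / 3)" using T(2) by simp
    also have "\<dots> = T * \<epsilon>" by (simp flip: distrib_left)
    finally show "D (U1 T) (U2 T) \<le> \<epsilon>" using T by simp
  qed
qed

lemma trajectory_lipschitz:
  assumes U: "sol U" and b: "\<And>t. t \<ge> 0 \<Longrightarrow> norm (snd (U t)) \<le> \<rho>" and st: "s \<ge> 0" "t \<ge> 0"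
  shows "norm (J (fst (U t)) - J (fst (U s))) \<le> \<rho> * \<bar>t - s\<bar>"
proof -
  have "norm (J (fst (U t)) - J (fst (U s))) \<le> \<rho> * norm (t - s)"
  proof (rule differentiable_bound[where S = "{0..}" and f' = "\<lambda>r x. x *\<^sub>R snd (U r)"])
    fix r :: real assume r: "r \<in> {0..}"
    show "((\<lambda>r. J (fst (U r))) has_derivative (\<lambda>x. x *\<^sub>R snd (U r))) (at r within {0..})"
      using sol_vel[OF U[unfolded sol_def], of r] r by (simp add: has_vector_derivative_def)
    show "onorm (\<lambda>x. x *\<^sub>R snd (U r)) \<le> \<rho>"
      by (intro onorm_le) (use b[of r] r in \<open>simp add: mult.commute[of \<rho>] mult_left_mono\<close>)
  qed (use st in auto)
  then show ?thesis by simp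
qed

text \<open>A finite colouring: each initial state receives the net points close to its displacement
  at finitely many sample times. The velocity bound carries closeness from the sample times to all
  of [0,T], so equal colours meet the smallness condition of \<open>quasi_stability\<close>, and one
  state per colour provides the centres.\<close>

lemma asymptotically_smooth:
  assumes \<epsilon>: "\<epsilon> > 0"
  shows "\<exists>T\<ge>0. \<exists>X. finite X \<and> S T ` {y\<in>P. E y \<le> R} \<subseteq> (\<Union>x\<in>X. ball x \<epsilon>)"
proof -
  define B where "B = {y\<in>P. E y \<le> R}"
  define m where "m = min \<mu> \<alpha> / 2"
  have m: "m > 0" using M(3) A(3) by (simp add: m_def)
  have "m * (\<epsilon> / 2)\<^sup>2 > 0" using m \<epsilon> by simp
  from quasi_stability[OF this, of R] obtain T \<eta> where T: "T > 0" "\<eta> > 0"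
    and qs: "\<And>U1 U2. sol U1 \<Longrightarrow> sol U2 \<Longrightarrow> E (U1 0) \<le> R \<Longrightarrow> E (U2 0) \<le> R \<Longrightarrow>
      (\<forall>t\<in>{0..T}. norm (J (fst (U1 t)) - J (fst (U2 t))) \<le> \<eta>) \<Longrightarrow> D (U1 T) (U2 T) \<le> m * (\<epsilon> / 2)\<^sup>2"
    by blast
  obtain \<rho> where \<rho>: "\<rho> > 0" "\<And>y. y \<in> P \<Longrightarrow> E y \<le> R \<Longrightarrow> norm (fst y) \<le> \<rho> \<and> norm (snd y) \<le> \<rho>"
    using E_sublevel_bounded[of R] by blast
  obtain X where X: "finite X" "\<And>u. u \<in> V \<Longrightarrow> norm u \<le> \<rho> \<Longrightarrow> \<exists>x\<in>X. dist (J u) x < \<eta> / 4"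
    using J_compact[of "\<eta> / 4" \<rho>] T(2) by auto
  define p where "p u = (SOME x. x \<in> X \<and> dist (J u) x < \<eta> / 4)" for u
  have p: "p u \<in> X" "dist (J u) (p u) < \<eta> / 4" if "u \<in> V" "norm u \<le> \<rho>" for u
    using someI_ex[of "\<lambda>x. x \<in> X \<and> dist (J u) x < \<eta> / 4"] X(2)[OF that] unfolding p_def by blast+
  \<comment> \<open>Between a time and the preceding sample time a displacement moves by at most
    \<rho> \<tau> = \<eta>/4 after \<open>J\<close>. Two such moves and two net errors add up to
    \<eta>.\<close>
  define \<tau> where "\<tau> = \<eta> / (4 * \<rho>)"
  have \<tau>: "\<tau> > 0" "\<rho> * \<tau> = \<eta> / 4" using T \<rho>(1) by (auto simp: \<tau>_def)
  define N where "N = nat \<lceil>T / \<tau>\<rceil>"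
  \<comment> \<open>The restriction makes colours extensional functions on the sample indices, of
    which there are finitely many.\<close>
  define col where "col y = restrict (\<lambda>j. p (fst (S (real j * \<tau>) y))) {..N}" for y
  have S0: "S 0 y = y" if "y \<in> B" for y using S_0 that by (simp add: B_def P_def)
  have sl: "sol (\<lambda>t. S t y)" if "y \<in> B" for y using S_sol that by (simp add: B_def)
  have SB: "S t y \<in> P" "E (S t y) \<le> R" if "y \<in> B" "t \<ge> 0" for t y
    using sol_in[OF sl[OF that(1)] that(2)] E_decreasing[OF sl[OF that(1)] that(2)] S0[OF that(1)] that(1) by (auto simp: B_def)
  have St: "fst (S t y) \<in> V" "norm (fst (S t y)) \<le> \<rho>" "norm (snd (S t y)) \<le> \<rho>" if "y \<in> B" "t \<ge> 0" for t y
    using \<rho>(2)[OF SB[OF that]] SB(1)[OF that] by (auto simp: P_def)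
  have "col ` B \<subseteq> (\<Pi>\<^sub>E j\<in>{..N}. X)"
  proof (intro image_subsetI PiE_I)
    fix y j assume y: "y \<in> B"
    show "col y j \<in> X" if "j \<in> {..N}" using St[OF y, of "real j * \<tau>"] \<tau>(1) that by (auto simp: col_def intro!: p)
    show "col y j = undefined" if "j \<notin> {..N}" using that by (auto simp: col_def)
  qed
  then have fin: "finite (col ` B)" using finite_PiE[of "{..N}" "\<lambda>_. X"] X(1) finite_subset by blast
  have close: "dist (S T y) (S T y') < \<epsilon>" if y: "y \<in> B" "y' \<in> B" and eq: "col y = col y'" for y y'
  proof -
    have "D (S T y) (S T y') \<le> m * (\<epsilon> / 2)\<^sup>2"
    proof (rule qs[OF sl[OF y(1)] sl[OF y(2)]])
      show "E (S 0 y) \<le> R" "E (S 0 y') \<le> R" using S0 y by (auto simp: B_def)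
      show "\<forall>t\<in>{0..T}. norm (J (fst (S t y)) - J (fst (S t y'))) \<le> \<eta>"
      proof
        fix t assume t: "t \<in> {0..T}"
        define j where "j = nat \<lfloor>t / \<tau>\<rfloor>"
        have "t / \<tau> \<ge> 0" using t \<tau> by simp
        then have j: "real j \<le> t / \<tau>" "t / \<tau> < real j + 1" unfolding j_def by linarith+
        have "t / \<tau> \<le> T / \<tau>" using t \<tau> by (simp add: divide_right_mono)
        then have "real j \<le> real N" using j(1) unfolding N_def by linarith
        then have jN: "j \<le> N" by simp
        have jt: "\<bar>t - real j * \<tau>\<bar> \<le> \<tau>" "real j * \<tau> \<ge> 0" using j \<tau> by (auto simp: field_simps abs_le_iff)
        have lip: "norm (J (fst (S t x)) - J (fst (S (real j * \<tau>) x))) \<le> \<eta> / 4" if x: "x \<in> B" for x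
        proof -
          have "norm (J (fst (S t x)) - J (fst (S (real j * \<tau>) x))) \<le> \<rho> * \<bar>t - real j * \<tau>\<bar>"
            by (rule trajectory_lipschitz[OF sl[OF x]]) (use St(3)[OF x] jt t in auto)
          also have "\<dots> \<le> \<rho> * \<tau>" using jt \<rho>(1) by (intro mult_left_mono) auto
          finally show ?thesis using \<tau> by simp
        qed
        have grid: "dist (J (fst (S (real j * \<tau>) x))) (col x j) < \<eta> / 4" if x: "x \<in> B" for x
          using p(2)[OF St(1,2)[OF x jt(2)]] jN by (simp add: col_def)
        have "dist (J (fst (S (real j * \<tau>) y))) (J (fst (S (real j * \<tau>) y'))) < \<eta> / 4 + \<eta> / 4"
          using dist_triangle2[of "J (fst (S (real j * \<tau>) y))" "J (fst (S (real j * \<tau>) y'))" "col y j"]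
            grid[OF y(1)] grid[OF y(2)] eq by simp
        then have 1: "norm (J (fst (S (real j * \<tau>) y)) - J (fst (S (real j * \<tau>) y'))) \<le> \<eta> / 2" by (simp add: dist_norm)
        have "dist (J (fst (S t y))) (J (fst (S t y'))) \<le> dist (J (fst (S t y))) (J (fst (S (real j * \<tau>) y))) +
            (dist (J (fst (S (real j * \<tau>) y))) (J (fst (S (real j * \<tau>) y'))) + dist (J (fst (S t y'))) (J (fst (S (real j * \<tau>) y'))))"
          by (rule order_trans[OF dist_triangle[of _ _ "J (fst (S (real j * \<tau>) y))"]])
             (intro add_left_mono dist_triangle2)
        then show "norm (J (fst (S t y)) - J (fst (S t y'))) \<le> \<eta>" 
          using 1 lip[OF y(1)] lip[OF y(2)] by (simp add: dist_norm)
      qed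
    qed
    moreover have "m * (dist (S T y) (S T y'))\<^sup>2 \<le> D (S T y) (S T y')"
      unfolding m_def by (rule D_lower) (use SB y T in auto)
    ultimately have "m * (dist (S T y) (S T y'))\<^sup>2 \<le> m * (\<epsilon> / 2)\<^sup>2" by linarith
    then have "(dist (S T y) (S T y'))\<^sup>2 \<le> (\<epsilon> / 2)\<^sup>2" using m by simp
    from power2_le_imp_le[OF this] have "dist (S T y) (S T y') \<le> \<epsilon> / 2" using \<epsilon> by simp
    then show ?thesis using \<epsilon> by simp
  qed
  define Z where "Z = (\<lambda>c. S T (inv_into B col c)) ` col ` B"
  have "S T ` B \<subseteq> (\<Union>x\<in>Z. ball x \<epsilon>)"
  proof
    fix x assume "x \<in> S T ` B"
    then obtain y where y: "y \<in> B" "x = S T y" by blast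
    let ?y = "inv_into B col (col y)"
    have "?y \<in> B" "col ?y = col y" using y(1) inv_into_into[of "col y" col B] f_inv_into_f[of "col y" col B] by blast+
    then have "dist (S T ?y) x < \<epsilon>" using close[of ?y y] y by simp
    moreover have "S T ?y \<in> Z" using y(1) by (auto simp: Z_def)
    ultimately show "x \<in> (\<Union>x\<in>Z. ball x \<epsilon>)" by (auto simp: mem_ball)
  qed
  moreover have "finite Z" unfolding Z_def using fin by blast
  ultimately show ?thesis using T(1) unfolding B_def by (intro exI[of _ T] conjI exI[of _ Z]) auto
qed

lemma closed_P: "closed P"
  unfolding P_def by (intro closed_Times V H)

sublocale gradient_system P S E
proof
  show "closed P" by (rule closed_P)
  show "S t y \<in> P" if "t \<ge> 0" "y \<in> P" for t y using S_in that by (simp add: P_def)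
  show "S 0 y = y" if "y \<in> P" for y using S_0 that by (simp add: P_def)
  show "E (S t y) \<le> E y" if "t \<ge> 0" "y \<in> P" for t y
    using E_decreasing[OF S_sol[OF that(2)] that(1)] S_0 that(2) by (simp add: P_def)
qed (fact S_add S_cont E_cont E_strict E_bounded stationary_bounded asymptotically_smooth)+

end

section \<open>The Hilbert space of square integrable functions and integration\<close>

definition sqi :: "(real \<Rightarrow> real) \<Rightarrow> bool" where
  "sqi f \<longleftrightarrow> f \<in> borel_measurable lebesgue \<and> integrable lebesgue (\<lambda>x. (f x)\<^sup>2)"

text \<open>Rests on completeness of Lebesgue measure. It is indispensable because
  \<open>rep_ae\<close> returns an arbitrary member of a class.\<close>

lemma borel_measurable_lebesgue_cong_AE:
  fixes f g :: "real \<Rightarrow> real"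
  assumes f: "f \<in> borel_measurable lebesgue" and ae: "AE x in lebesgue. g x = f x"
  shows "g \<in> borel_measurable lebesgue"
proof (rule measurableI)
  fix A :: "real set" assume "A \<in> sets borel"
  then have "f -` A \<inter> space lebesgue \<in> sets lebesgue" using f by (rule measurable_sets[rotated])
  moreover have "AE x in lebesgue. x \<in> f -` A \<inter> space lebesgue \<longleftrightarrow> x \<in> g -` A \<inter> space lebesgue"
    using ae by eventually_elim simp
  ultimately show "g -` A \<inter> space lebesgue \<in> sets lebesgue"
    using completion.in_sets_AE[of "f -` A \<inter> space lebesgue" "g -` A \<inter> space lebesgue" lborel] by auto
qed simp

lemma sqi_cong_AE:
  assumes "sqi f" "AE x in lebesgue. g x = f x" shows "sqi g"
proof -
  have m: "g \<in> borel_measurable lebesgue" using assms borel_measurable_lebesgue_cong_AE unfolding sqi_def by blast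
  have "integrable lebesgue (\<lambda>x. (g x)\<^sup>2)"
  proof (rule integrable_cong_AE_imp)
    show "integrable lebesgue (\<lambda>x. (f x)\<^sup>2)" using assms(1) by (simp add: sqi_def)
    show "AE x in lebesgue. (f x)\<^sup>2 = (g x)\<^sup>2" using assms(2) by eventually_elim simp
  qed (use m in simp)
  with m show ?thesis by (simp add: sqi_def)
qed

lemma sqi_bound:
  assumes f: "sqi f" and g: "g \<in> borel_measurable lebesgue" and le: "AE x in lebesgue. \<bar>g x\<bar> \<le> \<bar>f x\<bar>"
  shows "sqi g"
  unfolding sqi_def
proof (rule conjI[OF g], rule Bochner_Integration.integrable_bound)
  show "integrable lebesgue (\<lambda>x. (f x)\<^sup>2)" using f by (simp add: sqi_def)
  show "(\<lambda>x. (g x)\<^sup>2) \<in> borel_measurable lebesgue" using g by simp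
  show "AE x in lebesgue. norm ((g x)\<^sup>2) \<le> norm ((f x)\<^sup>2)"
    using le by eventually_elim (simp add: abs_le_square_iff)
qed

lemma sqi_mult_integrable:
  assumes f: "sqi f" and g: "sqi g" shows "integrable lebesgue (\<lambda>x. f x * g x)"
proof (rule Bochner_Integration.integrable_bound)
  show "integrable lebesgue (\<lambda>x. (f x)\<^sup>2 + (g x)\<^sup>2)" using f g by (auto simp: sqi_def)
  show "(\<lambda>x. f x * g x) \<in> borel_measurable lebesgue" using f g by (auto simp: sqi_def)
  show "AE x in lebesgue. norm (f x * g x) \<le> norm ((f x)\<^sup>2 + (g x)\<^sup>2)"
  proof (rule AE_I2)
    fix x
    have "2 * \<bar>f x * g x\<bar> \<le> (f x)\<^sup>2 + (g x)\<^sup>2"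
      using sum_squares_bound[of "\<bar>f x\<bar>" "\<bar>g x\<bar>"] by (simp add: abs_mult)
    then show "norm (f x * g x) \<le> norm ((f x)\<^sup>2 + (g x)\<^sup>2)" by simp
  qed
qed

lemma sqi_zero [simp]: "sqi (\<lambda>x. 0)" by (simp add: sqi_def)

lemma sqi_add:
  assumes f: "sqi f" and g: "sqi g" shows "sqi (\<lambda>x. f x + g x)"
  unfolding sqi_def
proof
  show "(\<lambda>x. f x + g x) \<in> borel_measurable lebesgue" using f g by (auto simp: sqi_def)
  have "integrable lebesgue (\<lambda>x. (f x)\<^sup>2 + (g x)\<^sup>2 + 2 * (f x * g x))"
    using f g sqi_mult_integrable[OF f g] by (auto simp: sqi_def)
  then show "integrable lebesgue (\<lambda>x. (f x + g x)\<^sup>2)" by (simp add: power2_sum mult.assoc)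
qed

lemma sqi_cmult: "sqi f \<Longrightarrow> sqi (\<lambda>x. c * f x)"
  by (auto simp: sqi_def power_mult_distrib)

lemma sqi_minus: "sqi f \<Longrightarrow> sqi (\<lambda>x. - f x)"
  using sqi_cmult[of f "-1"] by simp

lemma sqi_diff: "sqi f \<Longrightarrow> sqi g \<Longrightarrow> sqi (\<lambda>x. f x - g x)"
  using sqi_add[OF _ sqi_minus, of f g] by simp

lemma rep_abs_ae: "AE x in lebesgue. rep_ae (abs_ae f) x = f x"
  using Quotient_rep_abs[OF Quotient_aefun, of f] by simp

lemma aefun_eqI:
  assumes "AE x in lebesgue. rep_ae u x = rep_ae v x" shows "u = v"
  using assms Quotient_rel_rep[OF Quotient_aefun, of u v] by simp

text \<open>A type cannot depend on the length \<open>L\<close>, so this is L^2 of the whole line;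
  functions on [0,L] form the closed subspace of classes vanishing outside the interval.\<close>

typedef l2 = "{u::aefun. sqi (rep_ae u)}"
proof
  show "abs_ae (\<lambda>x. 0) \<in> {u. sqi (rep_ae u)}" using sqi_cong_AE[OF sqi_zero rep_abs_ae] by simp
qed

definition fn :: "l2 \<Rightarrow> real \<Rightarrow> real" where "fn u = rep_ae (Rep_l2 u)"

definition mk :: "(real \<Rightarrow> real) \<Rightarrow> l2" where "mk f = Abs_l2 (abs_ae f)"

lemma fn_sqi [simp]: "sqi (fn u)" using Rep_l2[of u] by (simp add: fn_def)

lemma fn_measurable [measurable, simp]: "fn u \<in> borel_measurable lebesgue"
  using fn_sqi[of u] by (simp add: sqi_def)

lemma Rep_mk: "sqi f \<Longrightarrow> Rep_l2 (mk f) = abs_ae f"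
  unfolding mk_def using Abs_l2_inverse[of "abs_ae f"] sqi_cong_AE[OF _ rep_abs_ae, of f] by simp

lemma fn_mk: "sqi f \<Longrightarrow> AE x in lebesgue. fn (mk f) x = f x"
  unfolding fn_def Rep_mk by (rule rep_abs_ae)

lemma l2_eqI: "AE x in lebesgue. fn u x = fn v x \<Longrightarrow> u = v"
  unfolding fn_def using aefun_eqI Rep_l2_inject by blast

instantiation l2 :: real_inner
begin

definition "0 = mk (\<lambda>x. 0)"
definition "u + v = mk (\<lambda>x. fn u x + fn v x)"
definition "u - v = mk (\<lambda>x. fn u x - fn v x)"
definition "- u = mk (\<lambda>x. - fn u x)"
definition "c *\<^sub>R u = mk (\<lambda>x. c * fn u x)"
definition "inner u v = (LINT x|lebesgue. fn u x * fn v x)"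
definition "norm (u::l2) = sqrt (inner u u)"
definition "sgn (u::l2) = inverse (norm u) *\<^sub>R u"
definition "dist (u::l2) v = norm (u - v)"
definition "(uniformity :: (l2 \<times> l2) filter) = (INF e\<in>{0<..}. principal {(x, y). dist x y < e})"
definition "open (U :: l2 set) = (\<forall>x\<in>U. \<forall>\<^sub>F (x', y) in uniformity. x' = x \<longrightarrow> y \<in> U)"

lemma fn_zero: "AE x in lebesgue. fn 0 x = 0" unfolding zero_l2_def by (rule fn_mk) simp
lemma fn_add: "AE x in lebesgue. fn (u + v) x = fn u x + fn v x"
  unfolding plus_l2_def by (rule fn_mk) (simp add: sqi_add)
lemma fn_diff: "AE x in lebesgue. fn (u - v) x = fn u x - fn v x"
  unfolding minus_l2_def by (rule fn_mk) (simp add: sqi_diff)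
lemma fn_uminus: "AE x in lebesgue. fn (- u) x = - fn u x"
  unfolding uminus_l2_def by (rule fn_mk) (simp add: sqi_minus)
lemma fn_scaleR: "AE x in lebesgue. fn (c *\<^sub>R u) x = c * fn u x"
  unfolding scaleR_l2_def by (rule fn_mk) (simp add: sqi_cmult)

lemma inner_l2_cong:
  assumes "AE x in lebesgue. fn u x * fn v x = f x" "f \<in> borel_measurable lebesgue"
  shows "inner u v = (LINT x|lebesgue. f x)"
  unfolding inner_l2_def by (rule integral_cong_AE) (use assms in auto)

instance
proof
  fix u v w :: l2 and a b :: real
  show "u + v + w = u + (v + w)"
    by (rule l2_eqI) (use fn_add[of "u + v" w] fn_add[of u v] fn_add[of u "v + w"] fn_add[of v w] in \<open>eventually_elim, simp\<close>)
  show "u + v = v + u"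
    by (rule l2_eqI) (use fn_add[of u v] fn_add[of v u] in \<open>eventually_elim, simp\<close>)
  show "0 + u = u"
    by (rule l2_eqI) (use fn_add[of 0 u] fn_zero in \<open>eventually_elim, simp\<close>)
  show "- u + u = 0"
    by (rule l2_eqI) (use fn_add[of "- u" u] fn_uminus[of u] fn_zero in \<open>eventually_elim, simp\<close>)
  show "u - v = u + - v"
    by (rule l2_eqI) (use fn_diff[of u v] fn_add[of u "- v"] fn_uminus[of v] in \<open>eventually_elim, simp\<close>)
  show "a *\<^sub>R (u + v) = a *\<^sub>R u + a *\<^sub>R v"
    by (rule l2_eqI) (use fn_scaleR[of a "u + v"] fn_add[of u v] fn_add[of "a *\<^sub>R u" "a *\<^sub>R v"] fn_scaleR[of a u] fn_scaleR[of a v] in \<open>eventually_elim, simp add: distrib_left\<close>)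
  show "(a + b) *\<^sub>R u = a *\<^sub>R u + b *\<^sub>R u"
    by (rule l2_eqI) (use fn_scaleR[of "a + b" u] fn_add[of "a *\<^sub>R u" "b *\<^sub>R u"] fn_scaleR[of a u] fn_scaleR[of b u] in \<open>eventually_elim, simp add: distrib_right\<close>)
  show "a *\<^sub>R b *\<^sub>R u = (a * b) *\<^sub>R u"
    by (rule l2_eqI) (use fn_scaleR[of a "b *\<^sub>R u"] fn_scaleR[of b u] fn_scaleR[of "a * b" u] in \<open>eventually_elim, simp\<close>)
  show "1 *\<^sub>R u = u"
    by (rule l2_eqI) (use fn_scaleR[of 1 u] in \<open>eventually_elim, simp\<close>)
  show "dist u v = norm (u - v)" by (rule dist_l2_def)
  show "sgn u = inverse (norm u) *\<^sub>R u" by (rule sgn_l2_def)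
  show "inner u v = inner v u" by (simp add: inner_l2_def mult.commute)
  show "inner (u + v) w = inner u w + inner v w"
  proof -
    have "inner (u + v) w = (LINT x|lebesgue. fn u x * fn w x + fn v x * fn w x)"
      by (rule inner_l2_cong) (use fn_add[of u v] in \<open>eventually_elim, simp add: distrib_right\<close>, simp)
    then show ?thesis by (simp add: inner_l2_def sqi_mult_integrable)
  qed
  show "inner (a *\<^sub>R u) v = a * inner u v"
  proof -
    have "inner (a *\<^sub>R u) v = (LINT x|lebesgue. a * (fn u x * fn v x))"
      by (rule inner_l2_cong) (use fn_scaleR[of a u] in \<open>eventually_elim, simp\<close>, simp)
    then show ?thesis by (simp add: inner_l2_def)
  qed
  show "0 \<le> inner u u" by (simp add: inner_l2_def)
  show "inner u u = 0 \<longleftrightarrow> u = 0"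
  proof
    assume "inner u u = 0"
    then have "AE x in lebesgue. fn u x * fn u x = 0"
      unfolding inner_l2_def by (subst (asm) integral_nonneg_eq_0_iff_AE) (auto simp: sqi_mult_integrable)
    then have "AE x in lebesgue. fn u x = 0" by simp
    with fn_zero have "AE x in lebesgue. fn u x = fn 0 x" by eventually_elim simp
    then show "u = 0" by (rule l2_eqI)
  next
    assume "u = 0"
    then have "AE x in lebesgue. fn u x = 0" using fn_zero by simp
    then have "AE x in lebesgue. fn u x * fn u x = 0" by eventually_elim simp
    then show "inner u u = 0" unfolding inner_l2_def by (rule integral_eq_zero_AE)
  qed
  show "norm u = sqrt (inner u u)" by (rule norm_l2_def)
qed (rule uniformity_l2_def open_l2_def)+

end

lemma fn_diff_sq: "(LINT x|lebesgue. (fn u x - fn v x)\<^sup>2) = (dist u v)\<^sup>2"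
proof -
  have "inner (u - v) (u - v) = (LINT x|lebesgue. (fn u x - fn v x)\<^sup>2)"
    by (rule inner_l2_cong) (use fn_diff[of u v] in \<open>eventually_elim, simp add: power2_eq_square\<close>, simp)
  then show ?thesis by (simp add: dist_norm power2_norm_eq_inner)
qed

lemma nn_integral_fn_diff: "(\<integral>\<^sup>+x. ennreal ((fn u x - fn v x)\<^sup>2) \<partial>lebesgue) = ennreal ((dist u v)\<^sup>2)"
  unfolding fn_diff_sq[symmetric]
  using sqi_diff[OF fn_sqi fn_sqi, of u v] unfolding sqi_def by (intro nn_integral_eq_integral) auto

text \<open>Riesz-Fischer: a rapidly Cauchy subsequence converges almost everywhere, and Fatou's
  lemma turns the pointwise limit into a limit in norm.\<close>

instance l2 :: complete_space
proof
  fix X :: "nat \<Rightarrow> l2" assume X: "Cauchy X"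
  have "\<exists>N. \<forall>m\<ge>N. \<forall>n\<ge>N. dist (X m) (X n) < (1/4)^k" for k
    using X unfolding Cauchy_def by simp
  then obtain N where N: "\<And>k m n. m \<ge> N k \<Longrightarrow> n \<ge> N k \<Longrightarrow> dist (X m) (X n) < (1/4)^k" by metis
  \<comment> \<open>The partial sums dominate all of \<open>N 0\<close>, ..., \<open>N k\<close>, so
    every later index meets all earlier tolerances.\<close>
  define r where "r k = (\<Sum>i\<le>k. N i)" for k
  have rN: "r k \<ge> N j" if "j \<le> k" for j k
    unfolding r_def using that by (intro member_le_sum) auto
  \<comment> \<open>The increments have squared norm below 16^(-k), which leaves room for the weight
    4^k. Finiteness of the weighted sum almost everywhere gives |d k x| at most a constant times
    2^(-k), so the telescoping series converges.\<close>
  define d where "d k x = fn (X (r (Suc k))) x - fn (X (r k)) x" for k x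
  have "(\<integral>\<^sup>+x. (\<Sum>k. ennreal (4^k * (d k x)\<^sup>2)) \<partial>lebesgue) = (\<Sum>k. \<integral>\<^sup>+x. ennreal (4^k * (d k x)\<^sup>2) \<partial>lebesgue)"
    by (rule nn_integral_suminf) (simp add: d_def)
  also have "\<dots> \<le> (\<Sum>k. ennreal ((1/4)^k))"
  proof (rule suminf_le)
    fix k
    have "(\<integral>\<^sup>+x. ennreal (4^k * (d k x)\<^sup>2) \<partial>lebesgue) = ennreal (4^k) * (\<integral>\<^sup>+x. ennreal ((d k x)\<^sup>2) \<partial>lebesgue)"
      unfolding d_def by (subst nn_integral_cmult[symmetric]) (auto simp: ennreal_mult)
    also have "\<dots> = ennreal (4^k * (dist (X (r (Suc k))) (X (r k)))\<^sup>2)"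
      unfolding d_def nn_integral_fn_diff by (simp add: ennreal_mult)
    also have "\<dots> \<le> ennreal (4^k * ((1/4)^k)\<^sup>2)"
      using N[where k = k, OF rN[of k "Suc k"] rN[of k k]] by (intro ennreal_leI mult_left_mono power_mono) auto
    also have "4^k * ((1/4)^k)\<^sup>2 = (1/4 :: real)^k" by (simp add: power_one_over power2_eq_square)
    finally show "(\<integral>\<^sup>+x. ennreal (4^k * (d k x)\<^sup>2) \<partial>lebesgue) \<le> ennreal ((1/4)^k)" .
  qed auto
  also have "\<dots> = ennreal (\<Sum>k. (1/4)^k)" by (rule suminf_ennreal2) (auto intro: summable_geometric)
  also have "\<dots> < \<infinity>" by simp
  finally have "(\<integral>\<^sup>+x. (\<Sum>k. ennreal (4^k * (d k x)\<^sup>2)) \<partial>lebesgue) \<noteq> \<infinity>"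
    by (rule order.strict_implies_not_eq)
  moreover have "(\<lambda>x. \<Sum>k. ennreal (4^k * (d k x)\<^sup>2)) \<in> borel_measurable lebesgue"
    unfolding d_def by measurable
  ultimately have "AE x in lebesgue. (\<Sum>k. ennreal (4^k * (d k x)\<^sup>2)) \<noteq> \<infinity>"
    by (rule nn_integral_PInf_AE[rotated])
  then have lim: "AE x in lebesgue. convergent (\<lambda>k. fn (X (r k)) x)"
  proof eventually_elim
    fix x assume fin: "(\<Sum>k. ennreal (4^k * (d k x)\<^sup>2)) \<noteq> \<infinity>"
    have finite_real: "\<exists>C\<ge>0. s = ennreal C" if "s \<noteq> \<infinity>" for s
      using that by (cases s) auto
    define F where "F k = ennreal (4^k * (d k x)\<^sup>2)" for k
    obtain C where C: "C \<ge> 0" "(\<Sum>k. F k) = ennreal C"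
      using finite_real[OF fin] unfolding F_def by blast
    have "\<bar>d k x\<bar> \<le> sqrt C * (1/2)^k" for k
    proof -
      have "sum F {k} \<le> (\<Sum>k. F k)" by (rule sum_le_suminf) auto
      then have "ennreal (4^k * (d k x)\<^sup>2) \<le> ennreal C" unfolding C(2) by (simp add: F_def)
      then have "4^k * (d k x)\<^sup>2 \<le> C" using ennreal_le_iff[OF C(1)] by blast
      moreover have "(2^k)\<^sup>2 = (4::real)^k" by (simp add: power2_eq_square flip: power_mult_distrib)
      ultimately have "(2^k * \<bar>d k x\<bar>)\<^sup>2 \<le> C" by (simp add: power_mult_distrib)
      then have "2^k * \<bar>d k x\<bar> \<le> sqrt C" by (rule real_le_rsqrt)
      then show ?thesis by (simp add: power_one_over field_simps)
    qed
    note bound = this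
    have "summable (\<lambda>k. sqrt C * (1/2)^k)" by (intro summable_mult summable_geometric) simp
    then have "summable (\<lambda>k. d k x)" by (rule summable_comparison_test'[where N = 0]) (simp only: real_norm_def bound)
    then have "summable (\<lambda>k. fn (X (r (Suc k))) x - fn (X (r k)) x)" by (simp add: d_def)
    then have "convergent (\<lambda>m. \<Sum>k<m. fn (X (r (Suc k))) x - fn (X (r k)) x)"
      by (simp only: summable_iff_convergent)
    then obtain l where "(\<lambda>m. fn (X (r m)) x - fn (X (r 0)) x) \<longlonglongrightarrow> l"
      using sum_lessThan_telescope[of "\<lambda>k. fn (X (r k)) x"] unfolding convergent_def by (simp only:) blast
    from tendsto_add[OF this tendsto_const[of "fn (X (r 0)) x"]]
    have "(\<lambda>k. fn (X (r k)) x) \<longlonglongrightarrow> l + fn (X (r 0)) x" by (simp only: diff_add_cancel)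
    then show "convergent (\<lambda>k. fn (X (r k)) x)" by (rule convergentI)
  qed
  define g where "g x = lim (\<lambda>k. fn (X (r k)) x)" for x
  have gm [measurable]: "g \<in> borel_measurable lebesgue" unfolding g_def[abs_def] by (rule borel_measurable_lim_metric) simp
  have glim: "AE x in lebesgue. (\<lambda>k. fn (X (r k)) x) \<longlonglongrightarrow> g x"
    using lim by eventually_elim (simp add: g_def convergent_LIMSEQ_iff)
  have fatou: "(\<integral>\<^sup>+x. ennreal ((fn (X n) x - g x)\<^sup>2) \<partial>lebesgue) \<le> ennreal (((1/4)^j)\<^sup>2)" if n: "n \<ge> N j" for n j
  proof -
    have "(\<integral>\<^sup>+x. ennreal ((fn (X n) x - g x)\<^sup>2) \<partial>lebesgue) =
        (\<integral>\<^sup>+x. liminf (\<lambda>k. ennreal ((fn (X n) x - fn (X (r k)) x)\<^sup>2)) \<partial>lebesgue)"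
    proof (rule nn_integral_cong_AE)
      show "AE x in lebesgue. ennreal ((fn (X n) x - g x)\<^sup>2) = liminf (\<lambda>k. ennreal ((fn (X n) x - fn (X (r k)) x)\<^sup>2))"
        using glim
      proof eventually_elim
        fix x assume "(\<lambda>k. fn (X (r k)) x) \<longlonglongrightarrow> g x"
        then have "(\<lambda>k. ennreal ((fn (X n) x - fn (X (r k)) x)\<^sup>2)) \<longlonglongrightarrow> ennreal ((fn (X n) x - g x)\<^sup>2)"
          by (intro tendsto_intros)
        then show "ennreal ((fn (X n) x - g x)\<^sup>2) = liminf (\<lambda>k. ennreal ((fn (X n) x - fn (X (r k)) x)\<^sup>2))"
          by (rule lim_imp_Liminf[OF sequentially_bot, symmetric])
      qed
    qed
    also have "\<dots> \<le> liminf (\<lambda>k. \<integral>\<^sup>+x. ennreal ((fn (X n) x - fn (X (r k)) x)\<^sup>2) \<partial>lebesgue)"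
      by (rule nn_integral_liminf) simp
    also have "\<dots> \<le> ennreal (((1/4)^j)\<^sup>2)"
    proof (rule Liminf_le)
      show "\<forall>\<^sub>F k in sequentially. (\<integral>\<^sup>+x. ennreal ((fn (X n) x - fn (X (r k)) x)\<^sup>2) \<partial>lebesgue) \<le> ennreal (((1/4)^j)\<^sup>2)"
        unfolding eventually_sequentially
      proof (intro exI allI impI)
        fix k assume "j \<le> k"
        then have "dist (X n) (X (r k)) \<le> (1/4)^j" using N[OF n rN] by (simp add: less_imp_le)
        then show "(\<integral>\<^sup>+x. ennreal ((fn (X n) x - fn (X (r k)) x)\<^sup>2) \<partial>lebesgue) \<le> ennreal (((1/4)^j)\<^sup>2)"
          unfolding nn_integral_fn_diff by (intro ennreal_leI power_mono) auto
      qed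
    qed simp
    finally show ?thesis .
  qed
  have sd: "sqi (\<lambda>x. fn (X n) x - g x)" if "n \<ge> N j" for n j
    unfolding sqi_def
  proof
    show "integrable lebesgue (\<lambda>x. (fn (X n) x - g x)\<^sup>2)"
      by (rule integrableI_nonneg) (simp_all add: le_less_trans[OF fatou[OF that] ennreal_less_top, unfolded infinity_ennreal_def])
  qed simp
  have "sqi g" using sqi_diff[OF fn_sqi[of "X (N 0)"] sd[of 0 "N 0"]] by simp
  then have gg: "AE x in lebesgue. fn (mk g) x = g x" by (rule fn_mk)
  have dle: "dist (X n) (mk g) \<le> (1/4)^j" if "n \<ge> N j" for n j
  proof -
    have "ennreal ((dist (X n) (mk g))\<^sup>2) = (\<integral>\<^sup>+x. ennreal ((fn (X n) x - g x)\<^sup>2) \<partial>lebesgue)"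
      unfolding nn_integral_fn_diff[symmetric] by (rule nn_integral_cong_AE) (use gg in \<open>eventually_elim, simp\<close>)
    also note fatou[OF that]
    finally have "(dist (X n) (mk g))\<^sup>2 \<le> ((1/4)^j)\<^sup>2" by (simp add: ennreal_le_iff)
    then show ?thesis by (rule power2_le_imp_le) simp
  qed
  have "X \<longlonglongrightarrow> mk g"
  proof (rule metric_LIMSEQ_I)
    fix e :: real assume "e > 0"
    then obtain j where "(1/4::real)^j < e" using real_arch_pow_inv[of e "1/4"] by force
    then show "\<exists>no. \<forall>n\<ge>no. dist (X n) (mk g) < e" 
      by (intro exI[of _ "N j"] allI impI le_less_trans[OF dle])
  qed
  then show "convergent X" unfolding convergent_def by blast
qed

lemma mk_fn [simp]: "mk (fn u) = u"
  by (rule l2_eqI) (rule fn_mk[OF fn_sqi])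

lemma mk_cong_AE:
  assumes "AE x in lebesgue. f x = g x" "sqi f" shows "mk f = mk g"
proof -
  have g: "sqi g" by (rule sqi_cong_AE[OF assms(2)]) (use assms(1) in \<open>eventually_elim, simp\<close>)
  show ?thesis
    by (rule l2_eqI) (use fn_mk[OF assms(2)] fn_mk[OF g] assms(1) in \<open>eventually_elim, simp\<close>)
qed

lemma sqi_measurable: "sqi f \<Longrightarrow> f \<in> borel_measurable lebesgue"
  by (simp add: sqi_def)

lemma mk_add:
  assumes f: "sqi f" and g: "sqi g" shows "mk (\<lambda>x. f x + g x) = mk f + mk g"
  by (rule l2_eqI) (use fn_mk[OF f] fn_mk[OF g] fn_mk[OF sqi_add[OF f g]] fn_add[of "mk f" "mk g"] in \<open>eventually_elim, simp\<close>)

lemma mk_diff: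
  assumes f: "sqi f" and g: "sqi g" shows "mk (\<lambda>x. f x - g x) = mk f - mk g"
  by (rule l2_eqI) (use fn_mk[OF f] fn_mk[OF g] fn_mk[OF sqi_diff[OF f g]] fn_diff[of "mk f" "mk g"] in \<open>eventually_elim, simp\<close>)

lemma mk_scale:
  assumes f: "sqi f" shows "mk (\<lambda>x. c * f x) = c *\<^sub>R mk f"
  by (rule l2_eqI) (use fn_mk[OF f] fn_mk[OF sqi_cmult[OF f, of c]] fn_scaleR[of c "mk f"] in \<open>eventually_elim, simp\<close>)

lemma inner_mk:
  assumes f: "sqi f" shows "inner (mk f) v = (LINT x|lebesgue. f x * fn v x)"
proof (rule inner_l2_cong)
  show "AE x in lebesgue. fn (mk f) x * fn v x = f x * fn v x" using fn_mk[OF f] by eventually_elim simp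
qed (intro borel_measurable_times sqi_measurable f fn_sqi)

lemma inner_mk_mk:
  assumes f: "sqi f" and g: "sqi g" shows "inner (mk f) (mk g) = (LINT x|lebesgue. f x * g x)"
proof (rule inner_l2_cong)
  show "AE x in lebesgue. fn (mk f) x * fn (mk g) x = f x * g x"
    using fn_mk[OF f] fn_mk[OF g] by eventually_elim simp
qed (intro borel_measurable_times sqi_measurable f g)

lemma norm_mk: "sqi f \<Longrightarrow> (norm (mk f))\<^sup>2 = (LINT x|lebesgue. (f x)\<^sup>2)"
  unfolding power2_norm_eq_inner by (subst inner_mk_mk) (simp_all add: power2_eq_square)

lemma norm_mk_mono:
  assumes f: "sqi f" and g: "sqi g" and le: "AE x in lebesgue. \<bar>f x\<bar> \<le> \<bar>g x\<bar>"
  shows "norm (mk f) \<le> norm (mk g)"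
proof (rule power2_le_imp_le)
  show "(norm (mk f))\<^sup>2 \<le> (norm (mk g))\<^sup>2"
    unfolding norm_mk[OF f] norm_mk[OF g]
  proof (rule integral_mono_AE)
    show "AE x in lebesgue. (f x)\<^sup>2 \<le> (g x)\<^sup>2" using le by eventually_elim (simp add: abs_le_square_iff)
  qed (use f g in \<open>auto simp: sqi_def\<close>)
qed simp

lemma sqi_indicator [simp]: "sqi (indicator {a..b})" "sqi (indicator {a<..b})"
proof -
  have 1: "sqi (indicator A)" if A: "A \<in> sets lebesgue" "emeasure lebesgue A < \<infinity>" for A :: "real set"
  proof -
    have "(\<lambda>x. (indicator A x)\<^sup>2) = (indicator A :: real \<Rightarrow> real)" by (auto simp: indicator_def)
    then show ?thesis using A unfolding sqi_def by (simp add: integrable_real_indicator)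
  qed
  show i: "sqi (indicator {a..b})" by (rule 1) (auto simp: emeasure_lborel_Icc_eq)
  show "sqi (indicator {a<..b})"
    by (rule sqi_bound[OF i]) (auto intro!: AE_I2 borel_measurable_indicator simp: indicator_def)
qed

lemma norm_mk_indicator: "a \<le> b \<Longrightarrow> (norm (mk (indicator {a<..b})))\<^sup>2 = b - a" "a \<le> b \<Longrightarrow> (norm (mk (indicator {a..b})))\<^sup>2 = b - a"
proof -
  have *: "(\<lambda>x. (indicator A x)\<^sup>2) = (indicator A :: real \<Rightarrow> real)" for A by (auto simp: indicator_def)
  show "a \<le> b \<Longrightarrow> (norm (mk (indicator {a<..b})))\<^sup>2 = b - a" "a \<le> b \<Longrightarrow> (norm (mk (indicator {a..b})))\<^sup>2 = b - a"
    by (simp_all add: norm_mk *)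
qed

section \<open>Continuous functions and primitives on the interval\<close>

lemma continuous_indicator_measurable:
  fixes h :: "real \<Rightarrow> real"
  assumes h: "continuous_on {a..b} h" shows "(\<lambda>x. indicator {a..b} x * h x) \<in> borel_measurable lebesgue"
proof -
  have "(\<lambda>x. indicator {a..b} x *\<^sub>R h x) \<in> borel_measurable borel"
    by (rule borel_measurable_continuous_on_indicator[OF _ h]) simp
  then have "(\<lambda>x. indicator {a..b} x * h x) \<in> borel_measurable lborel" by simp
  then show ?thesis by (rule measurable_completion)
qed

lemma continuous_Icc_bounded:
  fixes h :: "real \<Rightarrow> real"
  assumes h: "continuous_on {a..b} h" shows "\<exists>B\<ge>0. \<forall>x\<in>{a..b}. \<bar>h x\<bar> \<le> B"
proof -
  have "bounded (h ` {a..b})" by (intro compact_imp_bounded compact_continuous_image h) simp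
  then show ?thesis unfolding bounded_pos by (auto intro: less_imp_le)
qed

lemma sqi_continuous:
  assumes h: "continuous_on {a..b} h" shows "sqi (\<lambda>x. indicator {a..b} x * h x)"
proof -
  obtain B where B: "B \<ge> 0" "\<And>x. x \<in> {a..b} \<Longrightarrow> \<bar>h x\<bar> \<le> B" using continuous_Icc_bounded[OF h] by blast
  show ?thesis
    by (rule sqi_bound[OF sqi_cmult[OF sqi_indicator(1)[of a b], of B] continuous_indicator_measurable[OF h]])
       (rule AE_I2, use B in \<open>auto simp: indicator_def\<close>)
qed

lemma sqi_bounded_mult:
  assumes f: "sqi f" and h: "continuous_on {a..b} h" shows "sqi (\<lambda>x. indicator {a..b} x * h x * f x)"
proof -
  obtain B where B: "B \<ge> 0" "\<And>x. x \<in> {a..b} \<Longrightarrow> \<bar>h x\<bar> \<le> B" using continuous_Icc_bounded[OF h] by blast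
  show ?thesis
  proof (rule sqi_bound[OF sqi_cmult[OF f, of B]])
    show "(\<lambda>x. indicator {a..b} x * h x * f x) \<in> borel_measurable lebesgue"
      by (rule borel_measurable_times[OF continuous_indicator_measurable[OF h] sqi_measurable[OF f]])
    show "AE x in lebesgue. \<bar>indicator {a..b} x * h x * f x\<bar> \<le> \<bar>B * f x\<bar>"
      using B by (intro AE_I2) (auto simp: indicator_def abs_mult intro!: mult_right_mono)
  qed
qed

text \<open>The primitive vanishing at 0, written as an inner product so that linearity and the
  Hoelder bound are Hilbert space facts.\<close>

definition Int0 :: "l2 \<Rightarrow> real \<Rightarrow> real" where "Int0 g x = inner g (mk (indicator {0..x}))"

lemma Int0_eq: "Int0 g x = (LINT y|lebesgue. indicator {0..x} y * fn g y)"
  unfolding Int0_def by (subst inner_commute) (simp add: inner_mk)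

lemma Int0_set: "Int0 g x = (LINT y:{0..x}|lebesgue. fn g y)"
  by (simp add: Int0_eq set_lebesgue_integral_def)

lemma Int0_add: "Int0 (g + h) x = Int0 g x + Int0 h x" by (simp add: Int0_def inner_add_left)
lemma Int0_diff: "Int0 (g - h) x = Int0 g x - Int0 h x" by (simp add: Int0_def inner_diff_left)
lemma Int0_scale: "Int0 (c *\<^sub>R g) x = c * Int0 g x" by (simp add: Int0_def)

lemma Int0_zero: "Int0 g 0 = 0"
proof -
  have "norm (mk (indicator {0..0})) = 0" using norm_mk_indicator(2)[of 0 0] by simp
  then show ?thesis by (simp add: Int0_def)
qed

lemma Int0_increment:
  assumes "0 \<le> x" "x \<le> y" shows "Int0 g y - Int0 g x = inner g (mk (indicator {x<..y}))"
proof -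
  have "(indicator {x<..y} :: real \<Rightarrow> real) = (\<lambda>t. indicator {0..y} t - indicator {0..x} t)"
    using assms by (auto simp: indicator_def fun_eq_iff)
  then have "mk (indicator {x<..y}) = mk (indicator {0..y}) - mk (indicator {0..x})"
    by (simp add: mk_diff)
  then show ?thesis by (simp add: Int0_def inner_diff_right)
qed

text \<open>Cauchy-Schwarz against the indicator of the interval between x and y, whose norm is the
  square root of its length. Continuity, uniform bounds and compactness of primitives all rest on
  this.\<close>

lemma Int0_holder: "0 \<le> x \<Longrightarrow> 0 \<le> y \<Longrightarrow> \<bar>Int0 g y - Int0 g x\<bar> \<le> norm g * sqrt \<bar>y - x\<bar>"
proof (induction x y rule: linorder_wlog)
  case (le x y)
  have "norm (mk (indicator {x<..y})) = sqrt (y - x)"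
    using norm_mk_indicator(1)[OF le(1)] by (simp add: real_sqrt_unique)
  then show ?case
    using Int0_increment[of x y g] le Cauchy_Schwarz_ineq2[of g "mk (indicator {x<..y})"] by simp
next
  case (sym x y)
  then show ?case by (simp add: abs_minus_commute)
qed

lemma Int0_bound: "0 \<le> x \<Longrightarrow> \<bar>Int0 g x\<bar> \<le> norm g * sqrt x"
  using Int0_holder[of 0 x g] by (simp add: Int0_zero)

lemma Int0_cont: "continuous_on {0..L} (Int0 g)"
  unfolding continuous_on_def
proof
  fix x assume x: "x \<in> {0..L}"
  have "((\<lambda>y. Int0 g y - Int0 g x) \<longlongrightarrow> 0) (at x within {0..L})"
  proof (rule Lim_null_comparison)
    show "\<forall>\<^sub>F y in at x within {0..L}. norm (Int0 g y - Int0 g x) \<le> norm g * sqrt \<bar>y - x\<bar>"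
      unfolding eventually_at_filter using x by (auto intro!: always_eventually Int0_holder)
    have "((\<lambda>y. norm g * sqrt \<bar>y - x\<bar>) \<longlongrightarrow> norm g * sqrt \<bar>x - x\<bar>) (at x within {0..L})"
      by (intro tendsto_intros)
    then show "((\<lambda>y. norm g * sqrt \<bar>y - x\<bar>) \<longlongrightarrow> 0) (at x within {0..L})" by simp
  qed
  then show "(Int0 g \<longlongrightarrow> Int0 g x) (at x within {0..L})" by (simp add: LIM_zero_iff)
qed

definition mkc :: "real \<Rightarrow> (real \<Rightarrow> real) \<Rightarrow> l2" where "mkc L h = mk (\<lambda>x. indicator {0..L} x * h x)"

text \<open>In terms of derivatives this is the embedding of H^1_0 into L^2: it sends u_x to
  u.\<close>

definition Jop :: "real \<Rightarrow> l2 \<Rightarrow> l2" where "Jop L g = mkc L (Int0 g)"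

definition H0 :: "real \<Rightarrow> l2 set" where "H0 L = {u. AE x in lebesgue. x \<notin> {0..L} \<longrightarrow> fn u x = 0}"

text \<open>The vanishing integral is the boundary condition u(L) = 0; the condition u(0) = 0 is
  built into the primitive.\<close>

definition V0 :: "real \<Rightarrow> l2 set" where "V0 L = {g\<in>H0 L. Int0 g L = 0}"

lemma mkc_fn:
  assumes "continuous_on {0..L} h" shows "AE x in lebesgue. fn (mkc L h) x = indicator {0..L} x * h x"
  unfolding mkc_def by (rule fn_mk[OF sqi_continuous[OF assms]])

lemma mkc_diff: "continuous_on {0..L} h \<Longrightarrow> continuous_on {0..L} k \<Longrightarrow> mkc L h - mkc L k = mkc L (\<lambda>x. h x - k x)"
  using mk_diff[OF sqi_continuous sqi_continuous, of 0 L h 0 L k] by (simp add: mkc_def right_diff_distrib)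

lemma mkc_inner:
  assumes "continuous_on {0..L} h" "continuous_on {0..L} k"
  shows "inner (mkc L h) (mkc L k) = (LINT x:{0..L}|lebesgue. h x * k x)"
proof -
  have "inner (mkc L h) (mkc L k) = (LINT x|lebesgue. (indicator {0..L} x * h x) * (indicator {0..L} x * k x))"
    unfolding mkc_def by (rule inner_mk_mk[OF sqi_continuous[OF assms(1)] sqi_continuous[OF assms(2)]])
  also have "\<dots> = (LINT x:{0..L}|lebesgue. h x * k x)"
    unfolding set_lebesgue_integral_def by (rule Bochner_Integration.integral_cong) (auto simp: indicator_def)
  finally show ?thesis .
qed

lemma mkc_norm_mono:
  assumes "continuous_on {0..L} h" "continuous_on {0..L} k" "\<And>x. x \<in> {0..L} \<Longrightarrow> \<bar>h x\<bar> \<le> \<bar>k x\<bar>"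
  shows "norm (mkc L h) \<le> norm (mkc L k)"
  unfolding mkc_def
  by (rule norm_mk_mono[OF sqi_continuous[OF assms(1)] sqi_continuous[OF assms(2)]])
     (rule AE_I2, use assms(3) in \<open>auto simp: indicator_def\<close>)

lemma mkc_norm_bound:
  assumes "L \<ge> 0" "continuous_on {0..L} h" "B \<ge> 0" "\<And>x. x \<in> {0..L} \<Longrightarrow> \<bar>h x\<bar> \<le> B"
  shows "norm (mkc L h) \<le> B * sqrt L"
proof -
  have "norm (mkc L h) \<le> norm (mkc L (\<lambda>x. B))" using assms by (intro mkc_norm_mono) auto
  also have "mkc L (\<lambda>x. B) = B *\<^sub>R mk (indicator {0..L})"
    using mk_scale[of "indicator {0..L}" B] by (simp add: mkc_def mult.commute)
  also have "norm \<dots> = B * sqrt L"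
    using norm_mk_indicator(2)[of 0 L] assms by (simp add: real_sqrt_unique)
  finally show ?thesis .
qed

lemma mkc_H0: "continuous_on {0..L} h \<Longrightarrow> mkc L h \<in> H0 L"
  unfolding H0_def using mkc_fn[of L h] by (auto elim!: eventually_mono)

lemma Jop_fn: "AE x in lebesgue. fn (Jop L g) x = indicator {0..L} x * Int0 g x"
  unfolding Jop_def by (rule mkc_fn[OF Int0_cont])

lemma Jop_H0: "Jop L g \<in> H0 L"
  unfolding Jop_def by (rule mkc_H0[OF Int0_cont])

lemma Jop_diff: "Jop L g - Jop L h = mkc L (\<lambda>x. Int0 g x - Int0 h x)"
  unfolding Jop_def by (rule mkc_diff[OF Int0_cont Int0_cont])

lemma Jop_norm_le: "L \<ge> 0 \<Longrightarrow> norm (Jop L g) \<le> norm g * L"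
proof -
  assume L: "L \<ge> 0"
  have "norm (Jop L g) \<le> (norm g * sqrt L) * sqrt L"
    unfolding Jop_def
  proof (rule mkc_norm_bound[OF L Int0_cont])
    fix x assume x: "x \<in> {0..L}"
    show "\<bar>Int0 g x\<bar> \<le> norm g * sqrt L"
      by (rule order_trans[OF Int0_bound]) (use x in \<open>auto intro!: mult_left_mono\<close>)
  qed (use L in simp)
  then show ?thesis using L by (simp add: mult.assoc)
qed

lemma Jop_bounded_linear: "L \<ge> 0 \<Longrightarrow> bounded_linear (Jop L)"
proof (rule bounded_linear_intro[where K = L])
  fix g h :: l2 and c :: real
  show "Jop L (g + h) = Jop L g + Jop L h"
    by (rule l2_eqI) (use Jop_fn[of L "g + h"] Jop_fn[of L g] Jop_fn[of L h] fn_add[of "Jop L g" "Jop L h"]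
        in \<open>eventually_elim, simp add: Int0_add distrib_left\<close>)
  show "Jop L (c *\<^sub>R g) = c *\<^sub>R Jop L g"
    by (rule l2_eqI) (use Jop_fn[of L "c *\<^sub>R g"] Jop_fn[of L g] fn_scaleR[of c "Jop L g"]
        in \<open>eventually_elim, simp add: Int0_scale\<close>)
qed (rule Jop_norm_le)

text \<open>The orthogonal projection onto \<open>H0 L\<close>, introduced to present that set as
  the fixed points of a bounded linear map.\<close>

definition restr :: "real \<Rightarrow> l2 \<Rightarrow> l2" where "restr L u = mk (\<lambda>x. indicator {0..L} x * fn u x)"

lemma sqi_restrict: "sqi f \<Longrightarrow> sqi (\<lambda>x. indicator {0..L} x * f x)"
  using sqi_bounded_mult[of f 0 L "\<lambda>x. 1"] by simp

lemma restr_fn: "AE x in lebesgue. fn (restr L u) x = indicator {0..L} x * fn u x"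
  unfolding restr_def by (rule fn_mk[OF sqi_restrict[OF fn_sqi]])

lemma restr_bounded_linear: "bounded_linear (restr L)"
proof (rule bounded_linear_intro[where K = 1])
  fix g h :: l2 and c :: real
  show "restr L (g + h) = restr L g + restr L h"
    by (rule l2_eqI) (use restr_fn[of L "g + h"] restr_fn[of L g] restr_fn[of L h] fn_add[of "restr L g" "restr L h"] fn_add[of g h]
        in \<open>eventually_elim, simp add: distrib_left\<close>)
  show "restr L (c *\<^sub>R g) = c *\<^sub>R restr L g"
    by (rule l2_eqI) (use restr_fn[of L "c *\<^sub>R g"] restr_fn[of L g] fn_scaleR[of c "restr L g"] fn_scaleR[of c g]
        in \<open>eventually_elim, simp\<close>)
  show "norm (restr L g) \<le> norm g * 1"
    using norm_mk_mono[OF sqi_restrict[OF fn_sqi] fn_sqi, of L g g] by (simp add: restr_def indicator_def)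
qed

lemma H0_iff: "u \<in> H0 L \<longleftrightarrow> restr L u = u"
proof
  assume "u \<in> H0 L"
  then have "AE x in lebesgue. x \<notin> {0..L} \<longrightarrow> fn u x = 0" by (simp add: H0_def)
  with restr_fn[of L u] have "AE x in lebesgue. fn (restr L u) x = fn u x"
    by eventually_elim (auto simp: indicator_def)
  then show "restr L u = u" by (rule l2_eqI)
next
  assume "restr L u = u"
  with restr_fn[of L u] have "AE x in lebesgue. fn u x = indicator {0..L} x * fn u x" by simp
  then show "u \<in> H0 L" unfolding H0_def by (auto elim!: eventually_mono)
qed

lemma H0_closed: "closed (H0 L)" and H0_subspace: "subspace (H0 L)"
proof -
  have e: "H0 L = {u. restr L u = u}" using H0_iff by auto
  show "closed (H0 L)" unfolding e
    by (intro closed_Collect_eq continuous_on_id linear_continuous_on[OF restr_bounded_linear])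
  show "subspace (H0 L)" unfolding e subspace_def
    using bounded_linear.linear[OF restr_bounded_linear, of L] by (auto simp: linear_0 linear_add linear_scale)
qed

lemma V0_closed: "closed (V0 L)" and V0_subspace: "subspace (V0 L)"
proof -
  have e: "V0 L = H0 L \<inter> {g. inner g (mk (indicator {0..L})) = 0}" by (auto simp: V0_def Int0_def)
  show "closed (V0 L)" unfolding e
    by (intro closed_Int H0_closed closed_Collect_eq continuous_intros)
  show "subspace (V0 L)" unfolding e
    by (intro subspace_inter H0_subspace) (auto simp: subspace_def inner_add_left)
qed

text \<open>Lebesgue differentiation: almost every value of g is the limit of averages over short
  intervals to its right, and these averages are difference quotients of the vanishing
  primitive.\<close>

lemma Int0_injective:
  assumes L: "L > 0" and g: "g \<in> H0 L" and z: "\<And>x. x \<in> {0..L} \<Longrightarrow> Int0 g x = 0"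
  shows "g = 0"
proof -
  define h where "h = restr L g"
  have ind: "(LINT t|lebesgue. indicator {a..b} t * fn g t) = inner g (mk (indicator {a..b}))" for a b
    by (subst inner_commute) (simp add: inner_mk)
  have int: "set_integrable lebesgue {a..b} (fn g)" for a b
    unfolding set_integrable_def using sqi_mult_integrable[OF sqi_indicator(1)[of a b] fn_sqi[of g]] by simp
  have "fn g integrable_on cbox a b" for a b using set_lebesgue_integral_eq_integral(1)[OF int] by simp
  then obtain N where N: "negligible N" "\<And>x e. x \<notin> N \<Longrightarrow> 0 < e \<Longrightarrow>
      \<exists>d>0. \<forall>h. 0 < h \<and> h < d \<longrightarrow> norm (integral (cbox x (x + h *\<^sub>R One)) (fn g) /\<^sub>R h ^ DIM(real) - fn g x) < e"
    using integrable_ccontinuous_explicit[of "fn g"] by blast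
  have zero: "fn g x = 0" if x: "x \<notin> N" "x \<in> {0<..<L}" for x
  proof (rule ccontr)
    assume "fn g x \<noteq> 0"
    then obtain d where d: "d > 0" "\<And>h. 0 < h \<Longrightarrow> h < d \<Longrightarrow> norm (integral {x..x + h} (fn g) / h - fn g x) < \<bar>fn g x\<bar>"
      using N(2)[OF x(1), of "\<bar>fn g x\<bar>"] by (auto simp: divide_inverse mult.commute)
    \<comment> \<open>x + h has to stay inside [0,L], where the primitive is known to
      vanish.\<close>
    define h where "h = min (d / 2) (L - x)"
    have h: "0 < h" "h < d" "x + h \<le> L" using d x by (auto simp: h_def)
    have "integral {x..x + h} (fn g) = (LINT t|lebesgue. indicator {x..x + h} t * fn g t)"
      using set_lebesgue_integral_eq_integral(2)[OF int, of x "x + h"] by (simp add: set_lebesgue_integral_def)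
    also have "\<dots> = inner g (mk (indicator {x..x + h}))" by (rule ind)
    also have "mk (indicator {x..x + h}) = mk (indicator {x<..x + h})"
    proof (rule mk_cong_AE)
      have "AE t in lebesgue. t \<noteq> x" using AE_lborel_singleton by (rule AE_completion)
      then show "AE t in lebesgue. indicator {x..x + h} t = (indicator {x<..x + h} t :: real)"
        by eventually_elim (auto simp: indicator_def)
    qed simp
    also have "inner g (mk (indicator {x<..x + h})) = Int0 g (x + h) - Int0 g x"
      using Int0_increment[of x "x + h" g] x h by simp
    also have "\<dots> = 0" using z x h by simp
    finally show False using d(2)[OF h(1,2)] by simp
  qed
  show "g = 0"
  proof (rule l2_eqI)
    have "AE x in lebesgue. x \<noteq> 0" "AE x in lebesgue. x \<noteq> L" using AE_lborel_singleton by (auto intro: AE_completion)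
    moreover have "AE x in lebesgue. x \<notin> N" using N(1) by (simp add: negligible_iff_null_sets AE_not_in)
    moreover have "AE x in lebesgue. x \<notin> {0..L} \<longrightarrow> fn g x = 0" using g by (simp add: H0_def)
    ultimately show "AE x in lebesgue. fn g x = fn 0 x" using fn_zero
      by eventually_elim (use zero in force)
  qed
qed

text \<open>The integral of |h - k| is zero, and a continuous nonnegative function with zero
  integral vanishes everywhere.\<close>

lemma continuous_AE_eq:
  fixes h k :: "real \<Rightarrow> real"
  assumes L: "L > 0" and h: "continuous_on {0..L} h" and k: "continuous_on {0..L} k"
    and ae: "AE x in lebesgue. x \<in> {0..L} \<longrightarrow> h x = k x" and x: "x \<in> {0..L}"
  shows "h x = k x"
proof -
  have "{x\<in>{0..L}. h x \<noteq> k x} \<in> null_sets lebesgue"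
  proof -
    have "{x. \<not> (x \<in> {0..L} \<longrightarrow> h x = k x)} \<in> null_sets lebesgue"
      using ae completion.AE_iff_null_sets[of "\<lambda>x. x \<in> {0..L} \<longrightarrow> h x = k x" lborel] by simp
    moreover have "{x. \<not> (x \<in> {0..L} \<longrightarrow> h x = k x)} = {x\<in>{0..L}. h x \<noteq> k x}" by auto
    ultimately show ?thesis by simp
  qed
  then have neg: "negligible {x\<in>{0..L}. h x \<noteq> k x}" by (simp add: negligible_iff_null_sets)
  have "integral {0..L} (\<lambda>x. \<bar>h x - k x\<bar>) = 0"
  proof -
    have "((\<lambda>x. \<bar>h x - k x\<bar>) has_integral 0) {0..L}"
      by (rule has_integral_spike[OF neg, of _ _ "\<lambda>x. 0"]) auto
    then show ?thesis by (rule integral_unique)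
  qed
  then have "\<forall>x\<in>{0..L}. \<bar>h x - k x\<bar> = 0"
    by (subst (asm) integral_eq_0_iff) (use L h k in \<open>auto intro!: continuous_intros\<close>)
  then show ?thesis using x by simp
qed

lemma Jop_injective:
  assumes L: "L > 0" and g: "g \<in> H0 L" and z: "Jop L g = 0"
  shows "g = 0"
proof (rule Int0_injective[OF L g])
  fix x assume x: "x \<in> {0..L}"
  have "AE x in lebesgue. x \<in> {0..L} \<longrightarrow> Int0 g x = 0"
    using Jop_fn[of L g] fn_zero unfolding z by eventually_elim (auto simp: indicator_def)
  then show "Int0 g x = 0" using continuous_AE_eq[OF L Int0_cont, of "\<lambda>x. 0" g x] x by simp
qed

section \<open>Integration by parts and Wirtinger's inequality\<close>

lemma sigma_finite_lebesgue: "sigma_finite_measure (lebesgue :: real measure)"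
proof
  obtain A :: "real set set" where A: "countable A" "A \<subseteq> sets lborel" "\<Union>A = space lborel" "\<forall>a\<in>A. emeasure lborel a \<noteq> \<infinity>"
    using lborel.sigma_finite_countable by blast
  show "\<exists>A::real set set. countable A \<and> A \<subseteq> sets lebesgue \<and> \<Union>A = space lebesgue \<and> (\<forall>a\<in>A. emeasure lebesgue a \<noteq> \<infinity>)"
  proof (intro exI conjI ballI)
    show "A \<subseteq> sets lebesgue" using A(2) by (auto intro: sets_completionI_sets)
    show "emeasure lebesgue a \<noteq> \<infinity>" if "a \<in> A" for a using A(2,4) that by (auto simp: subset_iff)
  qed (use A in auto)
qed

text \<open>Fubini on the plane cut along the diagonal, each half integrated with the smaller
  variable inside.\<close>

lemma integral_product_split:
  fixes p q :: "real \<Rightarrow> real"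
  assumes p: "integrable lebesgue p" and q: "integrable lebesgue q"
  shows "(LINT s|lebesgue. p s) * (LINT t|lebesgue. q t) =
    (LINT s|lebesgue. p s * (LINT t|lebesgue. (if t \<le> s then q t else 0))) +
    (LINT t|lebesgue. q t * (LINT s|lebesgue. (if s < t then p s else 0)))"
proof -
  interpret sigma_finite_measure "lebesgue :: real measure" by (rule sigma_finite_lebesgue)
  interpret pair_sigma_finite "lebesgue :: real measure" "lebesgue :: real measure" ..
  define F where "F s t = p s * q t" for s t
  have [measurable]: "p \<in> borel_measurable lebesgue" "q \<in> borel_measurable lebesgue" using p q by auto
  have id: "(\<lambda>x::real. x) \<in> borel_measurable lebesgue" by (rule measurable_completion) simp
  have [measurable]: "fst \<in> borel_measurable ((lebesgue :: real measure) \<Otimes>\<^sub>M (lebesgue :: real measure))"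
    by (rule measurable_compose[OF measurable_fst id])
  have [measurable]: "snd \<in> borel_measurable ((lebesgue :: real measure) \<Otimes>\<^sub>M (lebesgue :: real measure))"
    by (rule measurable_compose[OF measurable_snd id])
  have F: "integrable (lebesgue \<Otimes>\<^sub>M lebesgue) (case_prod F)"
  proof (rule Fubini_integrable)
    show "case_prod F \<in> borel_measurable (lebesgue \<Otimes>\<^sub>M lebesgue)" unfolding F_def by measurable
    have "(\<lambda>s. LINT t|lebesgue. norm (case (s, t) of (s, t) \<Rightarrow> F s t)) = (\<lambda>s. \<bar>p s\<bar> * (LINT t|lebesgue. \<bar>q t\<bar>))"
      by (simp add: F_def abs_mult)
    then show "integrable lebesgue (\<lambda>s. LINT t|lebesgue. norm (case (s, t) of (s, t) \<Rightarrow> F s t))" using p by simp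
    show "AE s in lebesgue. integrable lebesgue (\<lambda>t. case (s, t) of (s, t) \<Rightarrow> F s t)" using q by (simp add: F_def)
  qed
  define F1 where "F1 s t = (if t \<le> s then F s t else 0)" for s t
  define F2 where "F2 s t = (if s < t then F s t else 0)" for s t
  have mF: "case_prod F \<in> borel_measurable (lebesgue \<Otimes>\<^sub>M lebesgue)" using F by auto
  have m1: "case_prod F1 \<in> borel_measurable (lebesgue \<Otimes>\<^sub>M lebesgue)"
  proof -
    have "(\<lambda>z. if snd z \<le> fst z then case_prod F z else 0) \<in> borel_measurable (lebesgue \<Otimes>\<^sub>M lebesgue)"
      using mF by measurable
    moreover have "(\<lambda>z. if snd z \<le> fst z then case_prod F z else 0) = case_prod F1" by (auto simp: F1_def fun_eq_iff)
    ultimately show ?thesis by simp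
  qed
  have m2: "case_prod F2 \<in> borel_measurable (lebesgue \<Otimes>\<^sub>M lebesgue)"
  proof -
    have "(\<lambda>z. if fst z < snd z then case_prod F z else 0) \<in> borel_measurable (lebesgue \<Otimes>\<^sub>M lebesgue)"
      using mF by measurable
    moreover have "(\<lambda>z. if fst z < snd z then case_prod F z else 0) = case_prod F2" by (auto simp: F2_def fun_eq_iff)
    ultimately show ?thesis by simp
  qed
  have F1: "integrable (lebesgue \<Otimes>\<^sub>M lebesgue) (case_prod F1)"
    by (rule Bochner_Integration.integrable_bound[OF F m1]) (auto simp: F1_def)
  have F2: "integrable (lebesgue \<Otimes>\<^sub>M lebesgue) (case_prod F2)"
    by (rule Bochner_Integration.integrable_bound[OF F m2]) (auto simp: F2_def)
  have "(LINT s|lebesgue. p s) * (LINT t|lebesgue. q t) = (LINT s|lebesgue. (LINT t|lebesgue. F s t))"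
    by (simp add: F_def)
  also have "\<dots> = integral\<^sup>L (lebesgue \<Otimes>\<^sub>M lebesgue) (case_prod F)" using integral_fst[OF F] by simp
  also have "case_prod F = (\<lambda>z. case_prod F1 z + case_prod F2 z)"
    by (auto simp: F1_def F2_def fun_eq_iff)
  also have "integral\<^sup>L (lebesgue \<Otimes>\<^sub>M lebesgue) (\<lambda>z. case_prod F1 z + case_prod F2 z) =
      integral\<^sup>L (lebesgue \<Otimes>\<^sub>M lebesgue) (case_prod F1) + integral\<^sup>L (lebesgue \<Otimes>\<^sub>M lebesgue) (case_prod F2)"
    by (rule Bochner_Integration.integral_add[OF F1 F2])
  also have "integral\<^sup>L (lebesgue \<Otimes>\<^sub>M lebesgue) (case_prod F1) = (LINT s|lebesgue. (LINT t|lebesgue. F1 s t))"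
    using integral_fst[OF F1] by simp
  also have "(\<lambda>s. LINT t|lebesgue. F1 s t) = (\<lambda>s. p s * (LINT t|lebesgue. (if t \<le> s then q t else 0)))"
  proof
    fix s
    have "(\<lambda>t. F1 s t) = (\<lambda>t. p s * (if t \<le> s then q t else 0))" by (auto simp: F1_def F_def)
    then show "(LINT t|lebesgue. F1 s t) = p s * (LINT t|lebesgue. (if t \<le> s then q t else 0))" by simp
  qed
  also have "integral\<^sup>L (lebesgue \<Otimes>\<^sub>M lebesgue) (case_prod F2) = (LINT t|lebesgue. (LINT s|lebesgue. F2 s t))"
    using integral_snd[OF F2] by simp
  also have "(\<lambda>t. LINT s|lebesgue. F2 s t) = (\<lambda>t. q t * (LINT s|lebesgue. (if s < t then p s else 0)))"
  proof
    fix t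
    have "(\<lambda>s. F2 s t) = (\<lambda>s. q t * (if s < t then p s else 0))" by (auto simp: F2_def F_def)
    then show "(LINT s|lebesgue. F2 s t) = q t * (LINT s|lebesgue. (if s < t then p s else 0))" by simp
  qed
  finally show ?thesis .
qed

lemma Int0_mk: "sqi f \<Longrightarrow> Int0 (mk f) x = (LINT t|lebesgue. f t * indicator {0..x} t)"
  unfolding Int0_def by (rule inner_mk_mk) simp_all

text \<open>Integration by parts for two primitives. Their densities are merely square integrable,
  so in place of a pointwise product rule the product is expanded into a double integral and split
  along the diagonal.\<close>

lemma Int0_mult:
  assumes x: "x \<ge> 0"
  shows "Int0 g x * Int0 h x = (LINT s:{0..x}|lebesgue. fn g s * Int0 h s + fn h s * Int0 g s)"
proof -
  define p where "p s = indicator {0..x} s * fn g s" for s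
  define q where "q s = indicator {0..x} s * fn h s" for s
  have ip: "integrable lebesgue p" "integrable lebesgue q"
    unfolding p_def q_def by (intro sqi_mult_integrable; simp)+
  have 1: "p s * (LINT t|lebesgue. (if t \<le> s then q t else 0)) = indicator {0..x} s *\<^sub>R (fn g s * Int0 h s)" for s
  proof (cases "s \<in> {0..x}")
    case True
    then have "(\<lambda>t. if t \<le> s then q t else 0) = (\<lambda>t. indicator {0..s} t * fn h t)"
      by (auto simp: q_def indicator_def fun_eq_iff)
    then show ?thesis using True by (simp add: p_def Int0_eq)
  qed (simp add: p_def)
  have 2: "q t * (LINT s|lebesgue. (if s < t then p s else 0)) = indicator {0..x} t *\<^sub>R (fn h t * Int0 g t)" for t
  proof (cases "t \<in> {0..x}")
    case True
    \<comment> \<open>Strict and weak inequality differ at s = t only, a null set.\<close>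
    have "(LINT s|lebesgue. (if s < t then p s else 0)) = (LINT s|lebesgue. indicator {0..t} s * fn g s)"
    proof (rule integral_cong_AE)
      have "AE s in lebesgue. s \<noteq> t" using AE_lborel_singleton by (rule AE_completion)
      then show "AE s in lebesgue. (if s < t then p s else 0) = indicator {0..t} s * fn g s"
        by eventually_elim (use True in \<open>auto simp: p_def indicator_def\<close>)
      have "(\<lambda>s. if s < t then p s else 0) = (\<lambda>s. indicator {..<t} s * p s)" by (auto simp: indicator_def)
      moreover have "(\<lambda>s. indicator {..<t} s * p s) \<in> borel_measurable lebesgue"
        using ip by (intro borel_measurable_times borel_measurable_indicator) auto
      ultimately show "(\<lambda>s. if s < t then p s else 0) \<in> borel_measurable lebesgue" by simp
    qed (intro sqi_measurable sqi_restrict fn_sqi)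
    then show ?thesis using True by (simp add: q_def Int0_eq)
  qed (simp add: q_def)
  have i: "integrable lebesgue (\<lambda>s. indicator {0..x} s *\<^sub>R (fn g s * Int0 h s))" for g h
    using sqi_mult_integrable[OF sqi_continuous[OF Int0_cont[of x h]] fn_sqi[of g]] by (simp add: mult_ac)
  have "Int0 g x * Int0 h x = (LINT s|lebesgue. p s) * (LINT t|lebesgue. q t)"
    by (simp add: Int0_eq p_def q_def)
  also have "\<dots> = (LINT s|lebesgue. indicator {0..x} s *\<^sub>R (fn g s * Int0 h s)) + (LINT t|lebesgue. indicator {0..x} t *\<^sub>R (fn h t * Int0 g t))"
    unfolding integral_product_split[OF ip] 1 2 ..
  also have "\<dots> = (LINT s:{0..x}|lebesgue. fn g s * Int0 h s + fn h s * Int0 g s)"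
    unfolding set_lebesgue_integral_def by (simp only: scaleR_add_right Bochner_Integration.integral_add[OF i i])
  finally show ?thesis .
qed

text \<open>Wirtinger's inequality by completing the square: for w = c tan(c(x - L/2)), which is smooth on the closed
  interval if c < pi/L, one has w' = c^2 + w^2, hence the integral of (u' + w u)^2 equals that of
  u'^2 - c^2 u^2 because u vanishes at the end points.\<close>
lemma wirtinger_aux:
  assumes L: "L > 0" and c: "0 < c" "c < pi / L" and g: "g \<in> V0 L"
  shows "c * norm (Jop L g) \<le> norm g"
proof -
  define w where "w x = c * tan (c * (x - L / 2))" for x
  have cosne: "cos (c * (x - L / 2)) \<noteq> 0" if "x \<in> {0..L}" for x
  proof -
    have "\<bar>x - L / 2\<bar> \<le> L / 2" using that unfolding abs_le_iff by (simp add: field_simps)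
    then have "\<bar>c * (x - L / 2)\<bar> \<le> c * (L / 2)" using c by (simp add: abs_mult)
    also have "\<dots> < pi / L * (L / 2)" using c L by (intro mult_strict_right_mono) auto
    also have "\<dots> = pi / 2" using L by simp
    finally have "cos (c * (x - L / 2)) > 0" by (intro cos_gt_zero_pi) auto
    then show ?thesis by simp
  qed
  have dw: "(w has_real_derivative (c\<^sup>2 + (w x)\<^sup>2)) (at x)" if "x \<in> {0..L}" for x
  proof -
    have "(w has_real_derivative c * (inverse ((cos (c * (x - L / 2)))\<^sup>2) * c)) (at x)"
      unfolding w_def[abs_def] using cosne[OF that] by (auto intro!: derivative_eq_intros)
    moreover have "c * (inverse ((cos (c * (x - L / 2)))\<^sup>2) * c) = c\<^sup>2 + (w x)\<^sup>2"
    proof -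
      have "inverse ((cos (c * (x - L / 2)))\<^sup>2) = 1 + (tan (c * (x - L / 2)))\<^sup>2"
        using tan_sec[OF cosne[OF that]] by (simp add: power_inverse)
      then show ?thesis unfolding w_def by (simp only: power2_eq_square) (simp add: distrib_left mult_ac)
    qed
    ultimately show ?thesis by simp
  qed
  have cw: "continuous_on {0..L} w" using dw by (intro DERIV_continuous_on[of _ w]) (auto intro: has_field_derivative_at_within)
  define u where "u = Int0 g"
  have cu: "continuous_on {0..L} u" unfolding u_def by (rule Int0_cont)
  have u0: "u L = 0" using g by (simp add: u_def V0_def)
  have gH: "g \<in> H0 L" using g by (simp add: V0_def)
  \<comment> \<open>\<open>W\<close> and \<open>K\<close> are the densities of w - w(0) and u^2. The
    product of these primitives vanishes at L because u(L) = 0, and integration by parts turns this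
    into a vanishing integral of (w u^2)'.\<close>
  define W where "W = mkc L (\<lambda>x. c\<^sup>2 + (w x)\<^sup>2)"
  have cW: "continuous_on {0..L} (\<lambda>x. c\<^sup>2 + (w x)\<^sup>2)" by (intro continuous_intros cw)
  have IW: "Int0 W x = w x - w 0" if x: "x \<in> {0..L}" for x
  proof -
    have "set_integrable lebesgue {0..x} (\<lambda>t. c\<^sup>2 + (w t)\<^sup>2)"
      by (rule absolutely_integrable_continuous_real) (use x in \<open>auto intro: continuous_on_subset[OF cW]\<close>)
    from set_lebesgue_integral_eq_integral(2)[OF this]
    have "(LINT t:{0..x}|lebesgue. c\<^sup>2 + (w t)\<^sup>2) = integral {0..x} (\<lambda>t. c\<^sup>2 + (w t)\<^sup>2)" .
    moreover have "((\<lambda>t. c\<^sup>2 + (w t)\<^sup>2) has_integral (w x - w 0)) {0..x}"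
    proof (rule fundamental_theorem_of_calculus)
      fix t assume "t \<in> {0..x}"
      then show "(w has_vector_derivative (c\<^sup>2 + (w t)\<^sup>2)) (at t within {0..x})"
        unfolding has_real_derivative_iff_has_vector_derivative[symmetric]
        using x by (intro has_field_derivative_at_within[OF dw]) auto
    qed (use x in auto)
    moreover have "Int0 W x = (LINT t:{0..x}|lebesgue. c\<^sup>2 + (w t)\<^sup>2)"
      unfolding W_def mkc_def Int0_mk[OF sqi_continuous[OF cW]] set_lebesgue_integral_def
      by (rule Bochner_Integration.integral_cong) (use x in \<open>auto simp: indicator_def\<close>)
    ultimately show ?thesis by (simp add: integral_unique)
  qed
  have sK: "sqi (\<lambda>x. indicator {0..L} x * u x * fn g x)" by (rule sqi_bounded_mult[OF fn_sqi cu])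
  define K where "K = mk (\<lambda>x. 2 * (indicator {0..L} x * u x * fn g x))"
  have sK2: "sqi (\<lambda>x. 2 * (indicator {0..L} x * u x * fn g x))" by (rule sqi_cmult[OF sK])
  have IK: "Int0 K x = (u x)\<^sup>2" if x: "x \<in> {0..L}" for x
  proof -
    have "(u x)\<^sup>2 = (LINT s:{0..x}|lebesgue. fn g s * u s + fn g s * u s)"
      using Int0_mult[of x g g] x by (simp add: u_def power2_eq_square)
    also have "\<dots> = Int0 K x"
      unfolding K_def Int0_mk[OF sK2] set_lebesgue_integral_def
      by (rule Bochner_Integration.integral_cong) (use x in \<open>auto simp: indicator_def\<close>)
    finally show ?thesis by simp
  qed
  have i1: "integrable lebesgue (\<lambda>s. (indicator {0..L} s * (c\<^sup>2 + (w s)\<^sup>2)) * (indicator {0..L} s * (u s)\<^sup>2))"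
    by (intro sqi_mult_integrable sqi_continuous cW continuous_intros cu)
  have i2: "integrable lebesgue (\<lambda>s. 2 * (indicator {0..L} s * u s * fn g s) * (indicator {0..L} s * w s))"
    by (intro sqi_mult_integrable sK2 sqi_continuous cw)
  have i3: "integrable lebesgue (\<lambda>s. 2 * (indicator {0..L} s * u s * fn g s) * indicator {0..L} s)"
    by (intro sqi_mult_integrable sK2 sqi_indicator)
  have "Int0 W L * Int0 K L = (LINT s:{0..L}|lebesgue. fn W s * Int0 K s + fn K s * Int0 W s)"
    by (rule Int0_mult) (use L in simp)
  also have "\<dots> = (LINT s|lebesgue. (indicator {0..L} s * (c\<^sup>2 + (w s)\<^sup>2)) * (indicator {0..L} s * (u s)\<^sup>2) +
      (2 * (indicator {0..L} s * u s * fn g s) * (indicator {0..L} s * w s) -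
       w 0 * (2 * (indicator {0..L} s * u s * fn g s) * indicator {0..L} s)))"
    unfolding set_lebesgue_integral_def
  proof (rule integral_cong_AE)
    show "(\<lambda>s. indicator {0..L} s *\<^sub>R (fn W s * Int0 K s + fn K s * Int0 W s)) \<in> borel_measurable lebesgue"
    proof -
      have "(\<lambda>s. (indicator {0..L} s * Int0 K s) * fn W s + (indicator {0..L} s * Int0 W s) * fn K s) \<in> borel_measurable lebesgue"
        by (intro borel_measurable_add borel_measurable_times continuous_indicator_measurable Int0_cont fn_measurable)
      then show ?thesis by (simp add: algebra_simps)
    qed
    show "(\<lambda>s. (indicator {0..L} s * (c\<^sup>2 + (w s)\<^sup>2)) * (indicator {0..L} s * (u s)\<^sup>2) +
      (2 * (indicator {0..L} s * u s * fn g s) * (indicator {0..L} s * w s) -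
       w 0 * (2 * (indicator {0..L} s * u s * fn g s) * indicator {0..L} s))) \<in> borel_measurable lebesgue"
      by (intro borel_measurable_integrable Bochner_Integration.integrable_add Bochner_Integration.integrable_diff
          Bochner_Integration.integrable_mult_right i1 i2 i3)
    show "AE s in lebesgue. indicator {0..L} s *\<^sub>R (fn W s * Int0 K s + fn K s * Int0 W s) =
      (indicator {0..L} s * (c\<^sup>2 + (w s)\<^sup>2)) * (indicator {0..L} s * (u s)\<^sup>2) +
      (2 * (indicator {0..L} s * u s * fn g s) * (indicator {0..L} s * w s) -
       w 0 * (2 * (indicator {0..L} s * u s * fn g s) * indicator {0..L} s))"
      using mkc_fn[OF cW] fn_mk[OF sK2] unfolding W_def[symmetric] K_def[symmetric]
      by eventually_elim (auto simp: indicator_def IK IW algebra_simps)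
  qed
  also have "\<dots> = (LINT s|lebesgue. (indicator {0..L} s * (c\<^sup>2 + (w s)\<^sup>2)) * (indicator {0..L} s * (u s)\<^sup>2)) +
      ((LINT s|lebesgue. 2 * (indicator {0..L} s * u s * fn g s) * (indicator {0..L} s * w s)) -
       w 0 * (LINT s|lebesgue. 2 * (indicator {0..L} s * u s * fn g s) * indicator {0..L} s))"
    by (simp only: Bochner_Integration.integral_add Bochner_Integration.integral_diff integral_mult_right_zero
        Bochner_Integration.integrable_diff Bochner_Integration.integrable_mult_right i1 i2 i3)
  \<comment> \<open>The constant w(0), left over because the primitive of \<open>W\<close> is w -
    w(0), is multiplied by u(L)^2 = 0.\<close>
  also have "(LINT s|lebesgue. 2 * (indicator {0..L} s * u s * fn g s) * indicator {0..L} s) = 0"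
    using IK[of L] L u0 unfolding K_def Int0_mk[OF sK2] by simp
  finally have zero: "(LINT s|lebesgue. (indicator {0..L} s * (c\<^sup>2 + (w s)\<^sup>2)) * (indicator {0..L} s * (u s)\<^sup>2)) +
      (LINT s|lebesgue. 2 * (indicator {0..L} s * u s * fn g s) * (indicator {0..L} s * w s)) = 0"
    using IK[of L] L u0 by simp
  have i4: "integrable lebesgue (\<lambda>s. (fn g s)\<^sup>2)" using fn_sqi[of g] by (simp add: sqi_def)
  have sJ: "sqi (\<lambda>s. indicator {0..L} s * u s)" by (rule sqi_continuous[OF cu])
  then have i5: "integrable lebesgue (\<lambda>s. (indicator {0..L} s * u s)\<^sup>2)" by (simp add: sqi_def)
  have nJ: "(norm (Jop L g))\<^sup>2 = (LINT s|lebesgue. (indicator {0..L} s * u s)\<^sup>2)"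
    unfolding Jop_def mkc_def u_def[symmetric] by (rule norm_mk[OF sJ])
  have ng: "(norm g)\<^sup>2 = (LINT s|lebesgue. (fn g s)\<^sup>2)"
    unfolding power2_norm_eq_inner inner_l2_def by (simp add: power2_eq_square)
  \<comment> \<open>Adding the two integrands whose sum integrates to zero completes the square u' +
    w u on the interval.\<close>
  have "0 \<le> (LINT s|lebesgue. (fn g s)\<^sup>2 - c\<^sup>2 * (indicator {0..L} s * u s)\<^sup>2 +
     ((indicator {0..L} s * (c\<^sup>2 + (w s)\<^sup>2)) * (indicator {0..L} s * (u s)\<^sup>2) +
      2 * (indicator {0..L} s * u s * fn g s) * (indicator {0..L} s * w s)))"
  proof (rule integral_nonneg_AE, rule AE_I2)
    fix s
    have "(fn g s)\<^sup>2 - c\<^sup>2 * (u s)\<^sup>2 + ((c\<^sup>2 + (w s)\<^sup>2) * (u s)\<^sup>2 + 2 * (u s * fn g s) * w s) = (fn g s + w s * u s)\<^sup>2"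
      by (simp add: power2_eq_square algebra_simps)
    then show "0 \<le> (fn g s)\<^sup>2 - c\<^sup>2 * (indicator {0..L} s * u s)\<^sup>2 +
     ((indicator {0..L} s * (c\<^sup>2 + (w s)\<^sup>2)) * (indicator {0..L} s * (u s)\<^sup>2) +
      2 * (indicator {0..L} s * u s * fn g s) * (indicator {0..L} s * w s))"
      by (cases "s \<in> {0..L}") (simp_all add: indicator_def)
  qed
  also have "\<dots> = (norm g)\<^sup>2 - c\<^sup>2 * (norm (Jop L g))\<^sup>2 +
      ((LINT s|lebesgue. (indicator {0..L} s * (c\<^sup>2 + (w s)\<^sup>2)) * (indicator {0..L} s * (u s)\<^sup>2)) +
      (LINT s|lebesgue. 2 * (indicator {0..L} s * u s * fn g s) * (indicator {0..L} s * w s)))"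
    unfolding nJ ng
    by (simp only: Bochner_Integration.integral_add Bochner_Integration.integral_diff integral_mult_right_zero
        Bochner_Integration.integrable_add Bochner_Integration.integrable_diff Bochner_Integration.integrable_mult_right i1 i2 i4 i5)
  finally have "(c * norm (Jop L g))\<^sup>2 \<le> (norm g)\<^sup>2" unfolding zero by (simp add: power_mult_distrib)
  then show ?thesis by (rule power2_le_imp_le) simp
qed

text \<open>At c = pi/L the tangent is singular at the end points, so the sharp constant is reached
  as a limit of c from below.\<close>

lemma wirtinger:
  assumes L: "L > 0" and g: "g \<in> V0 L"
  shows "(norm (Jop L g))\<^sup>2 \<le> L\<^sup>2 / pi\<^sup>2 * (norm g)\<^sup>2"
proof -
  have "pi / L * norm (Jop L g) \<le> norm g"
  proof (rule tendsto_upperbound)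
    show "((\<lambda>c. c * norm (Jop L g)) \<longlongrightarrow> pi / L * norm (Jop L g)) (at_left (pi / L))"
      by (intro tendsto_intros)
    show "\<forall>\<^sub>F c in at_left (pi / L). c * norm (Jop L g) \<le> norm g"
      by (rule eventually_at_leftI[of 0]) (use wirtinger_aux[OF L _ _ g] L in auto)
  qed simp
  then have "norm (Jop L g) \<le> L / pi * norm g" using L by (simp add: field_simps)
  then have "(norm (Jop L g))\<^sup>2 \<le> (L / pi * norm g)\<^sup>2" by (intro power_mono) auto
  then show ?thesis by (simp add: power_mult_distrib power_divide)
qed

text \<open>If the classes of a finite colouring have small image, one image point per colour forms
  a net.\<close>

lemma finite_net_of_finite_image:
  assumes "finite (c ` B)" "\<And>x y. x \<in> B \<Longrightarrow> y \<in> B \<Longrightarrow> c x = c y \<Longrightarrow> dist (J x) (J y) < \<eta>"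
  shows "\<exists>X. finite X \<and> (\<forall>x\<in>B. \<exists>z\<in>X. dist (J x) z < \<eta>)"
proof (intro exI conjI ballI)
  show "finite ((\<lambda>k. J (inv_into B c k)) ` c ` B)" using assms(1) by blast
  fix x assume x: "x \<in> B"
  have "inv_into B c (c x) \<in> B" "c (inv_into B c (c x)) = c x"
    using x inv_into_into[of "c x" c B] f_inv_into_f[of "c x" c B] by blast+
  then show "\<exists>z\<in>(\<lambda>k. J (inv_into B c k)) ` c ` B. dist (J x) z < \<eta>"
    using assms(2)[OF x, of "inv_into B c (c x)"] x by auto
qed

text \<open>By the Hoelder bound, a primitive is determined up to a small error by finitely many rounded values.\<close>
lemma Jop_totally_bounded:
  assumes L: "L > 0" and \<eta>: "\<eta> > 0"
  shows "\<exists>X. finite X \<and> (\<forall>g. norm g \<le> R \<longrightarrow> (\<exists>z\<in>X. dist (Jop L g) z < \<eta>))"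
proof -
  define B where "B = {g::l2. norm g \<le> R}"
  \<comment> \<open>Three errors of size e will occur: two moves to a grid point and one rounding.
    The uniform bound 3 e becomes 3 e sqrt L in L^2, which is below \<eta>.\<close>
  define e where "e = \<eta> / (4 * sqrt L)"
  have e: "e > 0" using L \<eta> by (simp add: e_def)
  define R' where "R' = \<bar>R\<bar> + 1"
  have R': "R' > 0" "R \<le> R'" by (auto simp: R'_def)
  \<comment> \<open>Over a distance h a primitive of a density of norm at most R' changes by at most
    R' sqrt h = e.\<close>
  define h where "h = (e / R')\<^sup>2"
  have h: "h > 0" "R' * sqrt h = e" using e R' by (auto simp: h_def)
  define N where "N = nat \<lceil>L / h\<rceil>"
  define K where "K = \<lceil>R' * sqrt L / e\<rceil>"
  \<comment> \<open>The last grid point may lie beyond L, hence the truncation; rounding is down to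
    multiples of e.\<close>
  define c where "c g = restrict (\<lambda>j. \<lfloor>Int0 g (min (real j * h) L) / e\<rfloor>) {..N}" for g
  have "c ` B \<subseteq> (\<Pi>\<^sub>E j\<in>{..N}. {-K..K})"
  proof (intro image_subsetI PiE_I)
    fix g j assume g: "g \<in> B"
    show "c g j = undefined" if "j \<notin> {..N}" using that by (simp add: c_def)
    assume j: "j \<in> {..N}"
    let ?x = "min (real j * h) L"
    have "\<bar>Int0 g ?x\<bar> \<le> norm g * sqrt ?x" using L h by (intro Int0_bound) auto
    also have "\<dots> \<le> R' * sqrt L" using g R' L h by (intro mult_mono) (auto simp: B_def)
    finally have "\<bar>Int0 g ?x / e\<bar> \<le> R' * sqrt L / e" using e by (simp add: divide_right_mono)
    then have "- (R' * sqrt L / e) \<le> Int0 g ?x / e" "Int0 g ?x / e \<le> R' * sqrt L / e" by (simp_all only: abs_le_iff) auto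
    then show "c g j \<in> {-K..K}" using j unfolding c_def K_def by (simp add: ceiling_def le_floor_iff floor_le_iff) linarith
  qed
  then have fin: "finite (c ` B)" using finite_PiE[of "{..N}" "\<lambda>_. {-K..K}"] finite_subset by blast
  have "\<exists>X. finite X \<and> (\<forall>g\<in>B. \<exists>z\<in>X. dist (Jop L g) z < \<eta>)"
  proof (rule finite_net_of_finite_image[OF fin])
    fix g g' assume g: "g \<in> B" "g' \<in> B" and eq: "c g = c g'"
    have "norm (Jop L g - Jop L g') \<le> (3 * e) * sqrt L"
      unfolding Jop_diff
    proof (rule mkc_norm_bound)
      fix x assume x: "x \<in> {0..L}"
      define j where "j = nat \<lfloor>x / h\<rfloor>"
      have "x / h \<ge> 0" using x h by simp
      then have j: "real j \<le> x / h" "x / h < real j + 1" unfolding j_def by linarith+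
      have "x / h \<le> L / h" using x h by (simp add: divide_right_mono)
      then have "real j \<le> real N" using j(1) unfolding N_def by linarith
      then have jN: "j \<le> N" by simp
      have jh: "real j * h \<le> x" "x < real j * h + h" using j h by (auto simp: field_simps)
      then have m: "min (real j * h) L = real j * h" using x by simp
      have close: "\<bar>Int0 k x - Int0 k (real j * h)\<bar> \<le> e" if "k \<in> B" for k
      proof -
        have "\<bar>Int0 k x - Int0 k (real j * h)\<bar> \<le> norm k * sqrt \<bar>x - real j * h\<bar>"
          using x h by (intro Int0_holder) auto
        also have "\<dots> \<le> R' * sqrt h" using that R' jh by (intro mult_mono) (auto simp: B_def)
        finally show ?thesis using h by simp
      qed
      have "\<lfloor>Int0 g (real j * h) / e\<rfloor> = \<lfloor>Int0 g' (real j * h) / e\<rfloor>"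
        using fun_cong[OF eq, of j] jN m by (simp add: c_def)
      then have "\<bar>Int0 g (real j * h) / e - Int0 g' (real j * h) / e\<bar> \<le> 1" by linarith
      then have "\<bar>Int0 g (real j * h) - Int0 g' (real j * h)\<bar> \<le> e"
        using e by (simp add: divide_le_eq abs_divide flip: diff_divide_distrib)
      then show "\<bar>Int0 g x - Int0 g' x\<bar> \<le> 3 * e" using close[OF g(1)] close[OF g(2)] by linarith
    qed (use L e in \<open>auto intro!: continuous_intros Int0_cont\<close>)
    also have "(3 * e) * sqrt L < \<eta>" using L \<eta> by (simp add: e_def)
    finally show "dist (Jop L g) (Jop L g') < \<eta>" by (simp add: dist_norm)
  qed
  then show ?thesis by (simp add: B_def)
qed

section \<open>Nemytskii operators\<close>

text \<open>Bundles (G1) and (G2) for one function; derivative and constants are existentially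
  bound, as the estimates only need that some exist.\<close>

definition damping :: "(real \<Rightarrow> real) \<Rightarrow> bool" where
  "damping g \<longleftrightarrow> (\<exists>g'. (\<forall>s. (g has_real_derivative g' s) (at s)) \<and> continuous_on UNIV g') \<and>
     strict_mono g \<and> g 0 = 0 \<and>
     (\<exists>m>0. \<exists>M>0. \<forall>s. \<bar>s\<bar> > 1 \<longrightarrow> m * s\<^sup>2 \<le> g s * s \<and> g s * s \<le> M * s\<^sup>2)"

lemma damping_cont: "damping g \<Longrightarrow> continuous_on T g"
  unfolding damping_def by (meson DERIV_isCont continuous_at_imp_continuous_on)

lemma damping_mono: "damping g \<Longrightarrow> 0 \<le> (g s - g t) * (s - t)"
  unfolding damping_def
  by (cases "s \<le> t") (auto simp: zero_le_mult_iff strict_mono_less_eq)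

lemma damping_mono_strict: "damping g \<Longrightarrow> s \<noteq> t \<Longrightarrow> 0 < (g s - g t) * (s - t)"
  unfolding damping_def
  by (cases "s < t") (auto simp: zero_less_mult_iff strict_mono_less)

lemma damping_0: "damping g \<Longrightarrow> g 0 = 0"
  by (simp add: damping_def)

text \<open>For |s| > 1 divide the upper growth condition by |s|; on [-1,1] monotonicity bounds g by
  its values at the end points.\<close>

lemma damping_growth:
  assumes g: "damping g" shows "\<exists>C>0. \<forall>s. \<bar>g s\<bar> \<le> C * (1 + \<bar>s\<bar>)"
proof -
  obtain M where M: "M > 0" "\<And>s. \<bar>s\<bar> > 1 \<Longrightarrow> g s * s \<le> M * s\<^sup>2" using g unfolding damping_def by blast
  have mono: "g s \<le> g t" if "s \<le> t" for s t using g that unfolding damping_def by (simp add: strict_mono_less_eq)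
  define C where "C = M + \<bar>g 1\<bar> + \<bar>g (-1)\<bar>"
  have "\<bar>g s\<bar> \<le> C * (1 + \<bar>s\<bar>)" for s
  proof (cases "\<bar>s\<bar> > 1")
    case True
    have "0 \<le> g s * s" using damping_mono[OF g, of s 0] damping_0[OF g] by simp
    then have "\<bar>g s\<bar> * \<bar>s\<bar> = g s * s" by (simp flip: abs_mult)
    also have "\<dots> \<le> M * s\<^sup>2" by (rule M(2)[OF True])
    also have "\<dots> = (M * \<bar>s\<bar>) * \<bar>s\<bar>" by (simp add: power2_eq_square flip: abs_mult)
    finally have "\<bar>g s\<bar> \<le> M * \<bar>s\<bar>" using True by (auto simp: mult_le_cancel_right)
    also have "\<dots> \<le> C * (1 + \<bar>s\<bar>)" using M(1) by (intro mult_mono) (auto simp: C_def)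
    finally show ?thesis .
  next
    case False
    then have "\<bar>g s\<bar> \<le> \<bar>g 1\<bar> + \<bar>g (-1)\<bar>" using mono[of s 1] mono[of "-1" s] by linarith
    also have "\<dots> \<le> C * 1" using M(1) by (simp add: C_def)
    also have "\<dots> \<le> C * (1 + \<bar>s\<bar>)" using M(1) by (intro mult_left_mono) (auto simp: C_def)
    finally show ?thesis .
  qed
  moreover have "C > 0" using M(1) by (simp add: C_def)
  ultimately show ?thesis by blast
qed

text \<open>Only \<open>b\<close> is confined. For a near the range of b the derivative is bounded
  on a compact interval; otherwise |a - b| \<ge> 1 and linear growth suffices. An unrestricted
  \<open>a\<close> is what continuity of the superposition operator calls for.\<close>

lemma damping_lipschitz:
  assumes g: "damping g"
  shows "\<exists>C\<ge>0. \<forall>a b. \<bar>b\<bar> \<le> K \<longrightarrow> \<bar>g a - g b\<bar> \<le> C * \<bar>a - b\<bar>"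
proof -
  obtain g' where g': "\<And>s. (g has_real_derivative g' s) (at s)" "continuous_on UNIV g'"
    using g unfolding damping_def by blast
  obtain B where B: "B \<ge> 0" "\<And>s. s \<in> {-K - 1..K + 1} \<Longrightarrow> \<bar>g' s\<bar> \<le> B"
    using continuous_Icc_bounded[OF continuous_on_subset[OF g'(2) subset_UNIV]] by blast
  obtain D where D: "D > 0" "\<And>s. \<bar>g s\<bar> \<le> D * (1 + \<bar>s\<bar>)" using damping_growth[OF g] by blast
  show ?thesis
  proof (intro exI conjI allI impI)
    show "0 \<le> B + D * (3 + 2 * \<bar>K\<bar>)" using B D by (simp add: add_nonneg_nonneg)
    fix a b assume b: "\<bar>b\<bar> \<le> K"
    show "\<bar>g a - g b\<bar> \<le> (B + D * (3 + 2 * \<bar>K\<bar>)) * \<bar>a - b\<bar>"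
    proof (cases "\<bar>a\<bar> \<le> K + 1")
      case True
      have "norm (g a - g b) \<le> B * norm (a - b)"
        by (rule field_differentiable_bound[of "{-K - 1..K + 1}" g g'])
           (use True b B g'(1) in \<open>auto intro: has_field_derivative_at_within simp: abs_le_iff\<close>)
      also have "\<dots> \<le> (B + D * (3 + 2 * \<bar>K\<bar>)) * norm (a - b)" using D by (intro mult_right_mono) auto
      finally show ?thesis by simp
    next
      case False
      then have 1: "\<bar>a - b\<bar> \<ge> 1" using b by linarith
      have K: "K \<ge> 0" using b by linarith
      have "\<bar>g a - g b\<bar> \<le> D * (1 + \<bar>a\<bar>) + D * (1 + \<bar>b\<bar>)" using D(2)[of a] D(2)[of b] by linarith
      also have "\<dots> = D * (2 + \<bar>a\<bar> + \<bar>b\<bar>)" by (simp add: algebra_simps)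
      also have "\<dots> \<le> D * ((3 + 2 * \<bar>K\<bar>) * \<bar>a - b\<bar>)"
      proof (intro mult_left_mono)
        have "K * 1 \<le> K * \<bar>a - b\<bar>" using K 1 by (intro mult_left_mono)
        then have "2 + 2 * K \<le> (2 + 2 * K) * \<bar>a - b\<bar>" using 1 by (simp add: distrib_right)
        then show "2 + \<bar>a\<bar> + \<bar>b\<bar> \<le> (3 + 2 * \<bar>K\<bar>) * \<bar>a - b\<bar>" 
          using b K abs_triangle_ineq2[of a b] unfolding distrib_right by simp
      qed (use D in simp)
      also have "\<dots> = D * (3 + 2 * \<bar>K\<bar>) * \<bar>a - b\<bar>" by simp
      also have "\<dots> \<le> (B + D * (3 + 2 * \<bar>K\<bar>)) * \<bar>a - b\<bar>" using B by (intro mult_right_mono) auto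
      finally show ?thesis .
    qed
  qed
qed

text \<open>Without a lower bound on the derivative of g at infinity, (g s - g t) (s - t) alone does not control
  large differences; those are absorbed by the two dissipation terms instead.\<close>
lemma damping_control:
  assumes g: "damping g" and \<delta>: "\<delta> > 0"
  shows "\<exists>C\<ge>0. \<forall>s t. (s - t)\<^sup>2 \<le> \<delta> + C * ((g s - g t) * (s - t) + g s * s + g t * t)"
proof -
  obtain m where m: "m > 0" "\<And>s. \<bar>s\<bar> > 1 \<Longrightarrow> m * s\<^sup>2 \<le> g s * s" using g unfolding damping_def by blast
  \<comment> \<open>On this compact set of pairs with separated entries, strict monotonicity gives
    the product of differences a positive minimum.\<close>
  define Q where "Q = {z \<in> {-1..1} \<times> {-1..1::real}. \<delta> \<le> (fst z - snd z)\<^sup>2}"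
  have Q: "compact Q"
  proof -
    have "closed {z::real \<times> real. \<delta> \<le> (fst z - snd z)\<^sup>2}" by (intro closed_Collect_le continuous_intros)
    then have "compact (({-1..1} \<times> {-1..1::real}) \<inter> {z. \<delta> \<le> (fst z - snd z)\<^sup>2})"
      by (intro compact_Int_closed compact_Times) auto
    moreover have "({-1..1} \<times> {-1..1::real}) \<inter> {z. \<delta> \<le> (fst z - snd z)\<^sup>2} = Q" by (auto simp: Q_def)
    ultimately show ?thesis by simp
  qed
  define q where "q z = (g (fst z) - g (snd z)) * (fst z - snd z)" for z
  have cq: "continuous_on Q q" unfolding q_def
    by (intro continuous_intros continuous_on_compose2[OF damping_cont[OF g, of UNIV]]) auto
  have qpos: "q z > 0" if "z \<in> Q" for z
    unfolding q_def by (rule damping_mono_strict[OF g]) (use that \<delta> in \<open>auto simp: Q_def\<close>)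
  have "\<exists>e>0. \<forall>z\<in>Q. e \<le> q z"
  proof (cases "Q = {}")
    case True then show ?thesis by (intro exI[of _ 1]) auto
  next
    case False
    then obtain z where "z \<in> Q" "\<And>y. y \<in> Q \<Longrightarrow> q z \<le> q y" using continuous_attains_inf[OF Q _ cq] by blast
    then show ?thesis using qpos by (intro exI[of _ "q z"]) auto
  qed
  then obtain e where e: "e > 0" "\<And>z. z \<in> Q \<Longrightarrow> e \<le> q z" by blast
  \<comment> \<open>If both arguments lie in [-1,1], (s - t)^2 is at most 4; otherwise it is at most
    4 r^2 with r the argument of larger modulus. The two summands serve these two cases.\<close>
  define C where "C = 4 / e + 4 / m"
  have C: "C \<ge> 0" "4 \<le> C * e" "4 \<le> C * m" using e(1) m(1) by (auto simp: C_def distrib_right)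
  show ?thesis
  proof (intro exI[of _ C] conjI allI C(1))
    fix s t
    have n: "0 \<le> (g s - g t) * (s - t)" "0 \<le> g s * s" "0 \<le> g t * t"
      using damping_mono[OF g, of s t] damping_mono[OF g, of s 0] damping_mono[OF g, of t 0] damping_0[OF g] by auto
    show "(s - t)\<^sup>2 \<le> \<delta> + C * ((g s - g t) * (s - t) + g s * s + g t * t)"
    proof (cases "\<bar>s\<bar> \<le> 1 \<and> \<bar>t\<bar> \<le> 1")
      case True
      show ?thesis
      proof (cases "(s - t)\<^sup>2 \<le> \<delta>")
        case True
        have "0 \<le> C * ((g s - g t) * (s - t) + g s * s + g t * t)" using C(1) n by (intro mult_nonneg_nonneg) auto
        then show ?thesis using True by linarith
      next
        case False
        then have "(s, t) \<in> Q" using \<open>\<bar>s\<bar> \<le> 1 \<and> \<bar>t\<bar> \<le> 1\<close> by (auto simp: Q_def)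
        from e(2)[OF this] have "e \<le> (g s - g t) * (s - t)" by (simp add: q_def)
        then have "C * e \<le> C * ((g s - g t) * (s - t) + g s * s + g t * t)" using C(1) n by (intro mult_left_mono) auto
        moreover have "(s - t)\<^sup>2 \<le> 2\<^sup>2"
          by (rule abs_le_square_iff[THEN iffD1]) (use \<open>\<bar>s\<bar> \<le> 1 \<and> \<bar>t\<bar> \<le> 1\<close> in linarith)
        ultimately show ?thesis using C(2) \<delta> by simp
      qed
    next
      case False
      define r where "r = (if \<bar>t\<bar> \<le> \<bar>s\<bar> then s else t)"
      have r: "\<bar>r\<bar> > 1" "\<bar>s\<bar> \<le> \<bar>r\<bar>" "\<bar>t\<bar> \<le> \<bar>r\<bar>" using False by (auto simp: r_def)
      have "(s - t)\<^sup>2 \<le> (2 * r)\<^sup>2" by (rule abs_le_square_iff[THEN iffD1]) (use r in linarith)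
      also have "\<dots> = 4 * r\<^sup>2" by (simp add: power_mult_distrib)
      also have "\<dots> \<le> (C * m) * r\<^sup>2" using C(3) by (intro mult_right_mono) auto
      also have "\<dots> \<le> C * (g r * r)" using m(2)[OF r(1)] C(1) by (simp add: mult.assoc mult_left_mono)
      also have "\<dots> \<le> C * ((g s - g t) * (s - t) + g s * s + g t * t)"
        using C(1) n by (intro mult_left_mono) (auto simp: r_def)
      finally show ?thesis using \<delta> by simp
    qed
  qed
qed

section \<open>The damping operator on L^2\<close>

lemma sqi_abs: "sqi f \<Longrightarrow> sqi (\<lambda>x. \<bar>f x\<bar>)"
  by (rule sqi_bound) (auto dest: sqi_measurable)

lemma norm_mk_abs: "sqi f \<Longrightarrow> norm (mk (\<lambda>x. \<bar>f x\<bar>)) = norm (mk f)"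
  by (rule antisym) (auto intro!: norm_mk_mono sqi_abs)

lemma norm_mk_le:
  assumes f: "sqi f" and p: "sqi p" and q: "sqi q" and ab: "a \<ge> 0" "b \<ge> 0"
    and le: "AE x in lebesgue. \<bar>f x\<bar> \<le> a * \<bar>p x\<bar> + b * \<bar>q x\<bar>"
  shows "norm (mk f) \<le> a * norm (mk p) + b * norm (mk q)"
proof -
  have s: "sqi (\<lambda>x. a * \<bar>p x\<bar>)" "sqi (\<lambda>x. b * \<bar>q x\<bar>)" by (intro sqi_cmult sqi_abs p q)+
  have "norm (mk f) \<le> norm (mk (\<lambda>x. a * \<bar>p x\<bar> + b * \<bar>q x\<bar>))"
    by (rule norm_mk_mono[OF f sqi_add[OF s]]) (use le in \<open>eventually_elim, simp\<close>)
  also have "mk (\<lambda>x. a * \<bar>p x\<bar> + b * \<bar>q x\<bar>) = a *\<^sub>R mk (\<lambda>x. \<bar>p x\<bar>) + b *\<^sub>R mk (\<lambda>x. \<bar>q x\<bar>)"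
    by (simp add: mk_add[OF s] mk_scale[OF sqi_abs[OF p]] mk_scale[OF sqi_abs[OF q]])
  also have "norm \<dots> \<le> a * norm (mk p) + b * norm (mk q)"
    using norm_triangle_ineq[of "a *\<^sub>R mk (\<lambda>x. \<bar>p x\<bar>)" "b *\<^sub>R mk (\<lambda>x. \<bar>q x\<bar>)"] ab
    by (simp add: norm_mk_abs p q)
  finally show ?thesis .
qed

definition Nem :: "real \<Rightarrow> (real \<Rightarrow> real) \<Rightarrow> l2 \<Rightarrow> l2" where
  "Nem L g v = mk (\<lambda>x. indicator {0..L} x * g (fn v x))"

context
  fixes L :: real and g assumes g: "damping g"
begin

lemma Nem_sqi: "sqi (\<lambda>x. indicator {0..L} x * g (fn v x))"
proof -
  obtain C where C: "C > 0" "\<And>s. \<bar>g s\<bar> \<le> C * (1 + \<bar>s\<bar>)" using damping_growth[OF g] by blast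
  have m: "(\<lambda>x. g (fn v x)) \<in> borel_measurable lebesgue"
    using measurable_compose[OF fn_measurable borel_measurable_continuous_onI[OF damping_cont[OF g]]] .
  have s: "sqi (\<lambda>x. C * (indicator {0..L} x + \<bar>fn v x\<bar>))" by (intro sqi_cmult sqi_add sqi_abs fn_sqi sqi_indicator)
  show ?thesis
  proof (rule sqi_bound[OF s])
    show "(\<lambda>x. indicator {0..L} x * g (fn v x)) \<in> borel_measurable lebesgue"
      by (intro borel_measurable_times m borel_measurable_indicator) simp
    show "AE x in lebesgue. \<bar>indicator {0..L} x * g (fn v x)\<bar> \<le> \<bar>C * (indicator {0..L} x + \<bar>fn v x\<bar>)\<bar>"
    proof (rule AE_I2)
      fix x show "\<bar>indicator {0..L} x * g (fn v x)\<bar> \<le> \<bar>C * (indicator {0..L} x + \<bar>fn v x\<bar>)\<bar>"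
        using C(1) order_trans[OF C(2)[of "fn v x"] abs_ge_self] by (cases "x \<in> {0..L}") auto
    qed
  qed
qed

lemma Nem_fn: "AE x in lebesgue. fn (Nem L g v) x = indicator {0..L} x * g (fn v x)"
  unfolding Nem_def by (rule fn_mk[OF Nem_sqi])

lemma Nem_inner: "inner (Nem L g v) w = (LINT x|lebesgue. (indicator {0..L} x * g (fn v x)) * fn w x)"
  unfolding Nem_def by (rule inner_mk[OF Nem_sqi])

lemma Nem_integrable: "integrable lebesgue (\<lambda>x. (indicator {0..L} x * g (fn v x)) * fn w x)"
  by (rule sqi_mult_integrable[OF Nem_sqi fn_sqi])

lemma Nem_inner_diff: "inner (Nem L g v - Nem L g w) (v - w) =
    (LINT x|lebesgue. indicator {0..L} x * ((g (fn v x) - g (fn w x)) * (fn v x - fn w x)))"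
proof -
  have "inner (Nem L g v - Nem L g w) (v - w) = inner (Nem L g v) v - inner (Nem L g v) w - (inner (Nem L g w) v - inner (Nem L g w) w)"
    by (simp add: inner_diff_left inner_diff_right)
  also have "\<dots> = (LINT x|lebesgue. ((indicator {0..L} x * g (fn v x)) * fn v x - (indicator {0..L} x * g (fn v x)) * fn w x) -
      ((indicator {0..L} x * g (fn w x)) * fn v x - (indicator {0..L} x * g (fn w x)) * fn w x))"
    unfolding Nem_inner
    by (simp only: Bochner_Integration.integral_diff Bochner_Integration.integrable_diff Nem_integrable)
  finally show ?thesis by (simp add: algebra_simps)
qed

lemma Nem_mono: "0 \<le> inner (Nem L g v - Nem L g w) (v - w)"
  unfolding Nem_inner_diff
  by (rule integral_nonneg_AE, rule AE_I2) (simp add: damping_mono[OF g])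

lemma Nem_0: "Nem L g 0 = 0"
  by (rule l2_eqI) (use Nem_fn[of 0] fn_zero in \<open>eventually_elim, simp add: damping_0[OF g]\<close>)

text \<open>A nonnegative integrand with zero integral vanishes almost everywhere, and s g(s) = 0
  only for s = 0.\<close>

lemma Nem_pos:
  assumes v: "v \<in> H0 L" and z: "inner (Nem L g v) v = 0" shows "v = 0"
proof -
  have nn: "0 \<le> g s * s" for s using damping_mono[OF g, of s 0] damping_0[OF g] by simp
  have "AE x in lebesgue. (indicator {0..L} x * g (fn v x)) * fn v x = 0"
    using z unfolding Nem_inner
    by (subst (asm) integral_nonneg_eq_0_iff_AE[OF Nem_integrable]) (auto intro!: AE_I2 simp: mult.assoc nn)
  moreover have "AE x in lebesgue. x \<notin> {0..L} \<longrightarrow> fn v x = 0" using v by (simp add: H0_def)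
  ultimately have "AE x in lebesgue. fn v x = fn 0 x" using fn_zero
  proof eventually_elim
    case (elim x)
    show ?case
    proof (rule ccontr)
      assume "fn v x \<noteq> fn 0 x"
      then have "fn v x \<noteq> 0" "x \<in> {0..L}" using elim by auto
      then have "g (fn v x) * fn v x > 0"
        using damping_mono_strict[OF g, of "fn v x" 0] damping_0[OF g] by simp
      then show False using elim(1) \<open>x \<in> {0..L}\<close> by auto
    qed
  qed
  then show ?thesis by (rule l2_eqI)
qed

lemma Nem_bdd: "\<exists>C. \<forall>v. norm v \<le> R \<longrightarrow> norm (Nem L g v) \<le> C"
proof -
  obtain C where C: "C > 0" "\<And>s. \<bar>g s\<bar> \<le> C * (1 + \<bar>s\<bar>)" using damping_growth[OF g] by blast
  show ?thesis
  proof (intro exI allI impI)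
    fix v :: l2 assume v: "norm v \<le> R"
    have "norm (Nem L g v) \<le> C * norm (mk (indicator {0..L})) + C * norm (mk (fn v))"
      unfolding Nem_def
    proof (rule norm_mk_le[OF Nem_sqi sqi_indicator(1) fn_sqi])
      show "AE x in lebesgue. \<bar>indicator {0..L} x * g (fn v x)\<bar> \<le> C * \<bar>indicator {0..L} x\<bar> + C * \<bar>fn v x\<bar>"
      proof (rule AE_I2)
        fix x show "\<bar>indicator {0..L} x * g (fn v x)\<bar> \<le> C * \<bar>indicator {0..L} x\<bar> + C * \<bar>fn v x\<bar>"
          using C(2)[of "fn v x"] C(1) by (cases "x \<in> {0..L}") (auto simp: distrib_left)
      qed
    qed (use C in auto)
    also have "\<dots> \<le> C * norm (mk (indicator {0..L})) + C * R" using v C by (intro add_left_mono mult_left_mono) auto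
    finally show "norm (Nem L g v) \<le> C * norm (mk (indicator {0..L})) + C * R" .
  qed
qed

text \<open>\<open>damping_control\<close> with \<delta>/L, integrated over an interval of length
  L.\<close>

lemma Nem_control:
  assumes L: "L > 0" and \<delta>: "\<delta> > 0"
  shows "\<exists>C\<ge>0. \<forall>v\<in>H0 L. \<forall>w\<in>H0 L. (norm (v - w))\<^sup>2 \<le>
    \<delta> + C * (inner (Nem L g v - Nem L g w) (v - w) + inner (Nem L g v) v + inner (Nem L g w) w)"
proof -
  have "\<delta> / L > 0" using L \<delta> by simp
  from damping_control[OF g this] obtain C where C: "C \<ge> 0"
    "\<And>s t. (s - t)\<^sup>2 \<le> \<delta> / L + C * ((g s - g t) * (s - t) + g s * s + g t * t)" by blast
  show ?thesis
  proof (intro exI[of _ C] conjI ballI C(1))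
    fix v w assume v: "v \<in> H0 L" and w: "w \<in> H0 L"
    define D where "D x = indicator {0..L} x * ((g (fn v x) - g (fn w x)) * (fn v x - fn w x))" for x
    define Dv where "Dv x = (indicator {0..L} x * g (fn v x)) * fn v x" for x
    define Dw where "Dw x = (indicator {0..L} x * g (fn w x)) * fn w x" for x
    have i: "integrable lebesgue Dv" "integrable lebesgue Dw" unfolding Dv_def Dw_def by (rule Nem_integrable)+
    have iD: "integrable lebesgue D"
    proof -
      have "D = (\<lambda>x. ((indicator {0..L} x * g (fn v x)) * fn v x - (indicator {0..L} x * g (fn v x)) * fn w x) -
          ((indicator {0..L} x * g (fn w x)) * fn v x - (indicator {0..L} x * g (fn w x)) * fn w x))"
        by (auto simp: D_def fun_eq_iff algebra_simps)
      then show ?thesis by (simp only: Bochner_Integration.integrable_diff Nem_integrable)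
    qed
    have ii: "integrable lebesgue (indicator {0..L} :: real \<Rightarrow> real)"
      by (rule integrable_real_indicator) (auto simp: emeasure_lborel_Icc_eq)
    have "(norm (v - w))\<^sup>2 = (LINT x|lebesgue. (fn v x - fn w x)\<^sup>2)" by (simp add: fn_diff_sq dist_norm)
    also have "\<dots> \<le> (LINT x|lebesgue. \<delta> / L * indicator {0..L} x + C * (D x + Dv x + Dw x))"
    proof (rule integral_mono_AE)
      show "integrable lebesgue (\<lambda>x. (fn v x - fn w x)\<^sup>2)" using sqi_diff[OF fn_sqi fn_sqi, of v w] by (simp add: sqi_def)
      show "integrable lebesgue (\<lambda>x. \<delta> / L * indicator {0..L} x + C * (D x + Dv x + Dw x))"
        using i iD ii by auto
      have "AE x in lebesgue. x \<notin> {0..L} \<longrightarrow> fn v x = 0" "AE x in lebesgue. x \<notin> {0..L} \<longrightarrow> fn w x = 0"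
        using v w by (simp_all add: H0_def)
      then show "AE x in lebesgue. (fn v x - fn w x)\<^sup>2 \<le> \<delta> / L * indicator {0..L} x + C * (D x + Dv x + Dw x)"
      proof eventually_elim
        case (elim x)
        show ?case
        proof (cases "x \<in> {0..L}")
          case True
          then show ?thesis using C(2)[of "fn v x" "fn w x"] by (simp add: D_def Dv_def Dw_def)
        next
          case False
          then show ?thesis using elim by (simp add: D_def Dv_def Dw_def)
        qed
      qed
    qed
    also have "\<dots> = \<delta> / L * (LINT x|lebesgue. indicator {0..L} x) + C * ((LINT x|lebesgue. D x) + (LINT x|lebesgue. Dv x) + (LINT x|lebesgue. Dw x))"
      using i iD ii by simp
    also have "(LINT x|lebesgue. indicator {0..L} x) = L" using L by simp
    finally show "(norm (v - w))\<^sup>2 \<le> \<delta> + C * (inner (Nem L g v - Nem L g w) (v - w) + inner (Nem L g v) v + inner (Nem L g w) w)"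
      using L by (simp add: Nem_inner_diff Nem_inner D_def Dv_def Dw_def)
  qed
qed

text \<open>The interval is split by the size of v. Where |v| is at most n', a Lipschitz bound holds
  whatever the value of w; elsewhere linear growth leaves a multiple of the tail of v, whose norm is
  small for large n' by dominated convergence.\<close>

lemma Nem_cont: "continuous_on T (Nem L g)"
proof (rule continuous_on_subset[OF _ subset_UNIV], unfold continuous_on_iff, intro ballI allI impI)
  fix v :: l2 and e :: real assume e: "e > 0"
  obtain C where C: "C > 0" "\<And>s. \<bar>g s\<bar> \<le> C * (1 + \<bar>s\<bar>)" using damping_growth[OF g] by blast
  define t where "t n x = (if \<bar>fn v x\<bar> > real n then fn v x else 0)" for n x
  have tm: "t n \<in> borel_measurable lebesgue" for n unfolding t_def[abs_def] by measurable
  have ts: "sqi (t n)" for n by (rule sqi_bound[OF fn_sqi tm]) (auto simp: t_def)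
  have "(\<lambda>n. LINT x|lebesgue. (t n x)\<^sup>2) \<longlonglongrightarrow> (LINT x|(lebesgue :: real measure). 0)"
  proof (rule integral_dominated_convergence[where w = "\<lambda>x. (fn v x)\<^sup>2"])
    show "integrable lebesgue (\<lambda>x. (fn v x)\<^sup>2)" using fn_sqi[of v] by (simp add: sqi_def)
    show "AE x in lebesgue. norm ((t n x)\<^sup>2) \<le> (fn v x)\<^sup>2" for n by (auto simp: t_def)
    show "AE x in lebesgue. (\<lambda>n. (t n x)\<^sup>2) \<longlonglongrightarrow> 0"
    proof (rule AE_I2, rule tendsto_eventually)
      fix x
      obtain N where "\<bar>fn v x\<bar> \<le> real N" using real_arch_simple by blast
      then show "\<forall>\<^sub>F n in sequentially. (t n x)\<^sup>2 = 0"
        unfolding eventually_sequentially t_def by (intro exI[of _ N]) auto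
    qed
  qed (use tm in auto)
  then have "(\<lambda>n. norm (mk (t n))) \<longlonglongrightarrow> 0"
    using tendsto_real_sqrt[of "\<lambda>n. LINT x|lebesgue. (t n x)\<^sup>2" 0] norm_mk[OF ts, symmetric] by simp
  from LIMSEQ_D[OF this, of "e / (8 * C)"] e C(1) obtain n where n0: "norm (mk (t n)) < e / (8 * C)" by fastforce
  \<comment> \<open>Adding 1 ensures |v| > 1 on the tail, so that additive constants there are
    absorbed by |v|.\<close>
  define n' where "n' = n + 1"
  have n: "norm (mk (t n')) < e / (8 * C)"
    by (rule le_less_trans[OF norm_mk_mono[OF ts ts] n0]) (auto simp: t_def n'_def)
  obtain C1 where C1: "C1 \<ge> 0" "\<And>a b. \<bar>b\<bar> \<le> real n' \<Longrightarrow> \<bar>g a - g b\<bar> \<le> C1 * \<bar>a - b\<bar>"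
    using damping_lipschitz[OF g, of "real n'"] by blast
  have est: "norm (Nem L g w - Nem L g v) \<le> (C1 + C) * norm (w - v) + (4 * C) * norm (mk (t n'))" for w
  proof -
    have "Nem L g w - Nem L g v = mk (\<lambda>x. indicator {0..L} x * g (fn w x) - indicator {0..L} x * g (fn v x))"
      unfolding Nem_def by (simp add: mk_diff Nem_sqi)
    also have "norm \<dots> \<le> (C1 + C) * norm (mk (\<lambda>x. fn w x - fn v x)) + (4 * C) * norm (mk (t n'))"
    proof (rule norm_mk_le)
      show "AE x in lebesgue. \<bar>indicator {0..L} x * g (fn w x) - indicator {0..L} x * g (fn v x)\<bar>
          \<le> (C1 + C) * \<bar>fn w x - fn v x\<bar> + 4 * C * \<bar>t n' x\<bar>"
      proof (rule AE_I2)
        fix x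
        have "\<bar>g (fn w x) - g (fn v x)\<bar> \<le> (C1 + C) * \<bar>fn w x - fn v x\<bar> + 4 * C * \<bar>t n' x\<bar>"
        proof (cases "\<bar>fn v x\<bar> \<le> real n'")
          case True
          have "\<bar>g (fn w x) - g (fn v x)\<bar> \<le> C1 * \<bar>fn w x - fn v x\<bar>" by (rule C1(2)[OF True])
          also have "\<dots> \<le> (C1 + C) * \<bar>fn w x - fn v x\<bar>" using C(1) by (intro mult_right_mono) auto
          also have "\<dots> \<le> (C1 + C) * \<bar>fn w x - fn v x\<bar> + 4 * C * \<bar>t n' x\<bar>" using C(1) by simp
          finally show ?thesis .
        next
          case False
          then have v1: "\<bar>fn v x\<bar> > 1" "t n' x = fn v x" by (auto simp: n'_def t_def)
          have "\<bar>g (fn w x) - g (fn v x)\<bar> \<le> C * (1 + \<bar>fn w x\<bar>) + C * (1 + \<bar>fn v x\<bar>)"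
            using C(2)[of "fn w x"] C(2)[of "fn v x"] by linarith
          also have "\<dots> = C * (2 + \<bar>fn w x\<bar> + \<bar>fn v x\<bar>)" by (simp add: algebra_simps)
          also have "\<dots> \<le> C * (\<bar>fn w x - fn v x\<bar> + 4 * \<bar>fn v x\<bar>)" using C(1) v1 by (intro mult_left_mono) auto
          also have "\<dots> = C * \<bar>fn w x - fn v x\<bar> + 4 * C * \<bar>t n' x\<bar>" using v1 by (simp add: distrib_left)
          also have "\<dots> \<le> (C1 + C) * \<bar>fn w x - fn v x\<bar> + 4 * C * \<bar>t n' x\<bar>"
            using C1(1) by (intro add_right_mono mult_right_mono) auto
          finally show ?thesis .
        qed
        moreover have "\<bar>indicator {0..L} x * g (fn w x) - indicator {0..L} x * g (fn v x)\<bar> \<le> \<bar>g (fn w x) - g (fn v x)\<bar>"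
          by (simp add: indicator_def)
        ultimately show "\<bar>indicator {0..L} x * g (fn w x) - indicator {0..L} x * g (fn v x)\<bar>
          \<le> (C1 + C) * \<bar>fn w x - fn v x\<bar> + 4 * C * \<bar>t n' x\<bar>" by linarith
      qed
    qed (use C C1 ts in \<open>auto intro!: sqi_diff Nem_sqi\<close>)
    also have "mk (\<lambda>x. fn w x - fn v x) = w - v" by (simp add: mk_diff)
    finally show ?thesis .
  qed
  have e8: "(4 * C) * norm (mk (t n')) < e / 2" using n C(1) by (simp add: field_simps)
  have CC: "C1 + C > 0" using C(1) C1(1) by simp
  show "\<exists>d>0. \<forall>w\<in>UNIV. dist w v < d \<longrightarrow> dist (Nem L g w) (Nem L g v) < e"
  proof (intro exI conjI ballI impI)
    show "e / (2 * (C1 + C)) > 0" using e CC by simp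
    fix w assume "dist w v < e / (2 * (C1 + C))"
    then have "(C1 + C) * norm (w - v) < e / 2" using CC by (simp add: dist_norm field_simps)
    then show "dist (Nem L g w) (Nem L g v) < e" using est[of w] e8 by (simp add: dist_norm)
  qed
qed

end

section \<open>Restoring forces and their potential\<close>

lemma norm_triple:
  fixes u :: "'a::real_inner \<times> 'b::real_inner \<times> 'c::real_inner"
  shows "(norm u)\<^sup>2 = (norm (fst u))\<^sup>2 + (norm (fst (snd u)))\<^sup>2 + (norm (snd (snd u)))\<^sup>2"
  by (simp add: power2_norm_eq_inner inner_prod_def add.assoc)

lemma norm_triple_le:
  fixes u :: "'a::real_inner \<times> 'b::real_inner \<times> 'c::real_inner"
  shows "norm u \<le> norm (fst u) + norm (fst (snd u)) + norm (snd (snd u))"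
proof (rule power2_le_imp_le)
  show "(norm u)\<^sup>2 \<le> (norm (fst u) + norm (fst (snd u)) + norm (snd (snd u)))\<^sup>2"
    unfolding norm_triple by (simp add: power2_eq_square algebra_simps)
qed simp

lemma norm_component_le:
  fixes u :: "'a::real_inner \<times> 'b::real_inner \<times> 'c::real_inner"
  shows "norm (fst u) \<le> norm u" "norm (fst (snd u)) \<le> norm u" "norm (snd (snd u)) \<le> norm u"
proof -
  have sq: "(norm (fst u))\<^sup>2 \<le> (norm u)\<^sup>2" "(norm (fst (snd u)))\<^sup>2 \<le> (norm u)\<^sup>2" "(norm (snd (snd u)))\<^sup>2 \<le> (norm u)\<^sup>2"
    by (simp_all add: norm_triple)
  show "norm (fst u) \<le> norm u" "norm (fst (snd u)) \<le> norm u" "norm (snd (snd u)) \<le> norm u"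
    by (rule power2_le_imp_le[OF sq(1) norm_ge_zero], rule power2_le_imp_le[OF sq(2) norm_ge_zero],
        rule power2_le_imp_le[OF sq(3) norm_ge_zero])
qed

text \<open>The displacement (phi, psi, w) at the point x when u holds its derivatives.\<close>

definition pt :: "l2 \<times> l2 \<times> l2 \<Rightarrow> real \<Rightarrow> real \<times> real \<times> real" where
  "pt u x = (Int0 (fst u) x, Int0 (fst (snd u)) x, Int0 (snd (snd u)) x)"

definition J3 :: "real \<Rightarrow> l2 \<times> l2 \<times> l2 \<Rightarrow> l2 \<times> l2 \<times> l2" where
  "J3 L u = (Jop L (fst u), Jop L (fst (snd u)), Jop L (snd (snd u)))"

lemma pt_diff: "pt (u - w) x = pt u x - pt w x"
  by (simp add: pt_def Int0_diff)

lemma pt_cont: "continuous_on {0..L} (pt u)"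
  unfolding pt_def by (intro continuous_on_Pair Int0_cont)

lemma norm_pt_le:
  assumes "0 \<le> x" shows "norm (pt u x) \<le> norm u * sqrt x"
proof (rule power2_le_imp_le)
  have sq: "(Int0 g x)\<^sup>2 \<le> (norm g)\<^sup>2 * x" for g
  proof -
    have "(Int0 g x)\<^sup>2 \<le> (norm g * sqrt x)\<^sup>2"
      by (rule abs_le_square_iff[THEN iffD1]) (use Int0_bound[OF assms, of g] assms in simp)
    then show ?thesis using assms by (simp add: power_mult_distrib)
  qed
  show "(norm (pt u x))\<^sup>2 \<le> (norm u * sqrt x)\<^sup>2"
    using sq[of "fst u"] sq[of "fst (snd u)"] sq[of "snd (snd u)"] assms
    by (simp add: norm_triple pt_def power_mult_distrib distrib_right)
qed (use assms in simp)

lemma J3_bounded_linear: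
  assumes "L \<ge> 0" shows "bounded_linear (J3 L)"
  unfolding J3_def[abs_def]
  by (intro bounded_linear_Pair bounded_linear_compose[OF Jop_bounded_linear[OF assms]]
      bounded_linear_compose[OF bounded_linear_fst] bounded_linear_compose[OF bounded_linear_snd]
      bounded_linear_fst bounded_linear_snd)

lemma J3_diff: "L \<ge> 0 \<Longrightarrow> J3 L (u - w) = J3 L u - J3 L w"
  using linear_diff[OF bounded_linear.linear[OF J3_bounded_linear]] .

lemma set_integrable_cont: "continuous_on {0..L} h \<Longrightarrow> set_integrable lebesgue {0..L} (h :: real \<Rightarrow> real)"
  by (rule absolutely_integrable_continuous_real)

lemma norm_mkc_pt: "norm (mkc L (\<lambda>x. norm (pt u x))) = norm (J3 L u)"
proof (rule power2_eq_imp_eq)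
  have c: "continuous_on {0..L} (\<lambda>x. Int0 g x * Int0 g x)" for g by (intro continuous_intros Int0_cont)
  have n: "(norm (Jop L g))\<^sup>2 = (LINT x:{0..L}|lebesgue. Int0 g x * Int0 g x)" for g
    unfolding power2_norm_eq_inner Jop_def by (rule mkc_inner[OF Int0_cont Int0_cont])
  have "(norm (mkc L (\<lambda>x. norm (pt u x))))\<^sup>2 = (LINT x:{0..L}|lebesgue. norm (pt u x) * norm (pt u x))"
    unfolding power2_norm_eq_inner by (rule mkc_inner) (intro continuous_intros pt_cont)+
  also have "\<dots> = (LINT x:{0..L}|lebesgue. Int0 (fst u) x * Int0 (fst u) x + Int0 (fst (snd u)) x * Int0 (fst (snd u)) x +
      Int0 (snd (snd u)) x * Int0 (snd (snd u)) x)"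
    using norm_triple[of "pt u _"] by (simp add: pt_def power2_eq_square)
  also have "\<dots> = (norm (J3 L u))\<^sup>2"
    unfolding norm_triple J3_def fst_conv snd_conv n
    by (simp only: set_integral_add set_integrable_cont[OF c])
  finally show "(norm (mkc L (\<lambda>x. norm (pt u x))))\<^sup>2 = (norm (J3 L u))\<^sup>2" .
qed auto

lemma mkc_scale: "continuous_on {0..L} h \<Longrightarrow> mkc L (\<lambda>x. c * h x) = c *\<^sub>R mkc L h"
  unfolding mkc_def using mk_scale[OF sqi_continuous, of 0 L h c] by (simp add: mult_ac)

definition fN :: "real \<Rightarrow> (real \<times> real \<times> real \<Rightarrow> real) \<Rightarrow> l2 \<times> l2 \<times> l2 \<Rightarrow> l2" where
  "fN L f u = mkc L (\<lambda>x. f (pt u x))"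

definition PhiN :: "real \<Rightarrow> (real \<times> real \<times> real \<Rightarrow> real) \<Rightarrow> l2 \<times> l2 \<times> l2 \<Rightarrow> real" where
  "PhiN L F u = (LINT x:{0..L}|lebesgue. F (pt u x))"

lemma C1_lipschitz_ball:
  fixes f :: "'a::euclidean_space \<Rightarrow> real"
  assumes "\<And>z. (f has_derivative (\<lambda>h. Df z \<bullet> h)) (at z)" "continuous_on UNIV Df"
  shows "\<exists>C\<ge>0. \<forall>a b. norm a \<le> R \<longrightarrow> norm b \<le> R \<longrightarrow> \<bar>f a - f b\<bar> \<le> C * norm (a - b)"
proof -
  have "bounded (Df ` cball 0 R)"
    by (intro compact_imp_bounded compact_continuous_image continuous_on_subset[OF assms(2)]) auto
  then obtain C where C: "C > 0" "\<And>z. norm z \<le> R \<Longrightarrow> norm (Df z) \<le> C" unfolding bounded_pos by auto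
  show ?thesis
  proof (intro exI[of _ C] conjI allI impI)
    fix a b :: 'a assume ab: "norm a \<le> R" "norm b \<le> R"
    have "norm (f a - f b) \<le> C * norm (a - b)"
    proof (rule differentiable_bound[where S = "cball 0 R" and f' = "\<lambda>z h. Df z \<bullet> h"])
      fix z :: 'a assume z: "z \<in> cball 0 R"
      show "(f has_derivative (\<lambda>h. Df z \<bullet> h)) (at z within cball 0 R)" by (rule has_derivative_at_withinI[OF assms(1)])
      show "onorm (\<lambda>h. Df z \<bullet> h) \<le> C"
      proof (rule onorm_le)
        fix h
        have "norm (Df z \<bullet> h) \<le> norm (Df z) * norm h" using Cauchy_Schwarz_ineq2[of "Df z" h] by simp
        also have "\<dots> \<le> C * norm h" using C(2)[of z] z by (intro mult_right_mono) auto
        finally show "norm (Df z \<bullet> h) \<le> C * norm h" .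
      qed
    qed (use ab in auto)
    then show "\<bar>f a - f b\<bar> \<le> C * norm (a - b)" by simp
  qed (use C in simp)
qed

lemma pt_bound:
  assumes "x \<in> {0..L}" "norm u \<le> R" shows "norm (pt u x) \<le> R * sqrt L"
proof -
  have "norm (pt u x) \<le> norm u * sqrt x" using assms by (intro norm_pt_le) auto
  also have "\<dots> \<le> R * sqrt L" using assms order_trans[OF norm_ge_zero assms(2)] by (intro mult_mono) auto
  finally show ?thesis .
qed

lemma fN_cont: "continuous_on UNIV f \<Longrightarrow> continuous_on {0..L} (\<lambda>x. f (pt u x))"
  by (rule continuous_on_compose2[OF _ pt_cont]) auto

text \<open>In one dimension the H^1_0 bound R bounds displacements pointwise by R sqrt L, so f is
  evaluated on a fixed ball and its Lipschitz constant there can be used. The pointwise estimate is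
  then integrated in L^2.\<close>

lemma fN_lipschitz:
  fixes f :: "real \<times> real \<times> real \<Rightarrow> real"
  assumes L: "L \<ge> 0" and f: "\<And>z. (f has_derivative (\<lambda>h. Df z \<bullet> h)) (at z)" "continuous_on UNIV Df"
  shows "\<exists>C\<ge>0. \<forall>u w. norm u \<le> R \<longrightarrow> norm w \<le> R \<longrightarrow> norm (fN L f u - fN L f w) \<le> C * norm (J3 L u - J3 L w)"
proof -
  have cf: "continuous_on UNIV f"
    by (rule has_derivative_continuous_on[OF f(1)])
  obtain C where C: "C \<ge> 0" "\<And>a b. norm a \<le> R * sqrt L \<Longrightarrow> norm b \<le> R * sqrt L \<Longrightarrow> \<bar>f a - f b\<bar> \<le> C * norm (a - b)"
    using C1_lipschitz_ball[OF f] by blast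
  show ?thesis
  proof (intro exI[of _ C] conjI allI impI C(1))
    fix u w :: "l2 \<times> l2 \<times> l2" assume b: "norm u \<le> R" "norm w \<le> R"
    have "fN L f u - fN L f w = mkc L (\<lambda>x. f (pt u x) - f (pt w x))"
      unfolding fN_def by (intro mkc_diff fN_cont cf)
    also have "norm \<dots> \<le> norm (mkc L (\<lambda>x. C * norm (pt (u - w) x)))"
    proof (rule mkc_norm_mono)
      fix x assume x: "x \<in> {0..L}"
      show "\<bar>f (pt u x) - f (pt w x)\<bar> \<le> \<bar>C * norm (pt (u - w) x)\<bar>"
        using C(2)[OF pt_bound[OF x b(1)] pt_bound[OF x b(2)]] C(1) by (simp add: pt_diff)
    qed (intro continuous_intros fN_cont cf pt_cont)+
    also have "\<dots> = C * norm (J3 L (u - w))"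
      using C(1) by (subst mkc_scale) (auto intro!: continuous_intros pt_cont simp: norm_mkc_pt)
    finally show "norm (fN L f u - fN L f w) \<le> C * norm (J3 L u - J3 L w)" by (simp add: J3_diff[OF L])
  qed
qed

text \<open>Mean value inequality on the segment for F minus its differential at b: the derivative
  is a difference of gradients, at most \<open>C1 + C2 + C3\<close> times |a - b|.\<close>

lemma taylor_ball:
  fixes F :: "real \<times> real \<times> real \<Rightarrow> real"
  assumes F: "\<And>z. (F has_derivative (\<lambda>h. f1 z * fst h + f2 z * fst (snd h) + f3 z * snd (snd h))) (at z)"
    and l1: "\<And>a b. norm a \<le> R \<Longrightarrow> norm b \<le> R \<Longrightarrow> \<bar>f1 a - f1 b\<bar> \<le> C1 * norm (a - b)" "C1 \<ge> 0"
    and l2: "\<And>a b. norm a \<le> R \<Longrightarrow> norm b \<le> R \<Longrightarrow> \<bar>f2 a - f2 b\<bar> \<le> C2 * norm (a - b)" "C2 \<ge> 0"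
    and l3: "\<And>a b. norm a \<le> R \<Longrightarrow> norm b \<le> R \<Longrightarrow> \<bar>f3 a - f3 b\<bar> \<le> C3 * norm (a - b)" "C3 \<ge> 0"
    and ab: "norm a \<le> R" "norm b \<le> R"
  shows "\<bar>F a - F b - (f1 b * fst (a - b) + f2 b * fst (snd (a - b)) + f3 b * snd (snd (a - b)))\<bar>
    \<le> (C1 + C2 + C3) * (norm (a - b))\<^sup>2"
proof -
  define G where "G z h = f1 z * fst h + f2 z * fst (snd h) + f3 z * snd (snd h)" for z h :: "real \<times> real \<times> real"
  have Gl: "bounded_linear (G z)" for z
    using has_derivative_bounded_linear[OF F[of z]] by (simp add: G_def[abs_def])
  define C where "C = C1 + C2 + C3"
  have "norm ((F a - G b a) - (F b - G b b)) \<le> (C * norm (a - b)) * norm (a - b)"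
  proof (rule differentiable_bound[where S = "closed_segment b a" and f = "\<lambda>z. F z - G b z" and f' = "\<lambda>z h. G z h - G b h"])
    fix z assume z: "z \<in> closed_segment b a"
    have "((\<lambda>z. F z - G b z) has_derivative (\<lambda>h. G z h - G b h)) (at z)"
      using F[of z] by (intro has_derivative_diff bounded_linear_imp_has_derivative Gl) (simp add: G_def[abs_def])
    then show "((\<lambda>z. F z - G b z) has_derivative (\<lambda>h. G z h - G b h)) (at z within closed_segment b a)"
      by (rule has_derivative_at_withinI)
    have zR: "norm z \<le> R"
      using subsetD[OF closed_segment_subset[of b "cball 0 R" a] z] ab by simp
    have zb: "norm (z - b) \<le> norm (a - b)"
      using segment_bound(1)[OF z] by (simp add: norm_minus_commute)
    show "onorm (\<lambda>h. G z h - G b h) \<le> C * norm (a - b)"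
    proof (rule onorm_le)
      fix h :: "real \<times> real \<times> real"
      have m: "\<bar>(p - q) * r\<bar> \<le> (K * norm (a - b)) * norm h" if "\<bar>p - q\<bar> \<le> K * norm (z - b)" "K \<ge> 0" "\<bar>r\<bar> \<le> norm h" for p q r K
      proof -
        have "\<bar>p - q\<bar> \<le> K * norm (a - b)" using that zb by (meson mult_left_mono order_trans)
        then show ?thesis unfolding abs_mult using that by (intro mult_mono) auto
      qed
      have "G z h - G b h = (f1 z - f1 b) * fst h + (f2 z - f2 b) * fst (snd h) + (f3 z - f3 b) * snd (snd h)"
        by (simp add: G_def algebra_simps)
      then have "norm (G z h - G b h) \<le> \<bar>(f1 z - f1 b) * fst h\<bar> + \<bar>(f2 z - f2 b) * fst (snd h)\<bar> + \<bar>(f3 z - f3 b) * snd (snd h)\<bar>"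
        by simp
      also have "\<dots> \<le> (C1 * norm (a - b)) * norm h + (C2 * norm (a - b)) * norm h + (C3 * norm (a - b)) * norm h"
        using norm_component_le[of h] by (intro add_mono m l1 l2 l3 zR ab) auto
      also have "\<dots> = C * norm (a - b) * norm h" by (simp add: C_def algebra_simps)
      finally show "norm (G z h - G b h) \<le> C * norm (a - b) * norm h" .
    qed
  qed auto
  moreover have "(F a - G b a) - (F b - G b b) = F a - F b - G b (a - b)"
    using linear_diff[OF bounded_linear.linear[OF Gl], of b a b] by simp
  ultimately show ?thesis by (simp add: G_def C_def power2_eq_square mult.assoc)
qed

text \<open>The pointwise Taylor estimate integrated over [0,L], with all arguments again in a fixed
  ball.\<close>

lemma PhiN_taylor:
  assumes L: "L \<ge> 0"
    and F: "\<And>z. (F has_derivative (\<lambda>h. f1 z * fst h + f2 z * fst (snd h) + f3 z * snd (snd h))) (at z)"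
    and f1: "\<And>z. (f1 has_derivative (\<lambda>h. D1 z \<bullet> h)) (at z)" "continuous_on UNIV D1"
    and f2: "\<And>z. (f2 has_derivative (\<lambda>h. D2 z \<bullet> h)) (at z)" "continuous_on UNIV D2"
    and f3: "\<And>z. (f3 has_derivative (\<lambda>h. D3 z \<bullet> h)) (at z)" "continuous_on UNIV D3"
  shows "\<exists>C. \<forall>u w. norm u \<le> R \<longrightarrow> norm w \<le> R \<longrightarrow>
    \<bar>PhiN L F u - PhiN L F w - inner (fN L f1 w, fN L f2 w, fN L f3 w) (J3 L u - J3 L w)\<bar> \<le> C * (norm (J3 L u - J3 L w))\<^sup>2"
proof -
  have cont: "continuous_on UNIV F" "continuous_on UNIV f1" "continuous_on UNIV f2" "continuous_on UNIV f3"
    by (rule has_derivative_continuous_on[OF F] has_derivative_continuous_on[OF f1(1)]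
        has_derivative_continuous_on[OF f2(1)] has_derivative_continuous_on[OF f3(1)])+
  obtain C1 where C1: "C1 \<ge> 0" "\<And>a b. norm a \<le> R * sqrt L \<Longrightarrow> norm b \<le> R * sqrt L \<Longrightarrow> \<bar>f1 a - f1 b\<bar> \<le> C1 * norm (a - b)"
    using C1_lipschitz_ball[OF f1] by blast
  obtain C2 where C2: "C2 \<ge> 0" "\<And>a b. norm a \<le> R * sqrt L \<Longrightarrow> norm b \<le> R * sqrt L \<Longrightarrow> \<bar>f2 a - f2 b\<bar> \<le> C2 * norm (a - b)"
    using C1_lipschitz_ball[OF f2] by blast
  obtain C3 where C3: "C3 \<ge> 0" "\<And>a b. norm a \<le> R * sqrt L \<Longrightarrow> norm b \<le> R * sqrt L \<Longrightarrow> \<bar>f3 a - f3 b\<bar> \<le> C3 * norm (a - b)"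
    using C1_lipschitz_ball[OF f3] by blast
  define C where "C = C1 + C2 + C3"
  show ?thesis
  proof (intro exI[of _ C] allI impI)
    fix u w :: "l2 \<times> l2 \<times> l2" assume b: "norm u \<le> R" "norm w \<le> R"
    define d where "d x = pt (u - w) x" for x
    define h where "h x = F (pt u x) - F (pt w x) - (f1 (pt w x) * fst (d x) + f2 (pt w x) * fst (snd (d x)) + f3 (pt w x) * snd (snd (d x)))" for x
    have cd: "continuous_on {0..L} d" unfolding d_def[abs_def] by (rule pt_cont)
    have ch: "continuous_on {0..L} h" unfolding h_def by (intro continuous_intros fN_cont cont cd)
    have hd: "\<bar>h x\<bar> \<le> C * (norm (d x) * norm (d x))" if x: "x \<in> {0..L}" for x
      using taylor_ball[OF F C1(2,1) C2(2,1) C3(2,1) pt_bound[OF x b(1)] pt_bound[OF x b(2)]]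
      by (simp add: h_def d_def pt_diff C_def power2_eq_square)
    have dc: "continuous_on {0..L} (\<lambda>x. fst (d x))" "continuous_on {0..L} (\<lambda>x. fst (snd (d x)))" "continuous_on {0..L} (\<lambda>x. snd (snd (d x)))"
      by (intro continuous_intros cd)+
    have J: "fst (J3 L u - J3 L w) = mkc L (\<lambda>x. fst (d x))" "fst (snd (J3 L u - J3 L w)) = mkc L (\<lambda>x. fst (snd (d x)))"
      "snd (snd (J3 L u - J3 L w)) = mkc L (\<lambda>x. snd (snd (d x)))"
      by (simp_all add: J3_def Jop_diff d_def pt_def Int0_diff)
    have "PhiN L F u - PhiN L F w - inner (fN L f1 w, fN L f2 w, fN L f3 w) (J3 L u - J3 L w) =
      (LINT x:{0..L}|lebesgue. F (pt u x)) - (LINT x:{0..L}|lebesgue. F (pt w x)) -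
      ((LINT x:{0..L}|lebesgue. f1 (pt w x) * fst (d x)) + (LINT x:{0..L}|lebesgue. f2 (pt w x) * fst (snd (d x))) +
       (LINT x:{0..L}|lebesgue. f3 (pt w x) * snd (snd (d x))))"
      unfolding inner_prod_def fst_conv snd_conv J PhiN_def fN_def
      by (simp only: mkc_inner[OF fN_cont[OF cont(2)] dc(1)] mkc_inner[OF fN_cont[OF cont(3)] dc(2)] mkc_inner[OF fN_cont[OF cont(4)] dc(3)] add.assoc)
    also have "\<dots> = (LINT x:{0..L}|lebesgue. h x)"
    proof -
      have i: "set_integrable lebesgue {0..L} (\<lambda>x. F (pt u x))" "set_integrable lebesgue {0..L} (\<lambda>x. F (pt w x))"
        "set_integrable lebesgue {0..L} (\<lambda>x. f1 (pt w x) * fst (d x))" "set_integrable lebesgue {0..L} (\<lambda>x. f2 (pt w x) * fst (snd (d x)))"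
        "set_integrable lebesgue {0..L} (\<lambda>x. f3 (pt w x) * snd (snd (d x)))"
        by (intro set_integrable_cont continuous_intros fN_cont cont dc)+
      show ?thesis unfolding h_def by (simp only: set_integral_add set_integral_diff i)
    qed
    also have "\<bar>\<dots>\<bar> \<le> (LINT x:{0..L}|lebesgue. C * (norm (d x) * norm (d x)))"
    proof -
      have cn: "continuous_on {0..L} (\<lambda>x. C * (norm (d x) * norm (d x)))" by (intro continuous_intros cd)
      have "\<bar>LINT x:{0..L}|lebesgue. h x\<bar> \<le> (LINT x:{0..L}|lebesgue. \<bar>h x\<bar>)"
        using set_integral_norm_bound[OF set_integrable_cont[OF ch]] by simp
      also have "\<dots> \<le> (LINT x:{0..L}|lebesgue. C * (norm (d x) * norm (d x)))"
        by (rule set_integral_mono) (auto intro!: set_integrable_cont cn hd continuous_on_rabs ch)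
      finally show ?thesis .
    qed
    also have "\<dots> = C * inner (mkc L (\<lambda>x. norm (d x))) (mkc L (\<lambda>x. norm (d x)))"
      by (subst mkc_inner) (auto intro!: continuous_intros cd)
    also have "\<dots> = C * (norm (J3 L u - J3 L w))\<^sup>2"
      using norm_mkc_pt[of L "u - w"] by (simp add: d_def[abs_def] J3_diff[OF L] flip: power2_norm_eq_inner)
    finally show "\<bar>PhiN L F u - PhiN L F w - inner (fN L f1 w, fN L f2 w, fN L f3 w) (J3 L u - J3 L w)\<bar> \<le> C * (norm (J3 L u - J3 L w))\<^sup>2" .
  qed
qed

lemma PhiN_lower:
  assumes L: "L \<ge> 0" and F: "continuous_on UNIV F" and lower: "\<And>z. - \<beta> * (norm z)\<^sup>2 - m \<le> F z"
  shows "- \<beta> * (norm (J3 L u))\<^sup>2 - m * L \<le> PhiN L F u"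
proof -
  have c: "continuous_on {0..L} (\<lambda>x. norm (pt u x) * norm (pt u x))" by (intro continuous_intros pt_cont)
  have "- \<beta> * (norm (J3 L u))\<^sup>2 - m * L = (LINT x:{0..L}|lebesgue. - \<beta> * (norm (pt u x) * norm (pt u x)) - m)"
  proof -
    have "(norm (J3 L u))\<^sup>2 = (LINT x:{0..L}|lebesgue. norm (pt u x) * norm (pt u x))"
      unfolding norm_mkc_pt[symmetric] power2_norm_eq_inner by (rule mkc_inner) (intro continuous_intros pt_cont)+
    moreover have "(LINT x:{0..L}|(lebesgue :: real measure). m) = m * L" using L by (simp add: set_lebesgue_integral_def mult.commute)
    moreover have "(LINT x:{0..L}|lebesgue. - \<beta> * (norm (pt u x) * norm (pt u x)) - m) =
        - \<beta> * (LINT x:{0..L}|lebesgue. norm (pt u x) * norm (pt u x)) - (LINT x:{0..L}|(lebesgue :: real measure). m)"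
    proof -
      have i: "set_integrable lebesgue {0..L} (\<lambda>x. - \<beta> * (norm (pt u x) * norm (pt u x)))" "set_integrable lebesgue {0..L} (\<lambda>x. m)"
        by (intro set_integrable_cont continuous_intros pt_cont)+
      show ?thesis by (simp only: set_integral_diff(2)[OF i] set_integral_mult_right)
    qed
    ultimately show ?thesis by simp
  qed
  also have "\<dots> \<le> PhiN L F u"
    unfolding PhiN_def
    by (rule set_integral_mono)
       (use lower in \<open>auto intro!: set_integrable_cont continuous_intros pt_cont fN_cont F simp: power2_eq_square\<close>)
  finally show ?thesis .
qed

text \<open>The hypothesis on grad F(z).z - F(z) has the shape of the lower bound in
  \<open>PhiN_lower\<close>, which is therefore applied to this function in place of F.\<close>

lemma fN_inner_lower:
  assumes L: "L \<ge> 0" and c: "continuous_on UNIV f1" "continuous_on UNIV f2" "continuous_on UNIV f3" "continuous_on UNIV F"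
    and lower: "\<And>z. - \<beta> * (norm z)\<^sup>2 - m \<le> f1 z * fst z + f2 z * fst (snd z) + f3 z * snd (snd z) - F z"
  shows "- \<beta> * (norm (J3 L u))\<^sup>2 - m * L + PhiN L F u \<le> inner (fN L f1 u, fN L f2 u, fN L f3 u) (J3 L u)"
proof -
  define k where "k z = f1 z * fst z + f2 z * fst (snd z) + f3 z * snd (snd z) - F z" for z
  have ck: "continuous_on UNIV k" unfolding k_def by (intro continuous_intros c)
  have "- \<beta> * (norm (J3 L u))\<^sup>2 - m * L \<le> PhiN L k u"
    by (rule PhiN_lower[OF L ck]) (simp only: k_def lower)
  also have "PhiN L k u = inner (fN L f1 u, fN L f2 u, fN L f3 u) (J3 L u) - PhiN L F u"
  proof -
    have cp: "continuous_on {0..L} (\<lambda>x. fst (pt u x))" "continuous_on {0..L} (\<lambda>x. fst (snd (pt u x)))" "continuous_on {0..L} (\<lambda>x. snd (snd (pt u x)))"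
      by (intro continuous_intros pt_cont)+
    have J: "fst (J3 L u) = mkc L (\<lambda>x. fst (pt u x))" "fst (snd (J3 L u)) = mkc L (\<lambda>x. fst (snd (pt u x)))"
      "snd (snd (J3 L u)) = mkc L (\<lambda>x. snd (snd (pt u x)))"
      by (simp_all add: J3_def Jop_def pt_def)
    have i: "set_integrable lebesgue {0..L} (\<lambda>x. F (pt u x))"
        "set_integrable lebesgue {0..L} (\<lambda>x. f1 (pt u x) * fst (pt u x))" "set_integrable lebesgue {0..L} (\<lambda>x. f2 (pt u x) * fst (snd (pt u x)))"
        "set_integrable lebesgue {0..L} (\<lambda>x. f3 (pt u x) * snd (snd (pt u x)))"
      by (intro set_integrable_cont continuous_intros fN_cont c cp)+
    show ?thesis
      unfolding inner_prod_def fst_conv snd_conv J PhiN_def fN_def k_def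
      by (simp only: mkc_inner[OF fN_cont[OF c(1)] cp(1)] mkc_inner[OF fN_cont[OF c(2)] cp(2)] mkc_inner[OF fN_cont[OF c(3)] cp(3)]
          set_integral_add set_integral_diff i add.assoc)
  qed
  finally show ?thesis by simp
qed

lemma J3_totally_bounded:
  assumes L: "L > 0" and \<eta>: "\<eta> > 0"
  shows "\<exists>X. finite X \<and> (\<forall>u. norm u \<le> R \<longrightarrow> (\<exists>x\<in>X. dist (J3 L u) x < \<eta>))"
proof -
  have "\<eta> / 3 > 0" using \<eta> by simp
  from Jop_totally_bounded[OF L this] obtain X where X: "finite X" "\<And>g. norm g \<le> R \<Longrightarrow> \<exists>z\<in>X. dist (Jop L g) z < \<eta> / 3"
    by blast
  show ?thesis
  proof (intro exI[of _ "X \<times> X \<times> X"] conjI allI impI)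
    show "finite (X \<times> X \<times> X)" using X(1) by simp
    fix u :: "l2 \<times> l2 \<times> l2" assume u: "norm u \<le> R"
    have n: "norm (fst u) \<le> R" "norm (fst (snd u)) \<le> R" "norm (snd (snd u)) \<le> R"
      using norm_component_le[of u] u by auto
    obtain x1 x2 x3 where x: "x1 \<in> X" "x2 \<in> X" "x3 \<in> X" "dist (Jop L (fst u)) x1 < \<eta> / 3"
      "dist (Jop L (fst (snd u))) x2 < \<eta> / 3" "dist (Jop L (snd (snd u))) x3 < \<eta> / 3"
      using X(2)[OF n(1)] X(2)[OF n(2)] X(2)[OF n(3)] by blast
    have "dist (J3 L u) (x1, x2, x3) < \<eta>"
      unfolding dist_norm
      by (rule le_less_trans[OF norm_triple_le]) (use x in \<open>simp add: J3_def dist_norm\<close>)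
    then show "\<exists>x\<in>X \<times> X \<times> X. dist (J3 L u) x < \<eta>" using x by (intro bexI[of _ "(x1, x2, x3)"]) auto
  qed
qed

lemma J3_injective:
  assumes L: "L > 0" and u: "u \<in> V0 L \<times> V0 L \<times> V0 L" and z: "J3 L u = 0"
  shows "u = 0"
proof -
  have "fst u = 0" "fst (snd u) = 0" "snd (snd u) = 0"
    using z u by (auto simp: J3_def V0_def zero_prod_def intro!: Jop_injective[OF L])
  then show ?thesis by (simp add: prod_eq_iff)
qed

lemma J3_wirtinger:
  assumes L: "L > 0" and u: "u \<in> V0 L \<times> V0 L \<times> V0 L"
  shows "(norm (J3 L u))\<^sup>2 \<le> L\<^sup>2 / pi\<^sup>2 * (norm u)\<^sup>2"
  using wirtinger[OF L, of "fst u"] wirtinger[OF L, of "fst (snd u)"] wirtinger[OF L, of "snd (snd u)"] u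
  unfolding norm_triple by (auto simp: J3_def distrib_left)

text \<open>The three strains of the curved beam: bending psi_x, shear phi_x + psi + l w and axial
  w_x - l phi, with \<open>Jop\<close> recovering functions from their derivatives.\<close>

definition strain :: "real \<Rightarrow> real \<Rightarrow> l2 \<times> l2 \<times> l2 \<Rightarrow> l2 \<times> l2 \<times> l2" where
  "strain L l u = (fst (snd u), fst u + Jop L (fst (snd u)) + l *\<^sub>R Jop L (snd (snd u)), snd (snd u) - l *\<^sub>R Jop L (fst u))"

text \<open>One diagonal weight serves both forms: inertia coefficients for the kinetic energy and
  stiffness coefficients for the elastic energy.\<close>

definition weight :: "real \<Rightarrow> real \<Rightarrow> real \<Rightarrow> l2 \<times> l2 \<times> l2 \<Rightarrow> l2 \<times> l2 \<times> l2" where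
  "weight a b c u = (a *\<^sub>R fst u, b *\<^sub>R fst (snd u), c *\<^sub>R snd (snd u))"

lemma weight_bounded_linear: "bounded_linear (weight a b c)"
  unfolding weight_def[abs_def]
  by (intro bounded_linear_Pair bounded_linear_compose[OF bounded_linear_scaleR_right]
      bounded_linear_compose[OF bounded_linear_fst] bounded_linear_compose[OF bounded_linear_snd]
      bounded_linear_fst bounded_linear_snd)

lemma strain_bounded_linear: "L \<ge> 0 \<Longrightarrow> bounded_linear (strain L l)"
  unfolding strain_def[abs_def]
  by (intro bounded_linear_Pair bounded_linear_add bounded_linear_sub bounded_linear_compose[OF bounded_linear_scaleR_right]
      bounded_linear_compose[OF Jop_bounded_linear]
      bounded_linear_compose[OF bounded_linear_fst] bounded_linear_compose[OF bounded_linear_snd]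
      bounded_linear_fst bounded_linear_snd)

lemma weight_form_bilinear:
  "bounded_linear T \<Longrightarrow> bounded_bilinear (\<lambda>u q. inner (weight a b c (T u)) (T q))"
  by (rule bounded_bilinear.comp[OF bounded_bilinear_inner bounded_linear_compose[OF weight_bounded_linear]])

lemma weight_form_eq:
  "inner (weight a b c u) q = a * inner (fst u) (fst q) + b * inner (fst (snd u)) (fst (snd q)) + c * inner (snd (snd u)) (snd (snd q))"
  by (simp add: weight_def inner_prod_def)

lemma weight_form_sym: "inner (weight a b c u) q = inner (weight a b c q) u"
  unfolding weight_form_eq by (simp only: inner_commute)

definition GN :: "real \<Rightarrow> (real \<Rightarrow> real) \<Rightarrow> (real \<Rightarrow> real) \<Rightarrow> (real \<Rightarrow> real) \<Rightarrow> l2 \<times> l2 \<times> l2 \<Rightarrow> l2 \<times> l2 \<times> l2" where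
  "GN L g1 g2 g3 v = (Nem L g1 (fst v), Nem L g2 (fst (snd v)), Nem L g3 (snd (snd v)))"

context
  fixes L :: real and g1 g2 g3
  assumes L: "L > 0" and g: "damping g1" "damping g2" "damping g3"
begin

lemma GN_cont: "continuous_on T (GN L g1 g2 g3)"
  unfolding GN_def
  by (intro continuous_on_Pair continuous_on_compose2[OF Nem_cont[OF g(1), of UNIV]]
      continuous_on_compose2[OF Nem_cont[OF g(2), of UNIV]] continuous_on_compose2[OF Nem_cont[OF g(3), of UNIV]]
      continuous_intros) auto

lemma GN_0: "GN L g1 g2 g3 0 = 0"
  using Nem_0[OF g(1)] Nem_0[OF g(2)] Nem_0[OF g(3)] by (simp add: GN_def zero_prod_def)

lemma GN_mono: "0 \<le> inner (GN L g1 g2 g3 v - GN L g1 g2 g3 w) (v - w)"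
  using Nem_mono[OF g(1), of L "fst v" "fst w"] Nem_mono[OF g(2), of L "fst (snd v)" "fst (snd w)"]
    Nem_mono[OF g(3), of L "snd (snd v)" "snd (snd w)"]
  by (simp add: GN_def inner_prod_def)

lemma Nem_nonneg: "damping g \<Longrightarrow> 0 \<le> inner (Nem L g v) v"
  using Nem_mono[of g L v 0] Nem_0[of g L] by simp

lemma GN_pos:
  assumes v: "v \<in> H0 L \<times> H0 L \<times> H0 L" and z: "inner (GN L g1 g2 g3 v) v = 0"
  shows "v = 0"
proof -
  have s: "inner (Nem L g1 (fst v)) (fst v) + (inner (Nem L g2 (fst (snd v))) (fst (snd v)) + inner (Nem L g3 (snd (snd v))) (snd (snd v))) = 0"
    using z by (simp add: GN_def inner_prod_def)
  have "inner (Nem L g1 (fst v)) (fst v) = 0" "inner (Nem L g2 (fst (snd v))) (fst (snd v)) = 0" "inner (Nem L g3 (snd (snd v))) (snd (snd v)) = 0"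
    using s Nem_nonneg[OF g(1), of "fst v"] Nem_nonneg[OF g(2), of "fst (snd v)"] Nem_nonneg[OF g(3), of "snd (snd v)"] by linarith+
  then have "fst v = 0" "fst (snd v) = 0" "snd (snd v) = 0"
    using v Nem_pos[OF g(1), of "fst v"] Nem_pos[OF g(2), of "fst (snd v)"] Nem_pos[OF g(3), of "snd (snd v)"] by auto
  then show ?thesis by (simp add: prod_eq_iff)
qed

lemma GN_bdd: "\<exists>C. \<forall>v. norm v \<le> R \<longrightarrow> norm (GN L g1 g2 g3 v) \<le> C"
proof -
  obtain C1 where C1: "\<And>v. norm v \<le> R \<Longrightarrow> norm (Nem L g1 v) \<le> C1" using Nem_bdd[OF g(1)] by blast
  obtain C2 where C2: "\<And>v. norm v \<le> R \<Longrightarrow> norm (Nem L g2 v) \<le> C2" using Nem_bdd[OF g(2)] by blast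
  obtain C3 where C3: "\<And>v. norm v \<le> R \<Longrightarrow> norm (Nem L g3 v) \<le> C3" using Nem_bdd[OF g(3)] by blast
  show ?thesis
  proof (intro exI[of _ "C1 + C2 + C3"] allI impI)
    fix v :: "l2 \<times> l2 \<times> l2" assume v: "norm v \<le> R"
    have "norm (fst v) \<le> R" "norm (fst (snd v)) \<le> R" "norm (snd (snd v)) \<le> R"
      using norm_component_le[of v] v by auto
    then show "norm (GN L g1 g2 g3 v) \<le> C1 + C2 + C3"
      using norm_triple_le[of "GN L g1 g2 g3 v"] C1[of "fst v"] C2[of "fst (snd v)"] C3[of "snd (snd v)"]
      by (simp add: GN_def)
  qed
qed

text \<open>Each component takes \<delta>/3; a common constant works because every dissipation term
  is nonnegative.\<close>

lemma GN_control:
  assumes \<delta>: "\<delta> > 0"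
  shows "\<exists>C\<ge>0. \<forall>v\<in>H0 L \<times> H0 L \<times> H0 L. \<forall>w\<in>H0 L \<times> H0 L \<times> H0 L. (norm (v - w))\<^sup>2 \<le>
    \<delta> + C * (inner (GN L g1 g2 g3 v - GN L g1 g2 g3 w) (v - w) + inner (GN L g1 g2 g3 v) v + inner (GN L g1 g2 g3 w) w)"
proof -
  define d where "d g v w = inner (Nem L g v - Nem L g w) (v - w) + inner (Nem L g v) v + inner (Nem L g w) w" for g v w
  have d0: "0 \<le> d g v w" if "damping g" for g v w
    using Nem_mono[OF that, of L v w] Nem_nonneg[OF that] by (simp add: d_def)
  have \<delta>3: "\<delta> / 3 > 0" using \<delta> by simp
  obtain C1 where C1: "C1 \<ge> 0" "\<And>v w. v \<in> H0 L \<Longrightarrow> w \<in> H0 L \<Longrightarrow> (norm (v - w))\<^sup>2 \<le> \<delta> / 3 + C1 * d g1 v w"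
    using Nem_control[OF g(1) L \<delta>3] unfolding d_def by blast
  obtain C2 where C2: "C2 \<ge> 0" "\<And>v w. v \<in> H0 L \<Longrightarrow> w \<in> H0 L \<Longrightarrow> (norm (v - w))\<^sup>2 \<le> \<delta> / 3 + C2 * d g2 v w"
    using Nem_control[OF g(2) L \<delta>3] unfolding d_def by blast
  obtain C3 where C3: "C3 \<ge> 0" "\<And>v w. v \<in> H0 L \<Longrightarrow> w \<in> H0 L \<Longrightarrow> (norm (v - w))\<^sup>2 \<le> \<delta> / 3 + C3 * d g3 v w"
    using Nem_control[OF g(3) L \<delta>3] unfolding d_def by blast
  define C where "C = C1 + C2 + C3"
  show ?thesis
  proof (intro exI[of _ C] conjI ballI)
    show "C \<ge> 0" using C1 C2 C3 by (simp add: C_def)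
    fix v w :: "l2 \<times> l2 \<times> l2" assume vw: "v \<in> H0 L \<times> H0 L \<times> H0 L" "w \<in> H0 L \<times> H0 L \<times> H0 L"
    let ?d1 = "d g1 (fst v) (fst w)" and ?d2 = "d g2 (fst (snd v)) (fst (snd w))" and ?d3 = "d g3 (snd (snd v)) (snd (snd w))"
    have m: "C1 * ?d1 \<le> C * ?d1" "C2 * ?d2 \<le> C * ?d2" "C3 * ?d3 \<le> C * ?d3"
      using C1(1) C2(1) C3(1) d0 g by (auto simp: C_def intro!: mult_right_mono)
    have "(norm (v - w))\<^sup>2 = (norm (fst v - fst w))\<^sup>2 + (norm (fst (snd v) - fst (snd w)))\<^sup>2 + (norm (snd (snd v) - snd (snd w)))\<^sup>2"
      by (simp add: norm_triple)
    also have "\<dots> \<le> \<delta> + C * (?d1 + ?d2 + ?d3)"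
      using C1(2)[of "fst v" "fst w"] C2(2)[of "fst (snd v)" "fst (snd w)"] C3(2)[of "snd (snd v)" "snd (snd w)"] vw m
      unfolding distrib_left by (auto simp: mem_Times_iff)
    also have "?d1 + ?d2 + ?d3 = inner (GN L g1 g2 g3 v - GN L g1 g2 g3 w) (v - w) + inner (GN L g1 g2 g3 v) v + inner (GN L g1 g2 g3 w) w"
      by (simp add: d_def GN_def inner_prod_def)
    finally show "(norm (v - w))\<^sup>2 \<le> \<delta> + C * (inner (GN L g1 g2 g3 v - GN L g1 g2 g3 w) (v - w) + inner (GN L g1 g2 g3 v) v + inner (GN L g1 g2 g3 w) w)" .
  qed
qed

end

section \<open>The Bresse system\<close>

text \<open>\<open>ip\<close> integrates over [0,L] and \<open>inner\<close> over the line; they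
  agree as soon as one factor vanishes outside the interval. Hence functions need to match their
  classes only inside [0,L].\<close>

lemma ip_eq:
  assumes f: "AE x in lebesgue. x \<in> {0..L} \<longrightarrow> f x = fn a x" and g: "AE x in lebesgue. x \<in> {0..L} \<longrightarrow> g x = fn b x"
    and H: "a \<in> H0 L \<or> b \<in> H0 L"
  shows "ip L f g = inner a b"
proof -
  have ae: "AE x in lebesgue. indicator {0..L} x *\<^sub>R (f x * g x) = fn a x * fn b x"
  proof -
    have "AE x in lebesgue. x \<notin> {0..L} \<longrightarrow> fn a x * fn b x = 0"
      using H unfolding H0_def by (auto elim!: eventually_mono)
    with f g show ?thesis by eventually_elim (auto simp: indicator_def)
  qed
  have m: "(\<lambda>x. fn a x * fn b x) \<in> borel_measurable lebesgue" by (intro borel_measurable_times fn_measurable)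
  show ?thesis
    unfolding ip_def set_lebesgue_integral_def inner_l2_def
    by (rule integral_cong_AE[OF borel_measurable_lebesgue_cong_AE[OF m ae] m ae])
qed

lemma nrm_eq:
  assumes "AE x in lebesgue. x \<in> {0..L} \<longrightarrow> f x = fn a x" "a \<in> H0 L"
  shows "nrm L f = norm a"
  unfolding nrm_def by (subst ip_eq[OF assms(1) assms(1)]) (use assms(2) in \<open>auto simp: norm_eq_sqrt_inner\<close>)

lemma sqi_of_L2fun:
  assumes f: "L2fun L f" and z: "AE x in lebesgue. x \<notin> {0..L} \<longrightarrow> f x = 0"
  shows "sqi f"
  unfolding sqi_def
proof
  show m: "f \<in> borel_measurable lebesgue" using f by (simp add: L2fun_def)
  show "integrable lebesgue (\<lambda>x. (f x)\<^sup>2)"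
  proof (rule integrable_cong_AE_imp)
    show "integrable lebesgue (\<lambda>x. indicator {0..L} x * (f x)\<^sup>2)" using f by (simp add: L2fun_def)
    show "AE x in lebesgue. indicator {0..L} x * (f x)\<^sup>2 = (f x)\<^sup>2"
      using z by eventually_elim (auto simp: indicator_def)
  qed (use m in simp)
qed

lemma L2fun_of_sqi: "sqi f \<Longrightarrow> L2fun L f"
  unfolding L2fun_def using sqi_mult_integrable[OF sqi_restrict[of f L], of f]
  by (auto dest: sqi_measurable simp: power2_eq_square mult.assoc)

lemma L2_sqi: "L2 L u \<Longrightarrow> sqi (rep_ae u)"
  unfolding L2_def using sqi_of_L2fun by blast

lemma mk_rep:
  assumes "sqi (rep_ae u)" shows "Rep_l2 (mk (rep_ae u)) = u" "fn (mk (rep_ae u)) = rep_ae u"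
proof -
  show "Rep_l2 (mk (rep_ae u)) = u" using Rep_mk[OF assms] Quotient_abs_rep[OF Quotient_aefun] by simp
  then show "fn (mk (rep_ae u)) = rep_ae u" by (simp add: fn_def)
qed

lemma mk_Rep: "mk (rep_ae (Rep_l2 v)) = v"
  using mk_fn[of v] by (simp add: fn_def)

lemma L2_H0: "L2 L u \<Longrightarrow> mk (rep_ae u) \<in> H0 L"
  using mk_rep(2)[OF L2_sqi] unfolding H0_def L2_def by simp

lemma H0_L2: "v \<in> H0 L \<Longrightarrow> L2 L (Rep_l2 v)"
  unfolding L2_def H0_def using L2fun_of_sqi[OF fn_sqi[of v]] by (simp add: fn_def)

lemma H10_deriv_dx:
  assumes "H10 L u" shows "H10_deriv L u (dx L u)"
proof -
  have "\<exists>g. H10_deriv L u g" using assms by (simp add: H10_def)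
  then show ?thesis unfolding dx_def by (rule someI_ex)
qed

lemma H10_sqi:
  assumes "H10 L u" shows "sqi (dx L u)"
proof (rule sqi_of_L2fun)
  show "L2fun L (dx L u)" using H10_deriv_dx[OF assms] by (simp add: H10_deriv_def)
  show "AE x in lebesgue. x \<notin> {0..L} \<longrightarrow> dx L u x = 0"
    using H10_deriv_dx[OF assms] by (intro AE_I2) (simp add: H10_deriv_def)
qed

lemma H10_fn: "H10 L u \<Longrightarrow> AE x in lebesgue. fn (mk (dx L u)) x = dx L u x"
  by (rule fn_mk[OF H10_sqi])

lemma Int0_mk_set: "sqi f \<Longrightarrow> Int0 (mk f) x = (LINT y:{0..x}|lebesgue. f y)"
  by (simp add: Int0_mk set_lebesgue_integral_def mult.commute)

lemma H10_V0:
  assumes "H10 L u" shows "mk (dx L u) \<in> V0 L"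
proof -
  have d: "H10_deriv L u (dx L u)" by (rule H10_deriv_dx[OF assms])
  have "mk (dx L u) \<in> H0 L"
    unfolding H0_def mem_Collect_eq using H10_fn[OF assms]
    by eventually_elim (use d in \<open>auto simp: H10_deriv_def\<close>)
  moreover have "Int0 (mk (dx L u)) L = 0"
    using d by (simp add: Int0_mk_set[OF H10_sqi[OF assms]] H10_deriv_def)
  ultimately show ?thesis by (simp add: V0_def)
qed

lemma H10_L2: "H10 L u \<Longrightarrow> L2 L u"
  by (simp add: H10_def)

text \<open>Whatever derivative \<open>dx\<close> selects, it integrates back to u; this identifies
  \<open>Jop\<close> with the embedding of H^1_0.\<close>

lemma H10_Jop:
  assumes "H10 L u" shows "Jop L (mk (dx L u)) = mk (rep_ae u)"
proof (rule l2_eqI)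
  have "AE x in lebesgue. rep_ae u x = (if x \<in> {0..L} then (LINT y:{0..x}|lebesgue. dx L u y) else 0)"
    using H10_deriv_dx[OF assms] by (simp add: H10_deriv_def)
  then show "AE x in lebesgue. fn (Jop L (mk (dx L u))) x = fn (mk (rep_ae u)) x"
    unfolding mk_rep(2)[OF L2_sqi[OF H10_L2[OF assms]]] using Jop_fn[of L "mk (dx L u)"]
    by eventually_elim (auto simp: Int0_mk_set[OF H10_sqi[OF assms]] indicator_def)
qed

lemma H10_rep:
  assumes "H10 L u" shows "fn (Jop L (mk (dx L u))) = rep_ae u" "Rep_l2 (Jop L (mk (dx L u))) = u"
  unfolding H10_Jop[OF assms] using mk_rep[OF L2_sqi[OF H10_L2[OF assms]]] by auto

lemma nrm_dx:
  assumes "H10 L u" shows "nrm L (dx L u) = norm (mk (dx L u))"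
proof (rule nrm_eq)
  show "AE x in lebesgue. x \<in> {0..L} \<longrightarrow> dx L u x = fn (mk (dx L u)) x"
    using H10_fn[OF assms] by eventually_elim simp
  show "mk (dx L u) \<in> H0 L" using H10_V0[OF assms] by (simp add: V0_def)
qed

text \<open>\<open>dx\<close> selects among derivatives that may differ on null sets. That its class
  is g follows from injectivity of \<open>Jop\<close>, since both have the same primitive.\<close>

lemma V0_H10:
  assumes L: "L > 0" and g: "g \<in> V0 L"
  shows "H10 L (Rep_l2 (Jop L g))" "mk (dx L (Rep_l2 (Jop L g))) = g"
proof -
  define u where "u = Rep_l2 (Jop L g)"
  \<comment> \<open>\<open>H10_deriv\<close> demands vanishing at every point outside [0,L], not
    just almost everywhere, so the representative of g is cut off.\<close>
  define d where "d x = indicator {0..L} x * fn g x" for x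
  have sd: "sqi d" unfolding d_def by (rule sqi_restrict[OF fn_sqi])
  have dg: "(LINT y:{0..x}|lebesgue. d y) = Int0 g x" if "x \<le> L" for x
    unfolding Int0_set set_lebesgue_integral_def
    by (rule Bochner_Integration.integral_cong) (use that in \<open>auto simp: d_def indicator_def\<close>)
  have "H10_deriv L u d"
    unfolding H10_deriv_def
  proof (intro conjI allI impI)
    show "L2fun L d" by (rule L2fun_of_sqi[OF sd])
    show "d x = 0" if "x \<notin> {0..L}" for x using that by (simp add: d_def)
    show "(LINT y:{0..L}|lebesgue. d y) = 0" using dg[of L] g by (simp add: V0_def)
    show "AE x in lebesgue. rep_ae u x = (if x \<in> {0..L} then (LINT y:{0..x}|lebesgue. d y) else 0)"
      using Jop_fn[of L g] unfolding fn_def u_def[symmetric]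
      by eventually_elim (auto simp: dg indicator_def)
  qed
  then show H: "H10 L (Rep_l2 (Jop L g))"
    unfolding H10_def u_def using H0_L2[OF Jop_H0] by blast
  have V: "mk (dx L u) \<in> V0 L" using H10_V0 H by (simp add: u_def)
  have "Jop L (mk (dx L u)) = Jop L g" using H10_Jop[OF H] mk_Rep by (simp add: u_def)
  then have "Jop L (mk (dx L u) - g) = 0"
    using linear_diff[OF bounded_linear.linear[OF Jop_bounded_linear], of L "mk (dx L u)" g] L by simp
  moreover have "mk (dx L u) - g \<in> H0 L" using V g by (auto simp: V0_def intro!: subspace_diff[OF H0_subspace])
  ultimately have "mk (dx L u) - g = 0" by (rule Jop_injective[OF L, rotated])
  then show "mk (dx L (Rep_l2 (Jop L g))) = g" by (simp add: u_def)
qed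

text \<open>Recording displacements by their derivatives makes the H^1_0 part of the metric an L^2
  norm, so that \<open>emb\<close> is an isometry for \<open>dH\<close>, with inverse
  \<open>uem\<close>.\<close>

definition emb :: "real \<Rightarrow> state \<Rightarrow> (l2 \<times> l2 \<times> l2) \<times> (l2 \<times> l2 \<times> l2)" where
  "emb L y = ((mk (dx L (c1 y)), mk (dx L (c2 y)), mk (dx L (c3 y))),
     (mk (rep_ae (c4 y)), mk (rep_ae (c5 y)), mk (rep_ae (c6 y))))"

definition uem :: "real \<Rightarrow> (l2 \<times> l2 \<times> l2) \<times> (l2 \<times> l2 \<times> l2) \<Rightarrow> state" where
  "uem L z = (Rep_l2 (Jop L (fst (fst z))), Rep_l2 (Jop L (fst (snd (fst z)))), Rep_l2 (Jop L (snd (snd (fst z)))),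
     Rep_l2 (fst (snd z)), Rep_l2 (fst (snd (snd z))), Rep_l2 (snd (snd (snd z))))"

abbreviation V3 :: "real \<Rightarrow> (l2 \<times> l2 \<times> l2) set" where "V3 L \<equiv> V0 L \<times> V0 L \<times> V0 L"
abbreviation H3 :: "real \<Rightarrow> (l2 \<times> l2 \<times> l2) set" where "H3 L \<equiv> H0 L \<times> H0 L \<times> H0 L"

lemmas c_defs = c1_def c2_def c3_def c4_def c5_def c6_def

lemma emb_in: "y \<in> phase L \<Longrightarrow> emb L y \<in> V3 L \<times> H3 L"
  by (auto simp: phase_def emb_def intro!: H10_V0 L2_H0)

lemma uem_emb:
  assumes "y \<in> phase L" shows "uem L (emb L y) = y"
proof -
  have "uem L (emb L y) = (c1 y, c2 y, c3 y, c4 y, c5 y, c6 y)"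
    using assms by (simp add: phase_def uem_def emb_def H10_rep mk_rep(1)[OF L2_sqi[of L]])
  then show ?thesis by (simp add: c_defs)
qed

lemma uem_in:
  assumes "L > 0" "z \<in> V3 L \<times> H3 L" shows "uem L z \<in> phase L"
  using assms V0_H10(1)[OF assms(1)] by (auto simp: phase_def uem_def c_defs H0_L2)

lemma emb_uem:
  assumes "L > 0" "z \<in> V3 L \<times> H3 L" shows "emb L (uem L z) = z"
  using assms(2) V0_H10(2)[OF assms(1)] by (auto simp: emb_def uem_def c_defs mk_Rep)

lemma nrm_mk_diff:
  assumes "mk f \<in> H0 L" "mk g \<in> H0 L" "sqi f" "sqi g"
  shows "nrm L (\<lambda>x. f x - g x) = norm (mk f - mk g)"
proof (rule nrm_eq)
  show "mk f - mk g \<in> H0 L" using assms by (intro subspace_diff[OF H0_subspace])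
  show "AE x in lebesgue. x \<in> {0..L} \<longrightarrow> f x - g x = fn (mk f - mk g) x"
    using fn_diff[of "mk f" "mk g"] fn_mk[OF assms(3)] fn_mk[OF assms(4)] by eventually_elim simp
qed

lemma dH_emb:
  assumes y: "y \<in> phase L" and z: "z \<in> phase L"
  shows "dH L y z = dist (emb L y) (emb L z)"
proof -
  have V: "g \<in> V0 L \<Longrightarrow> g \<in> H0 L" for g by (simp add: V0_def)
  have 1: "nrm L (\<lambda>x. dx L (c y) x - dx L (c z) x) = norm (mk (dx L (c y)) - mk (dx L (c z)))"
    if "H10 L (c y)" "H10 L (c z)" for c
    by (rule nrm_mk_diff[OF V[OF H10_V0[OF that(1)]] V[OF H10_V0[OF that(2)]] H10_sqi[OF that(1)] H10_sqi[OF that(2)]])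
  have 2: "nrm L (\<lambda>x. rep_ae (c y) x - rep_ae (c z) x) = norm (mk (rep_ae (c y)) - mk (rep_ae (c z)))"
    if "L2 L (c y)" "L2 L (c z)" for c
    by (rule nrm_mk_diff[OF L2_H0[OF that(1)] L2_H0[OF that(2)] L2_sqi[OF that(1)] L2_sqi[OF that(2)]])
  show ?thesis
    using y z unfolding dH_def phase_def
    by (simp add: 1[of c1] 1[of c2] 1[of c3] 2[of c4] 2[of c5] 2[of c6])
       (simp add: emb_def dist_prod_def dist_norm add.assoc)
qed

lemma damping_I:
  assumes "\<forall>s. (g has_real_derivative g' s) (at s)" "continuous_on UNIV g'" "strict_mono g" "g 0 = 0"
    "m > 0" "M > 0" "\<forall>s. \<bar>s\<bar> > 1 \<longrightarrow> m * s\<^sup>2 \<le> g s * s \<and> g s * s \<le> M * s\<^sup>2"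
  shows "damping g"
  unfolding damping_def using assms by blast

text \<open>Difference quotients of representatives represent the difference quotients of the
  classes, and \<open>nrm\<close> of their deviation from the velocity is a distance in
  \<open>l2\<close>.\<close>

lemma vel_deriv_has_vector_derivative:
  assumes v: "vel_deriv L u v" and u: "\<And>t. t \<ge> 0 \<Longrightarrow> L2 L (u t)" "\<And>t. t \<ge> 0 \<Longrightarrow> L2 L (v t)" and t: "t \<ge> 0"
  shows "((\<lambda>s. mk (rep_ae (u s))) has_vector_derivative mk (rep_ae (v t))) (at t within {0..})"
proof -
  have "((\<lambda>s. nrm L (\<lambda>x. (rep_ae (u s) x - rep_ae (u t) x) / (s - t) - rep_ae (v t) x)) \<longlongrightarrow> 0) (at t within {0..})"
    using v t by (simp add: vel_deriv_def)
  moreover have "\<forall>\<^sub>F s in at t within {0..}.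
      nrm L (\<lambda>x. (rep_ae (u s) x - rep_ae (u t) x) / (s - t) - rep_ae (v t) x) =
      dist ((mk (rep_ae (u s)) - mk (rep_ae (u t))) /\<^sub>R (s - t)) (mk (rep_ae (v t)))"
    unfolding eventually_at_filter
  proof (intro always_eventually allI impI)
    fix s :: real assume "s \<noteq> t" "s \<in> {0..}"
    then have s: "s \<ge> 0" by simp
    let ?a = "mk (rep_ae (u s))" and ?b = "mk (rep_ae (u t))" and ?c = "mk (rep_ae (v t))"
    show "nrm L (\<lambda>x. (rep_ae (u s) x - rep_ae (u t) x) / (s - t) - rep_ae (v t) x) = dist ((?a - ?b) /\<^sub>R (s - t)) ?c"
      unfolding dist_norm
    proof (rule nrm_eq)
      show "(?a - ?b) /\<^sub>R (s - t) - ?c \<in> H0 L"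
        using u s t by (intro subspace_diff[OF H0_subspace] subspace_scale[OF H0_subspace] L2_H0)
      show "AE x in lebesgue. x \<in> {0..L} \<longrightarrow> (rep_ae (u s) x - rep_ae (u t) x) / (s - t) - rep_ae (v t) x =
          fn ((?a - ?b) /\<^sub>R (s - t) - ?c) x"
        using fn_diff[of "(?a - ?b) /\<^sub>R (s - t)" ?c] fn_scaleR[of "inverse (s - t)" "?a - ?b"] fn_diff[of ?a ?b]
        unfolding mk_rep(2)[OF L2_sqi[OF u(1)[OF s]]] mk_rep(2)[OF L2_sqi[OF u(1)[OF t]]] mk_rep(2)[OF L2_sqi[OF u(2)[OF t]]]
        by eventually_elim (simp add: divide_inverse mult.commute)
    qed
  qed
  ultimately have "((\<lambda>s. dist ((mk (rep_ae (u s)) - mk (rep_ae (u t))) /\<^sub>R (s - t)) (mk (rep_ae (v t)))) \<longlongrightarrow> 0) (at t within {0..})"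
    by (rule Lim_transform_eventually)
  then show ?thesis unfolding has_vector_derivative_iff_quotient by (simp add: tendsto_dist_iff[symmetric])
qed

text \<open>The hypotheses in the shape the proof uses: arguments of F are single vectors z, so that
  u^2 + v^2 + w^2 is the squared norm, and the damping conditions are bundled.\<close>

locale bresse =
  fixes L \<rho>1 \<rho>2 b k k0 l \<gamma> \<beta> mF :: real
    and F f1 f2 f3 :: "real \<times> real \<times> real \<Rightarrow> real"
    and D1 D2 D3 :: "real \<times> real \<times> real \<Rightarrow> real \<times> real \<times> real"
    and g1 g2 g3 :: "real \<Rightarrow> real"
    and S :: "real \<Rightarrow> state \<Rightarrow> state"
  assumes pos: "L > 0" "\<rho>1 > 0" "\<rho>2 > 0"
    and gamma: "\<gamma> > 0"
      "\<And>\<phi> \<psi> w. H10 L \<phi> \<Longrightarrow> H10 L \<psi> \<Longrightarrow> H10 L w \<Longrightarrow>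
         (nrm L (dx L \<phi>))\<^sup>2 + (nrm L (dx L \<psi>))\<^sup>2 + (nrm L (dx L w))\<^sup>2 \<le>
         \<gamma> * (b * (nrm L (dx L \<psi>))\<^sup>2
              + k * (nrm L (\<lambda>x. dx L \<phi> x + rep_ae \<psi> x + l * rep_ae w x))\<^sup>2
              + k0 * (nrm L (\<lambda>x. dx L w x - l * rep_ae \<phi> x))\<^sup>2)"
    and F: "\<And>z. (F has_derivative (\<lambda>h. f1 z * fst h + f2 z * fst (snd h) + f3 z * snd (snd h))) (at z)"
    and f1: "\<And>z. (f1 has_derivative (\<lambda>h. D1 z \<bullet> h)) (at z)" "continuous_on UNIV D1"
    and f2: "\<And>z. (f2 has_derivative (\<lambda>h. D2 z \<bullet> h)) (at z)" "continuous_on UNIV D2"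
    and f3: "\<And>z. (f3 has_derivative (\<lambda>h. D3 z \<bullet> h)) (at z)" "continuous_on UNIV D3"
    and beta: "\<beta> \<ge> 0" "mF \<ge> 0" "\<beta> < pi\<^sup>2 / (2 * \<gamma> * L\<^sup>2)"
    and F_lower: "\<And>z. - \<beta> * (norm z)\<^sup>2 - mF \<le> F z"
    and f_lower: "\<And>z. - \<beta> * (norm z)\<^sup>2 - mF \<le> f1 z * fst z + f2 z * fst (snd z) + f3 z * snd (snd z) - F z"
    and g: "damping g1" "damping g2" "damping g3"
    and semigroup: "\<And>y. y \<in> phase L \<Longrightarrow> bresse_sol L \<rho>1 \<rho>2 b k k0 l g1 g2 g3 f1 f2 f3 y (\<lambda>t. S t y)"
begin

definition M where "M v w = inner (weight \<rho>1 \<rho>2 \<rho>1 v) w"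
definition A where "A u q = inner (weight b k k0 (strain L l u)) (strain L l q)"
definition f where "f u = (fN L f1 u, fN L f2 u, fN L f3 u)"
definition T where "T t z = emb L (S t (uem L z))"
text \<open>What is left of half the elastic energy after the fraction \<beta> \<gamma> L^2/pi^2 of
  it has been spent on the negative part of the potential; the division by \<gamma> converts elastic
  energy into the norm.\<close>

definition \<kappa> where "\<kappa> = (1 / 2 - \<beta> * \<gamma> * L\<^sup>2 / pi\<^sup>2) / \<gamma>"

lemma nonlinearity_cont: "continuous_on UNIV F" "continuous_on UNIV f1" "continuous_on UNIV f2" "continuous_on UNIV f3"
  by (rule has_derivative_continuous_on[OF F] has_derivative_continuous_on[OF f1(1)]
      has_derivative_continuous_on[OF f2(1)] has_derivative_continuous_on[OF f3(1)])+

lemma strain_components: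
  assumes u: "u \<in> V3 L"
  shows "fst (strain L l u) \<in> H0 L" "fst (snd (strain L l u)) \<in> H0 L" "snd (snd (strain L l u)) \<in> H0 L"
  using u by (auto simp: strain_def V0_def intro!: subspace_add[OF H0_subspace] subspace_diff[OF H0_subspace]
      subspace_scale[OF H0_subspace] Jop_H0)

lemma shear_fn:
  assumes y: "H10 L \<phi>" "H10 L \<psi>" "H10 L w"
  shows "AE x in lebesgue. x \<in> {0..L} \<longrightarrow> dx L \<phi> x + rep_ae \<psi> x + l * rep_ae w x =
    fn (mk (dx L \<phi>) + Jop L (mk (dx L \<psi>)) + l *\<^sub>R Jop L (mk (dx L w))) x"
    "AE x in lebesgue. x \<in> {0..L} \<longrightarrow> dx L w x - l * rep_ae \<phi> x =
    fn (mk (dx L w) - l *\<^sub>R Jop L (mk (dx L \<phi>))) x"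
proof -
  let ?p = "mk (dx L \<phi>)" and ?q = "Jop L (mk (dx L \<psi>))" and ?r = "Jop L (mk (dx L w))"
  show "AE x in lebesgue. x \<in> {0..L} \<longrightarrow> dx L \<phi> x + rep_ae \<psi> x + l * rep_ae w x = fn (?p + ?q + l *\<^sub>R ?r) x"
    using fn_add[of "?p + ?q" "l *\<^sub>R ?r"] fn_add[of ?p ?q] fn_scaleR[of l ?r] H10_fn[OF y(1)]
    by eventually_elim (simp add: H10_rep(1)[OF y(2)] H10_rep(1)[OF y(3)])
  show "AE x in lebesgue. x \<in> {0..L} \<longrightarrow> dx L w x - l * rep_ae \<phi> x = fn (mk (dx L w) - l *\<^sub>R Jop L (mk (dx L \<phi>))) x"
    using fn_diff[of "mk (dx L w)" "l *\<^sub>R Jop L (mk (dx L \<phi>))"] fn_scaleR[of l "Jop L (mk (dx L \<phi>))"] H10_fn[OF y(3)]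
    by eventually_elim (simp add: H10_rep(1)[OF y(1)])
qed

text \<open>The inequality defining \<gamma>, read for the displacements whose derivatives are the
  components of u.\<close>

lemma A_coercive:
  assumes u: "u \<in> V3 L" shows "1 / \<gamma> * (norm u)\<^sup>2 \<le> A u u"
proof -
  obtain u1 u2 u3 where u_eq: "u = (u1, u2, u3)" and uV: "u1 \<in> V0 L" "u2 \<in> V0 L" "u3 \<in> V0 L" using u by auto
  have uH: "u1 \<in> H0 L" "u2 \<in> H0 L" "u3 \<in> H0 L" using uV by (auto simp: V0_def)
  define \<phi> where "\<phi> = Rep_l2 (Jop L u1)"
  define \<psi> where "\<psi> = Rep_l2 (Jop L u2)"
  define w where "w = Rep_l2 (Jop L u3)"
  have h: "H10 L \<phi>" "H10 L \<psi>" "H10 L w" and d: "mk (dx L \<phi>) = u1" "mk (dx L \<psi>) = u2" "mk (dx L w) = u3"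
    using V0_H10[OF pos(1)] uV by (auto simp: \<phi>_def \<psi>_def w_def)
  have nd: "nrm L (dx L \<phi>) = norm u1" "nrm L (dx L \<psi>) = norm u2" "nrm L (dx L w) = norm u3"
    using nrm_dx[OF h(1)] nrm_dx[OF h(2)] nrm_dx[OF h(3)] by (simp_all add: d)
  have st: "strain L l u = (u2, u1 + Jop L u2 + l *\<^sub>R Jop L u3, u3 - l *\<^sub>R Jop L u1)"
    by (simp add: strain_def u_eq)
  have n2: "nrm L (\<lambda>x. dx L \<phi> x + rep_ae \<psi> x + l * rep_ae w x) = norm (u1 + Jop L u2 + l *\<^sub>R Jop L u3)"
    using strain_components(2)[OF u] shear_fn(1)[OF h] by (intro nrm_eq) (simp_all add: d st)
  have n3: "nrm L (\<lambda>x. dx L w x - l * rep_ae \<phi> x) = norm (u3 - l *\<^sub>R Jop L u1)"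
    using strain_components(3)[OF u] shear_fn(2)[OF h] by (intro nrm_eq) (simp_all add: d st)
  have "(norm u)\<^sup>2 \<le> \<gamma> * A u u"
    using gamma(2)[OF h] unfolding nd n2 n3 norm_triple u_eq fst_conv snd_conv
    by (simp add: A_def weight_form_eq st[unfolded u_eq] power2_norm_eq_inner)
  then show ?thesis using gamma(1) by (simp add: field_simps)
qed

text \<open>Wirtinger's inequality followed by coercivity; the bound on \<beta> makes the resulting
  factor less than 1/2.\<close>

lemma J_A: "u \<in> V3 L \<Longrightarrow> \<beta> * (norm (J3 L u))\<^sup>2 \<le> (\<beta> * \<gamma> * L\<^sup>2 / pi\<^sup>2) * A u u"
proof -
  assume u: "u \<in> V3 L"
  have "(norm u)\<^sup>2 \<le> \<gamma> * A u u" using A_coercive[OF u] gamma(1) by (simp add: field_simps)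
  then have "L\<^sup>2 / pi\<^sup>2 * (norm u)\<^sup>2 \<le> L\<^sup>2 / pi\<^sup>2 * (\<gamma> * A u u)" by (intro mult_left_mono) auto
  with J3_wirtinger[OF pos(1) u] have "(norm (J3 L u))\<^sup>2 \<le> L\<^sup>2 / pi\<^sup>2 * (\<gamma> * A u u)" by linarith
  then have "\<beta> * (norm (J3 L u))\<^sup>2 \<le> \<beta> * (L\<^sup>2 / pi\<^sup>2 * (\<gamma> * A u u))" using beta(1) by (intro mult_left_mono)
  then show ?thesis by (simp add: mult_ac)
qed

lemma \<kappa>_pos: "\<kappa> > 0"
proof -
  have "\<beta> * (2 * \<gamma> * L\<^sup>2) < pi\<^sup>2" using beta(3) gamma(1) pos(1) by (simp add: pos_less_divide_eq)
  then have "\<beta> * \<gamma> * L\<^sup>2 / pi\<^sup>2 < 1 / 2" by (simp add: divide_less_eq mult_ac)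
  then show ?thesis using gamma(1) by (simp add: \<kappa>_def)
qed

text \<open>Let \<theta> < 1/2 be the factor of \<open>J_A\<close>. The first bound spends \<theta>
  once against half of \<open>A\<close>. The second spends it twice against all of \<open>A\<close>,
  once for (F4) and once for (F2). Each use costs mF L, hence the common constant.\<close>

lemma coercive:
  assumes u: "u \<in> V3 L"
  shows "\<kappa> * (norm u)\<^sup>2 - 2 * mF * L \<le> A u u / 2 + PhiN L F u"
    and "\<kappa> * (norm u)\<^sup>2 - 2 * mF * L \<le> A u u + inner (f u) (J3 L u)"
proof -
  define \<theta> where "\<theta> = \<beta> * \<gamma> * L\<^sup>2 / pi\<^sup>2"
  have L: "L \<ge> 0" and mL: "mF * L \<ge> 0" using pos(1) beta(2) by auto
  have \<theta>: "\<theta> < 1 / 2" using \<kappa>_pos gamma(1) by (simp add: \<kappa>_def \<theta>_def zero_less_divide_iff)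
  have "(1 / 2 - \<theta>) * (1 / \<gamma> * (norm u)\<^sup>2) \<le> (1 / 2 - \<theta>) * A u u"
    using A_coercive[OF u] \<theta> by (intro mult_left_mono) auto
  moreover have "\<kappa> * (norm u)\<^sup>2 = (1 / 2 - \<theta>) * (1 / \<gamma> * (norm u)\<^sup>2)" by (simp add: \<kappa>_def \<theta>_def)
  ultimately have ka: "\<kappa> * (norm u)\<^sup>2 \<le> A u u / 2 - \<theta> * A u u" by (simp add: left_diff_distrib)
  have k0: "0 \<le> \<kappa> * (norm u)\<^sup>2" using \<kappa>_pos by simp
  have P: "- \<theta> * A u u - mF * L \<le> PhiN L F u"
    using PhiN_lower[OF L nonlinearity_cont(1) F_lower, of u] J_A[OF u] by (simp add: \<theta>_def)
  then show "\<kappa> * (norm u)\<^sup>2 - 2 * mF * L \<le> A u u / 2 + PhiN L F u" using ka mL by simp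
  have "- \<theta> * A u u - mF * L + PhiN L F u \<le> inner (f u) (J3 L u)"
    using fN_inner_lower[OF L nonlinearity_cont(2,3,4,1) f_lower, of u] J_A[OF u] by (simp add: \<theta>_def f_def)
  then show "\<kappa> * (norm u)\<^sup>2 - 2 * mF * L \<le> A u u + inner (f u) (J3 L u)" using ka k0 P mL by simp
qed

text \<open>The coupling terms of the three equations are the \<open>Jop\<close> parts of the strain
  of the test triple, so the sum of the equations is the single symmetric form \<open>A\<close> plus
  forces.\<close>

lemma weak_forms:
  assumes y: "y \<in> phase L" and q: "q \<in> V3 L"
  defines "u \<equiv> fst (emb L y)" and "v \<equiv> snd (emb L y)"
  shows "E1 L k k0 l g1 f1 y (Rep_l2 (Jop L (fst q))) + E2 L b k l g2 f2 y (Rep_l2 (Jop L (fst (snd q)))) +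
     E3 L k k0 l g3 f3 y (Rep_l2 (Jop L (snd (snd q)))) =
     A u q + inner (GN L g1 g2 g3 v + f u) (J3 L q)"
proof -
  obtain q1 q2 q3 where q_eq: "q = (q1, q2, q3)" and qV: "q1 \<in> V0 L" "q2 \<in> V0 L" "q3 \<in> V0 L" using q by auto
  have qH: "q1 \<in> H0 L" "q2 \<in> H0 L" "q3 \<in> H0 L" using qV by (auto simp: V0_def)
  have c: "H10 L (c1 y)" "H10 L (c2 y)" "H10 L (c3 y)" "L2 L (c4 y)" "L2 L (c5 y)" "L2 L (c6 y)"
    using y by (auto simp: phase_def)
  let ?u1 = "mk (dx L (c1 y))" and ?u2 = "mk (dx L (c2 y))" and ?u3 = "mk (dx L (c3 y))"
  let ?v1 = "mk (rep_ae (c4 y))" and ?v2 = "mk (rep_ae (c5 y))" and ?v3 = "mk (rep_ae (c6 y))"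
  have u: "u = (?u1, ?u2, ?u3)" and v: "v = (?v1, ?v2, ?v3)" by (simp_all add: u_def v_def emb_def)
  define s2 where "s2 = ?u1 + Jop L ?u2 + l *\<^sub>R Jop L ?u3"
  define s3 where "s3 = ?u3 - l *\<^sub>R Jop L ?u1"
  have rq: "AE x in lebesgue. x \<in> {0..L} \<longrightarrow> rep_ae (Rep_l2 (Jop L p)) x = fn (Jop L p) x" for p
    by (simp add: fn_def)
  have dq: "AE x in lebesgue. x \<in> {0..L} \<longrightarrow> dx L (Rep_l2 (Jop L p)) x = fn p x" if "p \<in> V0 L" for p
    using H10_fn[OF V0_H10(1)[OF pos(1) that]] unfolding V0_H10(2)[OF pos(1) that] by eventually_elim simp
  have du2: "AE x in lebesgue. x \<in> {0..L} \<longrightarrow> dx L (c2 y) x = fn ?u2 x"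
    using H10_fn[OF c(2)] by eventually_elim simp
  have sh: "AE x in lebesgue. x \<in> {0..L} \<longrightarrow> dx L (c1 y) x + rep_ae (c2 y) x + l * rep_ae (c3 y) x = fn s2 x"
    "AE x in lebesgue. x \<in> {0..L} \<longrightarrow> dx L (c3 y) x - l * rep_ae (c1 y) x = fn s3 x"
    using shear_fn[OF c(1,2,3)] by (simp_all add: s2_def s3_def)
  have gN: "AE x in lebesgue. x \<in> {0..L} \<longrightarrow> g (rep_ae w x) = fn (Nem L g (mk (rep_ae w))) x"
    if "damping g" "L2 L w" for g w
    using Nem_fn[OF that(1), of L "mk (rep_ae w)"] unfolding mk_rep(2)[OF L2_sqi[OF that(2)]]
    by eventually_elim simp
  have fNe: "AE x in lebesgue. x \<in> {0..L} \<longrightarrow> h (rep_ae (c1 y) x, rep_ae (c2 y) x, rep_ae (c3 y) x) = fn (fN L h u) x"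
    if "continuous_on UNIV h" for h
    using Jop_fn[of L ?u1] Jop_fn[of L ?u2] Jop_fn[of L ?u3] mkc_fn[OF fN_cont[OF that, of L u]]
    unfolding H10_rep(1)[OF c(1)] H10_rep(1)[OF c(2)] H10_rep(1)[OF c(3)] fN_def
    by eventually_elim (simp add: pt_def u)
  have JH: "x \<in> H0 L \<or> Jop L p \<in> H0 L" for x p by (simp add: Jop_H0)
  have e1: "E1 L k k0 l g1 f1 y (Rep_l2 (Jop L q1)) = k * inner s2 q1 - k0 * l * inner s3 (Jop L q1) +
      inner (Nem L g1 ?v1) (Jop L q1) + inner (fN L f1 u) (Jop L q1)"
    unfolding E1_def
    by (simp only: ip_eq[OF sh(1) dq[OF qV(1)] disjI2[OF qH(1)]] ip_eq[OF sh(2) rq JH]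
        ip_eq[OF gN[OF g(1) c(4)] rq JH] ip_eq[OF fNe[OF nonlinearity_cont(2)] rq JH])
  have e2: "E2 L b k l g2 f2 y (Rep_l2 (Jop L q2)) = b * inner ?u2 q2 + k * inner s2 (Jop L q2) +
      inner (Nem L g2 ?v2) (Jop L q2) + inner (fN L f2 u) (Jop L q2)"
    unfolding E2_def
    by (simp only: ip_eq[OF du2 dq[OF qV(2)] disjI2[OF qH(2)]] ip_eq[OF sh(1) rq JH]
        ip_eq[OF gN[OF g(2) c(5)] rq JH] ip_eq[OF fNe[OF nonlinearity_cont(3)] rq JH])
  have e3: "E3 L k k0 l g3 f3 y (Rep_l2 (Jop L q3)) = k0 * inner s3 q3 + k * l * inner s2 (Jop L q3) +
      inner (Nem L g3 ?v3) (Jop L q3) + inner (fN L f3 u) (Jop L q3)"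
    unfolding E3_def
    by (simp only: ip_eq[OF sh(2) dq[OF qV(3)] disjI2[OF qH(3)]] ip_eq[OF sh(1) rq JH]
        ip_eq[OF gN[OF g(3) c(6)] rq JH] ip_eq[OF fNe[OF nonlinearity_cont(4)] rq JH])
  have "A u q = b * inner ?u2 q2 + k * inner s2 (q1 + Jop L q2 + l *\<^sub>R Jop L q3) + k0 * inner s3 (q3 - l *\<^sub>R Jop L q1)"
    by (simp add: A_def weight_form_eq strain_def u q_eq s2_def s3_def)
  moreover have "inner (GN L g1 g2 g3 v + f u) (J3 L q) =
      (inner (Nem L g1 ?v1) (Jop L q1) + inner (fN L f1 u) (Jop L q1)) +
      (inner (Nem L g2 ?v2) (Jop L q2) + inner (fN L f2 u) (Jop L q2)) +
      (inner (Nem L g3 ?v3) (Jop L q3) + inner (fN L f3 u) (Jop L q3))"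
    by (simp add: GN_def f_def J3_def v q_eq inner_prod_def inner_add_left)
  ultimately show ?thesis
    unfolding q_eq fst_conv snd_conv e1 e2 e3
    by (simp add: inner_add_right inner_diff_right algebra_simps)
qed

lemma sol_properties:
  assumes "y \<in> phase L"
  shows "S 0 y = y" "\<And>t. t \<ge> 0 \<Longrightarrow> S t y \<in> phase L"
    "\<And>t. t \<ge> 0 \<Longrightarrow> ((\<lambda>s. dH L (S s y) (S t y)) \<longlongrightarrow> 0) (at t within {0..})"
    "vel_deriv L (\<lambda>s. c1 (S s y)) (\<lambda>s. c4 (S s y))"
    "vel_deriv L (\<lambda>s. c2 (S s y)) (\<lambda>s. c5 (S s y))"
    "vel_deriv L (\<lambda>s. c3 (S s y)) (\<lambda>s. c6 (S s y))"
    "\<And>q t. H10 L q \<Longrightarrow> t \<ge> 0 \<Longrightarrow> ((\<lambda>s. E1 L k k0 l g1 f1 (S s y) q) has_integral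
       (\<rho>1 * ip L (rep_ae (c4 (S 0 y))) (rep_ae q) - \<rho>1 * ip L (rep_ae (c4 (S t y))) (rep_ae q))) {0..t}"
    "\<And>q t. H10 L q \<Longrightarrow> t \<ge> 0 \<Longrightarrow> ((\<lambda>s. E2 L b k l g2 f2 (S s y) q) has_integral
       (\<rho>2 * ip L (rep_ae (c5 (S 0 y))) (rep_ae q) - \<rho>2 * ip L (rep_ae (c5 (S t y))) (rep_ae q))) {0..t}"
    "\<And>q t. H10 L q \<Longrightarrow> t \<ge> 0 \<Longrightarrow> ((\<lambda>s. E3 L k k0 l g3 f3 (S s y) q) has_integral
       (\<rho>1 * ip L (rep_ae (c6 (S 0 y))) (rep_ae q) - \<rho>1 * ip L (rep_ae (c6 (S t y))) (rep_ae q))) {0..t}"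
  using semigroup[OF assms] unfolding bresse_sol_def by auto

lemma fst_emb_J3: "y \<in> phase L \<Longrightarrow> J3 L (fst (emb L y)) = (mk (rep_ae (c1 y)), mk (rep_ae (c2 y)), mk (rep_ae (c3 y)))"
  by (simp add: J3_def emb_def phase_def H10_Jop)

lemma T_weak:
  assumes y: "y \<in> phase L" and q: "q \<in> V3 L" and t: "t \<ge> 0"
  shows "((\<lambda>s. A (fst (emb L (S s y))) q + inner (GN L g1 g2 g3 (snd (emb L (S s y))) + f (fst (emb L (S s y)))) (J3 L q)) has_integral
     (M (snd (emb L (S 0 y))) (J3 L q) - M (snd (emb L (S t y))) (J3 L q))) {0..t}"
proof -
  obtain q1 q2 q3 where q_eq: "q = (q1, q2, q3)" and qV: "q1 \<in> V0 L" "q2 \<in> V0 L" "q3 \<in> V0 L" using q by auto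
  note H = V0_H10(1)[OF pos(1) qV(1)] V0_H10(1)[OF pos(1) qV(2)] V0_H10(1)[OF pos(1) qV(3)]
  note P = sol_properties[OF y]
  have ipc: "ip L (rep_ae w) (rep_ae (Rep_l2 (Jop L p))) = inner (mk (rep_ae w)) (Jop L p)" if "L2 L w" for w p
    by (rule ip_eq) (use mk_rep(2)[OF L2_sqi[OF that]] Jop_H0 in \<open>auto simp: fn_def\<close>)
  have c: "L2 L (c4 (S r y))" "L2 L (c5 (S r y))" "L2 L (c6 (S r y))" if "r \<ge> 0" for r
    using P(2)[OF that] by (auto simp: phase_def)
  have Mv: "M (snd (emb L (S r y))) (J3 L q) = \<rho>1 * ip L (rep_ae (c4 (S r y))) (rep_ae (Rep_l2 (Jop L q1))) +
      \<rho>2 * ip L (rep_ae (c5 (S r y))) (rep_ae (Rep_l2 (Jop L q2))) + \<rho>1 * ip L (rep_ae (c6 (S r y))) (rep_ae (Rep_l2 (Jop L q3)))"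
    if "r \<ge> 0" for r
    by (simp add: M_def weight_form_eq J3_def emb_def q_eq ipc c[OF that])
  have "((\<lambda>s. E1 L k k0 l g1 f1 (S s y) (Rep_l2 (Jop L q1)) + E2 L b k l g2 f2 (S s y) (Rep_l2 (Jop L q2)) +
     E3 L k k0 l g3 f3 (S s y) (Rep_l2 (Jop L q3))) has_integral
     (M (snd (emb L (S 0 y))) (J3 L q) - M (snd (emb L (S t y))) (J3 L q))) {0..t}"
    using has_integral_add[OF has_integral_add[OF P(7)[OF H(1) t] P(8)[OF H(2) t]] P(9)[OF H(3) t]]
    by (simp add: Mv[OF t] Mv[of 0] algebra_simps)
  then show ?thesis
  proof (rule has_integral_eq[rotated])
    fix s assume "s \<in> {0..t}"
    then show "E1 L k k0 l g1 f1 (S s y) (Rep_l2 (Jop L q1)) + E2 L b k l g2 f2 (S s y) (Rep_l2 (Jop L q2)) +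
      E3 L k k0 l g3 f3 (S s y) (Rep_l2 (Jop L q3)) =
      A (fst (emb L (S s y))) q + inner (GN L g1 g2 g3 (snd (emb L (S s y))) + f (fst (emb L (S s y)))) (J3 L q)"
      using weak_forms[OF P(2) q, of s] by (simp add: q_eq)
  qed
qed

sublocale damped_wave "V3 L" "H3 L" "J3 L" M A "min \<rho>1 \<rho>2" "1 / \<gamma>" "GN L g1 g2 g3" f "PhiN L F" T \<kappa> "2 * mF * L"
proof (intro damped_wave.intro wave_forms.intro damped_wave_axioms.intro)
  have L: "L \<ge> 0" using pos(1) by simp
  show "subspace (V3 L)" by (intro subspace_Times V0_subspace)
  show "closed (V3 L)" by (intro closed_Times V0_closed)
  show "subspace (H3 L)" by (intro subspace_Times H0_subspace)
  show "closed (H3 L)" by (intro closed_Times H0_closed)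
  show "bounded_linear (J3 L)" by (rule J3_bounded_linear[OF L])
  show "J3 L u \<in> H3 L" for u by (simp add: J3_def Jop_H0)
  show "u = 0" if "u \<in> V3 L" "J3 L u = 0" for u by (rule J3_injective[OF pos(1) that])
  show "bounded_bilinear M" unfolding M_def[abs_def] by (rule weight_form_bilinear) simp
  show "M x y = M y x" for x y unfolding M_def by (rule weight_form_sym)
  show "min \<rho>1 \<rho>2 > 0" using pos by simp
  show "min \<rho>1 \<rho>2 * (norm x)\<^sup>2 \<le> M x x" for x
  proof -
    have "min \<rho>1 \<rho>2 * a\<^sup>2 \<le> \<rho>1 * a\<^sup>2" "min \<rho>1 \<rho>2 * a\<^sup>2 \<le> \<rho>2 * a\<^sup>2" for a :: real by (intro mult_right_mono; simp)+
    then show ?thesis unfolding M_def weight_form_eq norm_triple distrib_left power2_norm_eq_inner[symmetric]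
      by (intro add_mono)
  qed
  show "bounded_bilinear A" unfolding A_def[abs_def] by (rule weight_form_bilinear[OF strain_bounded_linear[OF L]])
  show "A x y = A y x" for x y unfolding A_def by (rule weight_form_sym)
  show "1 / \<gamma> > 0" using gamma by simp
  show "1 / \<gamma> * (norm u)\<^sup>2 \<le> A u u" if "u \<in> V3 L" for u by (rule A_coercive[OF that])
  show "continuous_on (H3 L) (GN L g1 g2 g3)" by (rule GN_cont[OF pos(1) g])
  show "GN L g1 g2 g3 0 = 0" by (rule GN_0[OF pos(1) g])
  show "0 \<le> inner (GN L g1 g2 g3 v - GN L g1 g2 g3 w) (v - w)" for v w by (rule GN_mono[OF pos(1) g])
  show "v = 0" if "v \<in> H3 L" "inner (GN L g1 g2 g3 v) v = 0" for v by (rule GN_pos[OF pos(1) g that])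
  show "\<exists>C. \<forall>v\<in>H3 L. norm v \<le> R \<longrightarrow> norm (GN L g1 g2 g3 v) \<le> C" for R
    using GN_bdd[OF pos(1) g, of R] by blast
  show "\<exists>C\<ge>0. \<forall>v\<in>H3 L. \<forall>w\<in>H3 L. (norm (v - w))\<^sup>2 \<le> \<delta> + C * (inner (GN L g1 g2 g3 v - GN L g1 g2 g3 w) (v - w) +
      inner (GN L g1 g2 g3 v) v + inner (GN L g1 g2 g3 w) w)" if "\<delta> > 0" for \<delta>
    by (rule GN_control[OF pos(1) g that])
  show "\<exists>C. \<forall>u\<in>V3 L. \<forall>w\<in>V3 L. norm u \<le> R \<longrightarrow> norm w \<le> R \<longrightarrow> norm (f u - f w) \<le> C * norm (J3 L u - J3 L w)" for R
  proof -
    obtain C1 where C1: "\<And>u w. norm u \<le> R \<Longrightarrow> norm w \<le> R \<Longrightarrow> norm (fN L f1 u - fN L f1 w) \<le> C1 * norm (J3 L u - J3 L w)"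
      using fN_lipschitz[OF L f1, of R] by blast
    obtain C2 where C2: "\<And>u w. norm u \<le> R \<Longrightarrow> norm w \<le> R \<Longrightarrow> norm (fN L f2 u - fN L f2 w) \<le> C2 * norm (J3 L u - J3 L w)"
      using fN_lipschitz[OF L f2, of R] by blast
    obtain C3 where C3: "\<And>u w. norm u \<le> R \<Longrightarrow> norm w \<le> R \<Longrightarrow> norm (fN L f3 u - fN L f3 w) \<le> C3 * norm (J3 L u - J3 L w)"
      using fN_lipschitz[OF L f3, of R] by blast
    show ?thesis
    proof (intro exI[of _ "C1 + C2 + C3"] ballI impI)
      fix u w :: "l2 \<times> l2 \<times> l2" assume b: "norm u \<le> R" "norm w \<le> R"
      show "norm (f u - f w) \<le> (C1 + C2 + C3) * norm (J3 L u - J3 L w)"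
        using norm_triple_le[of "f u - f w"] C1[OF b] C2[OF b] C3[OF b] by (simp add: f_def distrib_right)
    qed
  qed
  show "\<exists>C. \<forall>u\<in>V3 L. \<forall>w\<in>V3 L. norm u \<le> R \<longrightarrow> norm w \<le> R \<longrightarrow>
      \<bar>PhiN L F u - PhiN L F w - inner (f w) (J3 L u - J3 L w)\<bar> \<le> C * (norm (J3 L u - J3 L w))\<^sup>2" for R
    using PhiN_taylor[OF L F f1 f2 f3, of R] unfolding f_def by blast
  show "\<kappa> > 0" by (rule \<kappa>_pos)
  show "\<kappa> * (norm u)\<^sup>2 - 2 * mF * L \<le> A u u / 2 + PhiN L F u" if "u \<in> V3 L" for u by (rule coercive(1)[OF that])
  show "\<kappa> * (norm u)\<^sup>2 - 2 * mF * L \<le> A u u + inner (f u) (J3 L u)" if "u \<in> V3 L" for u by (rule coercive(2)[OF that])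
  show "\<exists>X. finite X \<and> (\<forall>u\<in>V3 L. norm u \<le> R \<longrightarrow> (\<exists>x\<in>X. dist (J3 L u) x < \<eta>))" if "\<eta> > 0" for R \<eta>
    using J3_totally_bounded[OF pos(1) that, of R] by blast
  \<comment> \<open>What remains concerns the evolution and is transported from the weak solution
    through \<open>emb\<close>.\<close>
  fix z assume z: "z \<in> V3 L \<times> H3 L"
  have y: "uem L z \<in> phase L" by (rule uem_in[OF pos(1) z])
  note P = sol_properties[OF y]
  show "T 0 z = z" by (simp add: T_def P(1) emb_uem[OF pos(1) z])
  show "T t z \<in> V3 L \<times> H3 L" if "t \<ge> 0" for t unfolding T_def by (rule emb_in[OF P(2)[OF that]])
  show "continuous_on {0..} (\<lambda>t. T t z)"
    unfolding continuous_on_def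
  proof
    fix t :: real assume t: "t \<in> {0..}"
    have "((\<lambda>s. dist (T s z) (T t z)) \<longlongrightarrow> 0) (at t within {0..})"
    proof (rule Lim_transform_eventually)
      show "((\<lambda>s. dH L (S s (uem L z)) (S t (uem L z))) \<longlongrightarrow> 0) (at t within {0..})" using P(3) t by simp
      show "\<forall>\<^sub>F s in at t within {0..}. dH L (S s (uem L z)) (S t (uem L z)) = dist (T s z) (T t z)"
        unfolding eventually_at_filter T_def using t by (intro always_eventually) (auto intro!: dH_emb P(2))
    qed
    then show "((\<lambda>t. T t z) \<longlongrightarrow> T t z) (at t within {0..})" by (simp add: tendsto_dist_iff[symmetric])
  qed
  show "((\<lambda>s. J3 L (fst (T s z))) has_vector_derivative snd (T t z)) (at t within {0..})" if t: "t \<ge> 0" for t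
  proof -
    have c: "L2 L (c1 (S s (uem L z)))" "L2 L (c2 (S s (uem L z)))" "L2 L (c3 (S s (uem L z)))"
      "L2 L (c4 (S s (uem L z)))" "L2 L (c5 (S s (uem L z)))" "L2 L (c6 (S s (uem L z)))" if "s \<ge> 0" for s
      using P(2)[OF that] by (auto simp: phase_def H10_L2)
    have "((\<lambda>s. (mk (rep_ae (c1 (S s (uem L z)))), mk (rep_ae (c2 (S s (uem L z)))), mk (rep_ae (c3 (S s (uem L z))))))
        has_vector_derivative snd (T t z)) (at t within {0..})"
      unfolding T_def emb_def snd_conv
      by (intro has_vector_derivative_Pair vel_deriv_has_vector_derivative[OF P(4)] vel_deriv_has_vector_derivative[OF P(5)]
          vel_deriv_has_vector_derivative[OF P(6)] c t)
    then show ?thesis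
      by (rule has_vector_derivative_transform[rotated 2]) (use t fst_emb_J3[OF P(2)] in \<open>auto simp: T_def\<close>)
  qed
  show "((\<lambda>s. A (fst (T s z)) q + inner (GN L g1 g2 g3 (snd (T s z)) + f (fst (T s z))) (J3 L q)) has_integral
      (M (snd (T 0 z)) (J3 L q) - M (snd (T t z)) (J3 L q))) {0..t}" if "q \<in> V3 L" "t \<ge> 0" for q t
    unfolding T_def by (rule T_weak[OF y that])
qed

section \<open>Transfer of the attractor to the phase space\<close>

lemma conjugate:
  assumes "y \<in> phase L" "t \<ge> 0" shows "S t y = uem L (T t (emb L y))" "T t (emb L y) = emb L (S t y)"
  using assms by (simp_all add: T_def uem_emb sol_properties(2))

lemma stationary_iff:
  assumes y: "y \<in> phase L" shows "y \<in> stationary L S \<longleftrightarrow> emb L y \<in> Stat"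
proof
  assume "y \<in> stationary L S"
  then show "emb L y \<in> Stat"
    using emb_in[OF y] unfolding Stat_def by (simp add: P_def stationary_def conjugate(2)[OF y])
next
  assume "emb L y \<in> Stat"
  then show "y \<in> stationary L S" using y by (simp add: stationary_def Stat_def conjugate(1)[OF y] uem_emb)
qed

lemma uem_P: "z \<in> P \<Longrightarrow> uem L z \<in> phase L \<and> emb L (uem L z) = z"
  using uem_in[OF pos(1)] emb_uem[OF pos(1)] by (simp add: P_def)

lemma emb_P: "y \<in> phase L \<Longrightarrow> emb L y \<in> P"
  using emb_in by (simp add: P_def)

text \<open>Full trajectories correspond under \<open>emb\<close> and \<open>uem\<close>, and
  distances are preserved, so backward convergence to stationary states transfers in both
  directions.\<close>

lemma Unst_iff:
  assumes y: "y \<in> phase L" shows "y \<in> unstable_manifold L S (stationary L S) \<longleftrightarrow> emb L y \<in> Unst"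
proof
  assume "y \<in> unstable_manifold L S (stationary L S)"
  then obtain u where u: "\<And>s. u s \<in> phase L" "\<And>t s. t \<ge> 0 \<Longrightarrow> u (t + s) = S t (u s)" "u 0 = y"
    and d: "\<And>\<epsilon>. \<epsilon> > 0 \<Longrightarrow> \<exists>T. \<forall>t\<le>T. \<exists>z\<in>stationary L S. dH L (u t) z < \<epsilon>"
    unfolding unstable_manifold_def by blast
  show "emb L y \<in> Unst"
    unfolding Unst_def mem_Collect_eq
  proof (intro exI[of _ "\<lambda>s. emb L (u s)"] conjI allI impI)
    fix \<epsilon> :: real assume "\<epsilon> > 0"
    then obtain T0 where T0: "\<And>t. t \<le> T0 \<Longrightarrow> \<exists>z\<in>stationary L S. dH L (u t) z < \<epsilon>" using d by blast
    show "\<exists>T. \<forall>t\<le>T. \<exists>z\<in>Stat. dist (emb L (u t)) z < \<epsilon>"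
    proof (intro exI[of _ T0] allI impI)
      fix t assume "t \<le> T0"
      then obtain z where z: "z \<in> stationary L S" "dH L (u t) z < \<epsilon>" using T0 by blast
      then have zp: "z \<in> phase L" by (simp add: stationary_def)
      show "\<exists>z\<in>Stat. dist (emb L (u t)) z < \<epsilon>"
        using z stationary_iff[OF zp] dH_emb[OF u(1) zp] by (intro bexI[of _ "emb L z"]) auto
    qed
  qed (use u emb_P conjugate(2)[OF u(1)] in auto)
next
  assume "emb L y \<in> Unst"
  then obtain u where u: "\<And>s. u s \<in> P" "\<And>t s. t \<ge> 0 \<Longrightarrow> u (t + s) = T t (u s)" "u 0 = emb L y"
    and d: "\<And>\<epsilon>. \<epsilon> > 0 \<Longrightarrow> \<exists>T. \<forall>t\<le>T. \<exists>z\<in>Stat. dist (u t) z < \<epsilon>"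
    unfolding Unst_def by blast
  show "y \<in> unstable_manifold L S (stationary L S)"
    unfolding unstable_manifold_def mem_Collect_eq
  proof (intro exI[of _ "\<lambda>s. uem L (u s)"] conjI allI impI)
    show "uem L (u s) \<in> phase L" for s using uem_P u(1) by blast
    show "uem L (u (t + s)) = S t (uem L (u s))" if "t \<ge> 0" for t s
      using uem_P[OF u(1), of s] conjugate(1)[of "uem L (u s)" t] u(2)[OF that, of s] that by simp
    show "uem L (u 0) = y" using u(3) uem_emb[OF y] by simp
    fix \<epsilon> :: real assume "\<epsilon> > 0"
    then obtain T0 where T0: "\<And>t. t \<le> T0 \<Longrightarrow> \<exists>z\<in>Stat. dist (u t) z < \<epsilon>" using d by blast
    show "\<exists>T. \<forall>t\<le>T. \<exists>z\<in>stationary L S. dH L (uem L (u t)) z < \<epsilon>"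
    proof (intro exI[of _ T0] allI impI)
      fix t assume "t \<le> T0"
      then obtain z where z: "z \<in> Stat" "dist (u t) z < \<epsilon>" using T0 by blast
      then have zp: "z \<in> P" by (simp add: Stat_def)
      show "\<exists>z\<in>stationary L S. dH L (uem L (u t)) z < \<epsilon>"
        using z uem_P[OF zp] uem_P[OF u(1)[of t]] stationary_iff[of "uem L z"] dH_emb[of "uem L (u t)" L "uem L z"]
        by (intro bexI[of _ "uem L z"]) auto
    qed
  qed
qed

text \<open>The abstract attractor carried over by \<open>uem\<close>; compactness and attraction
  survive because \<open>emb\<close> is an isometry of the phase space onto
  \<open>P\<close>.\<close>

theorem attractor: "\<exists>A. global_attractor L S A \<and> A = unstable_manifold L S (stationary L S)"
proof -
  from attractor_exists obtain K where K: "K \<subseteq> P" "compact K" "\<forall>t\<ge>0. T t ` K = K"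
    and attr: "\<forall>B. B \<subseteq> P \<and> bounded B \<longrightarrow> (\<forall>\<epsilon>>0. \<exists>s. \<forall>t\<ge>s. \<forall>a\<in>T t ` B. \<exists>z\<in>K. dist a z < \<epsilon>)"
    and KU: "K = Unst" by (elim exE conjE)
  define B where "B = uem L ` K"
  have Bp: "B \<subseteq> phase L" using uem_P K(1) by (auto simp: B_def)
  have "B = unstable_manifold L S (stationary L S)"
  proof (intro set_eqI iffI)
    fix y assume "y \<in> B"
    then obtain z where "z \<in> K" "y = uem L z" by (auto simp: B_def)
    then show "y \<in> unstable_manifold L S (stationary L S)"
      using uem_P[of z] K(1) KU Unst_iff[of y] by auto
  next
    fix y assume y: "y \<in> unstable_manifold L S (stationary L S)"
    then have "y \<in> phase L" unfolding unstable_manifold_def by auto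
    then show "y \<in> B" using y Unst_iff[of y] KU uem_emb[of y L] unfolding B_def by (metis imageI)
  qed
  moreover have "global_attractor L S B"
    unfolding global_attractor_def
  proof (intro conjI allI impI)
    show "compact_H L B"
      unfolding compact_H_def
    proof (intro conjI allI impI Bp)
      fix x :: "nat \<Rightarrow> state" assume x: "\<forall>n. x n \<in> B"
      then have xp: "x n \<in> phase L" for n using Bp by blast
      have "emb L (x n) \<in> K" for n
      proof -
        have "x n \<in> uem L ` K" using x by (simp add: B_def)
        then obtain z where "z \<in> K" "x n = uem L z" by blast
        then show ?thesis using uem_P[of z] K(1) by auto
      qed
      then obtain a r where a: "a \<in> K" "strict_mono (r :: nat \<Rightarrow> nat)" "(\<lambda>n. emb L (x (r n))) \<longlonglongrightarrow> a"
        using K(2) unfolding compact_def o_def by meson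
      have ap: "uem L a \<in> phase L" "emb L (uem L a) = a" using uem_P[of a] K(1) a(1) by auto
      have "(\<lambda>n. dH L (x (r n)) (uem L a)) = (\<lambda>n. dist (emb L (x (r n))) a)"
        using dH_emb[OF xp ap(1)] ap(2) by auto
      moreover have "(\<lambda>n. dist (emb L (x (r n))) a) \<longlonglongrightarrow> 0" using a(3) by (simp add: tendsto_dist_iff[symmetric])
      ultimately show "\<exists>a\<in>B. \<exists>r. strict_mono r \<and> (\<lambda>n. dH L (x (r n)) a) \<longlonglongrightarrow> 0"
        using a(1,2) unfolding B_def by (intro bexI[of _ "uem L a"] exI[of _ r]) auto
    qed
    show "S t ` B = B" if t: "t \<ge> 0" for t
    proof -
      have "S t (uem L z) = uem L (T t z)" if "z \<in> K" for z
        using conjugate(1)[of "uem L z" t] uem_P[of z] K(1) that t by auto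
      then have "S t ` B = uem L ` (T t ` K)" unfolding B_def image_image by (intro image_cong) auto
      then show ?thesis using K(3) t by (simp add: B_def)
    qed
    fix C and \<epsilon> :: real assume C: "bounded_H L C" and \<epsilon>: "\<epsilon> > 0"
    then obtain y0 R where Cp: "C \<subseteq> phase L" and y0: "y0 \<in> phase L" "\<And>y. y \<in> C \<Longrightarrow> dH L y0 y \<le> R"
      unfolding bounded_H_def by blast
    have "bounded (emb L ` C)"
      unfolding bounded_def
    proof (intro exI[of _ "emb L y0"] exI[of _ R] ballI)
      fix z assume "z \<in> emb L ` C"
      then obtain y where "y \<in> C" "z = emb L y" by blast
      then show "dist (emb L y0) z \<le> R" using y0(2)[of y] dH_emb[OF y0(1), of y] Cp by auto
    qed
    moreover have "emb L ` C \<subseteq> P" using emb_P Cp by auto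
    ultimately have "\<exists>s. \<forall>t\<ge>s. \<forall>a\<in>T t ` emb L ` C. \<exists>z\<in>K. dist a z < \<epsilon>"
      using attr[rule_format, OF _ \<epsilon>, of "emb L ` C"] by simp
    then obtain s where s: "\<And>t a. t \<ge> s \<Longrightarrow> a \<in> T t ` emb L ` C \<Longrightarrow> \<exists>z\<in>K. dist a z < \<epsilon>" by blast
    show "\<exists>T. \<forall>t\<ge>T. \<forall>a\<in>S t ` C. \<exists>z\<in>B. dH L a z < \<epsilon>"
    \<comment> \<open>The abstract threshold s may be negative, where nothing is known about
      \<open>S\<close>; hence the maximum with 0.\<close>
    proof (intro exI[of _ "max s 0"] allI impI ballI)
      fix t a assume t: "t \<ge> max s 0" and "a \<in> S t ` C"
      then obtain y where y: "y \<in> C" "a = S t y" by blast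
      have yp: "y \<in> phase L" using Cp y by blast
      have ap: "a \<in> phase L" using sol_properties(2)[OF yp] t y by simp
      have e: "emb L a = T t (emb L y)" using conjugate(2)[OF yp] t y by simp
      obtain z where z: "z \<in> K" "dist (emb L a) z < \<epsilon>" using s[of t "emb L a"] t e y(1) by auto
      have "uem L z \<in> phase L" "emb L (uem L z) = z" using uem_P[of z] z(1) K(1) by auto
      then show "\<exists>z\<in>B. dH L a z < \<epsilon>"
        using z dH_emb[OF ap, of "uem L z"] unfolding B_def by (intro bexI[of _ "uem L z"]) auto
    qed
  qed
  ultimately show ?thesis by blast
qed

end

theorem theorem4p1:
  fixes L \<rho>1 \<rho>2 b k k0 l \<gamma>3 \<beta> mF p Cf m1 m2 m3 M1 M2 M3 :: real
    and F f1 f2 f3 :: "real \<times> real \<times> real \<Rightarrow> real"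
    and DF1 DF2 DF3 :: "real \<times> real \<times> real \<Rightarrow> real \<times> real \<times> real"
    and g1 g2 g3 g1' g2' g3' :: "real \<Rightarrow> real"
    and S :: "real \<Rightarrow> state \<Rightarrow> state"
  assumes pos: "L > 0" "\<rho>1 > 0" "\<rho>2 > 0" "b > 0" "k > 0" "k0 > 0" "l > 0"
    and gamma3: "\<gamma>3 > 0"
      "\<forall>\<phi> \<psi> w. H10 L \<phi> \<and> H10 L \<psi> \<and> H10 L w \<longrightarrow>
         (nrm L (dx L \<phi>))\<^sup>2 + (nrm L (dx L \<psi>))\<^sup>2 + (nrm L (dx L w))\<^sup>2 \<le>
         \<gamma>3 * (b * (nrm L (dx L \<psi>))\<^sup>2
              + k * (nrm L (\<lambda>x. dx L \<phi> x + rep_ae \<psi> x + l * rep_ae w x))\<^sup>2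
              + k0 * (nrm L (\<lambda>x. dx L w x - l * rep_ae \<phi> x))\<^sup>2)"
    and F1: "\<forall>z. (F has_derivative (\<lambda>h. f1 z * fst h + f2 z * fst (snd h) + f3 z * snd (snd h))) (at z)"
      "\<forall>z. (f1 has_derivative (\<lambda>h. DF1 z \<bullet> h)) (at z)" "continuous_on UNIV DF1"
      "\<forall>z. (f2 has_derivative (\<lambda>h. DF2 z \<bullet> h)) (at z)" "continuous_on UNIV DF2"
      "\<forall>z. (f3 has_derivative (\<lambda>h. DF3 z \<bullet> h)) (at z)" "continuous_on UNIV DF3"
    and F2: "\<beta> \<ge> 0" "mF \<ge> 0" "\<beta> < pi\<^sup>2 / (2 * \<gamma>3 * L\<^sup>2)"
      "\<forall>u v w. F (u, v, w) \<ge> - \<beta> * (u\<^sup>2 + v\<^sup>2 + w\<^sup>2) - mF"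
    and F3: "p \<ge> 1" "Cf > 0"
      "\<forall>u v w. norm (DF1 (u, v, w)) \<le> Cf * (1 + \<bar>u\<bar> powr (p - 1) + \<bar>v\<bar> powr (p - 1) + \<bar>w\<bar> powr (p - 1))"
      "\<forall>u v w. norm (DF2 (u, v, w)) \<le> Cf * (1 + \<bar>u\<bar> powr (p - 1) + \<bar>v\<bar> powr (p - 1) + \<bar>w\<bar> powr (p - 1))"
      "\<forall>u v w. norm (DF3 (u, v, w)) \<le> Cf * (1 + \<bar>u\<bar> powr (p - 1) + \<bar>v\<bar> powr (p - 1) + \<bar>w\<bar> powr (p - 1))"
    and F4: "\<forall>u v w. f1 (u, v, w) * u + f2 (u, v, w) * v + f3 (u, v, w) * w - F (u, v, w)
                      \<ge> - \<beta> * (u\<^sup>2 + v\<^sup>2 + w\<^sup>2) - mF"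
    and G1: "\<forall>s. (g1 has_real_derivative g1' s) (at s)" "continuous_on UNIV g1'"
      "\<forall>s. (g2 has_real_derivative g2' s) (at s)" "continuous_on UNIV g2'"
      "\<forall>s. (g3 has_real_derivative g3' s) (at s)" "continuous_on UNIV g3'"
      "strict_mono g1" "strict_mono g2" "strict_mono g3"
      "g1 0 = 0" "g2 0 = 0" "g3 0 = 0"
    and G2: "m1 > 0" "M1 > 0" "m2 > 0" "M2 > 0" "m3 > 0" "M3 > 0"
      "\<forall>s. \<bar>s\<bar> > 1 \<longrightarrow> m1 * s\<^sup>2 \<le> g1 s * s \<and> g1 s * s \<le> M1 * s\<^sup>2"
      "\<forall>s. \<bar>s\<bar> > 1 \<longrightarrow> m2 * s\<^sup>2 \<le> g2 s * s \<and> g2 s * s \<le> M2 * s\<^sup>2"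
      "\<forall>s. \<bar>s\<bar> > 1 \<longrightarrow> m3 * s\<^sup>2 \<le> g3 s * s \<and> g3 s * s \<le> M3 * s\<^sup>2"
    and semigroup: "\<forall>y0\<in>phase L. bresse_sol L \<rho>1 \<rho>2 b k k0 l g1 g2 g3 f1 f2 f3 y0 (\<lambda>t. S t y0)"
  shows "\<exists>A. global_attractor L S A \<and> A = unstable_manifold L S (stationary L S)"
proof -
  have norm_sq: "(norm z)\<^sup>2 = (fst z)\<^sup>2 + (fst (snd z))\<^sup>2 + (snd (snd z))\<^sup>2" for z :: "real \<times> real \<times> real"
    by (simp add: norm_triple)
  interpret bresse L \<rho>1 \<rho>2 b k k0 l \<gamma>3 \<beta> mF F f1 f2 f3 DF1 DF2 DF3 g1 g2 g3 S
  proof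
    show "- \<beta> * (norm z)\<^sup>2 - mF \<le> F z" for z
      using F2(4)[rule_format, of "fst z" "fst (snd z)" "snd (snd z)"] by (simp add: norm_sq)
    show "- \<beta> * (norm z)\<^sup>2 - mF \<le> f1 z * fst z + f2 z * fst (snd z) + f3 z * snd (snd z) - F z" for z
      using F4[rule_format, of "fst z" "fst (snd z)" "snd (snd z)"] by (simp add: norm_sq)
    show "damping g1" by (rule damping_I[OF G1(1,2,7,10) G2(1,2,7)])
    show "damping g2" by (rule damping_I[OF G1(3,4,8,11) G2(3,4,8)])
    show "damping g3" by (rule damping_I[OF G1(5,6,9,12) G2(5,6,9)])
  qed (use pos gamma3 F1 F2 semigroup in auto)
  show ?thesis by (rule attractor)
qed

end
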